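(* Let $G$ be an infinite graph. Then, up to $\mathcal C$-equivalence (respectively up to topological equivalence of the induced spaces): (i) $\mathcal C_{\mathfrak F}$ is the least $\mathcal C$-system, i.e. $\mathcal C_{\mathfrak F}\le_{\mathcal C}\mathcal C_\alpha$ for every $\mathcal C$-system $\mathcal C_\alpha$ of $G$; (ii) $\mathcal C_{\mathcal U}$ is the greatest $\mathcal C$-system, i.e. $\mathcal C_\alpha\le_{\mathcal C}\mathcal C_{\mathcal U}$ for every $\mathcal C$-system $\mathcal C_\alpha$; (iii) $\mathfrak FG$ is the coarsest $\Omega$-compactification of $G$ induced by a $\mathcal C$-system, i.e. $\mathfrak FG\le\alpha G$ for every space $\alpha G$ induced by a $\mathcal C$-system; (iv) $\vartheta G$ is the finest $\Omega$-compactification of $G$ induced by a $\mathcal C$-system, i.e. $\alpha G\le\vartheta G$ for every such $\alpha G$.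
   Context: $\mathcal X$: finite subsets of $V(G)$; $\mathcal C_X$: components of $G-X$ (discrete); $\phi_{X',X}$ ($X\subseteq X'$) sends a component of $G-X'$ to the component of $G-X$ containing it. A $\mathcal C$-system $\mathcal C_\alpha=\{(\alpha(\mathcal C_X),\alpha_X),\mathfrak a_{X',X}\}$ consists of Hausdorff compactifications $(\alpha(\mathcal C_X),\alpha_X)$ of $\mathcal C_X$ and continuous maps $\mathfrak a_{X',X}:\alpha(\mathcal C_{X'})\to\alpha(\mathcal C_X)$ forming an inverse system with $\mathfrak a_{X',X}\circ\alpha_{X'}=\alpha_X\circ\phi_{X',X}$. For compactifications, $(K,h)\le(K',h')$ iff there is a continuous $f:K'\to K$ with $f\circ h'=h$. $\mathcal C_\alpha\le_{\mathcal C}\mathcal C_\delta$ iff for each $X$ some $f_X$ witnesses $(\alpha(\mathcal C_X),\alpha_X)\le(\delta(\mathcal C_X),\delta_X)$ and $f_X\circ\mathfrak d_{X',X}=\mathfrak a_{X',X}\circ f_{X'}$; $\mathcal C$-equivalent means $\le_{\mathcal C}$ in both directions. Induced space: with $\mathcal I_\alpha=\varprojlim\alpha(\mathcal C_X)$ and projections $\pi_X$, $\alpha G=G\cup\mathcal I_\alpha$ (G the 1-complex: edges copies of $[0,1]$, vertex neighbourhoods unions of half-open intervals at the vertex) with the topology generated by the open sets of the 1-complex and the sets $\bigcup\mathcal C\cup\mathring E(X,\bigcup\mathcal C)\cup\pi_X^{-1}(O)$, $O$ open in $\alpha(\mathcal C_X)$, $\mathcal C=\alpha_X^{-1}(O)$,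 $\mathring E(X,\bigcup\mathcal C)$ the inner points of edges between $X$ and $\bigcup\mathcal C$. Each end $\omega$ is identified with $(\alpha_X(C(X,\omega)))_X$, $C(X,\omega)$ the component of $G-X$ containing tails of rays of $\omega$. For induced spaces, $\alpha G\le\delta G$ means there is a continuous map $\delta G\to\alpha G$ fixing every point of $G$ and every end. Such a space is an $\Omega$-compactification (a compactification of $G\cup\Omega$ with the topology whose end neighbourhoods are $C(X,\omega)\cup\{\text{ends living in }C(X,\omega)\}\cup\mathring E(X,C(X,\omega))$, Hausdorff after deleting inner edge points). $\mathcal C_{\mathcal U}=\{(\mathcal U_X,c_X),f_{X',X}\}$: $\mathcal U_X$ all ultrafilters on $\mathcal C_X$ with Stone topology, $c_X(C)$ the principal ultrafilter of $\{C\}$, $f_{X',X}(U')=\{\mathcal C:\exists\mathcal C'\in U',\mathcal C\supseteq\phi_{X',X}[\mathcal C']\}$; its induced space is the tangle compactification $\vartheta G$. $\mathcal C_{\mathfrak F}=\{(\mathfrak F_X,c_X),\mathfrak f_{X',X}\}$ with induced space $\mathfrak FG$: $\mathcal C_X(Y)$ the components of $G-X$ with neighbourhood exactly $Y$, $\mathrm{crit}(X)=\{Y\subseteq X:\mathcal C_X(Y)\text{ infinite}\}$, $\mathcal F_X(Y)$ the set of $\mathcal C\subseteq\mathcal C_X$ containing a cofinite subset of $\mathcal C_X(Y)$, $\mathfrak F_X=\{c_X(C)\}\cup\{\mathcal F_X(Y):Y\in\mathrm{crit}(X)\}$ with topology generated by $\{\mathcal F:\mathcal C\in\mathcal F\}$,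 $\mathfrak f_{X',X}(c_{X'}(C'))=c_X(\phi_{X',X}(C'))$, $\mathfrak f_{X',X}(\mathcal F_{X'}(Y))=\mathcal F_X(Y)$ if $Y\subseteq X$, else $c_X(C)$ with $C\supseteq\bigcup\mathcal C_{X'}(Y)$ a component of $G-X$. *)

theory Defs
  imports "HOL-Analysis.Analysis"
begin

section \<open>Graphs, components and ends\<close>

record 'v ugraph =
  verts :: "'v set"
  edges :: "'v set set"

definition simple_graph :: "'v ugraph \<Rightarrow> bool" where
  "simple_graph G \<longleftrightarrow>
     (\<forall>e \<in> edges G. \<exists>u v. u \<in> verts G \<and> v \<in> verts G \<and> u \<noteq> v \<and> e = {u, v})"

definition induced_subgraph :: "'v ugraph \<Rightarrow> 'v set \<Rightarrow> 'v ugraph" where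
  "induced_subgraph G S = \<lparr>verts = verts G \<inter> S, edges = {e \<in> edges G. e \<subseteq> S}\<rparr>"

definition delete_verts :: "'v ugraph \<Rightarrow> 'v set \<Rightarrow> 'v ugraph" where
  "delete_verts G X = induced_subgraph G (verts G - X)"

definition adj_rel :: "'v ugraph \<Rightarrow> ('v \<times> 'v) set" where
  "adj_rel G = {(u, v). {u, v} \<in> edges G}"

text \<open>Components are represented by their vertex sets.\<close>

definition graph_components :: "'v ugraph \<Rightarrow> 'v set set" where
  "graph_components G = {{w. (v, w) \<in> (adj_rel G)\<^sup>*} | v. v \<in> verts G}"

definition fin_subsets :: "'v ugraph \<Rightarrow> 'v set set" where
  "fin_subsets G = {X. X \<subseteq> verts G \<and> finite X}"

definition comps :: "'v ugraph \<Rightarrow> 'v set \<Rightarrow> 'v set set" where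
  "comps G X = graph_components (delete_verts G X)"

definition comp_map :: "'v ugraph \<Rightarrow> 'v set \<Rightarrow> 'v set \<Rightarrow> 'v set \<Rightarrow> 'v set" where
  "comp_map G X' X C' = (THE C. C \<in> comps G X \<and> C' \<subseteq> C)"

definition nbhd :: "'v ugraph \<Rightarrow> 'v set \<Rightarrow> 'v set" where
  "nbhd G C = {v \<in> verts G - C. \<exists>u \<in> C. {u, v} \<in> edges G}"

definition rays :: "'v ugraph \<Rightarrow> (nat \<Rightarrow> 'v) set" where
  "rays G = {r. inj r \<and> range r \<subseteq> verts G \<and> (\<forall>n. {r n, r (Suc n)} \<in> edges G)}"

definition has_tail_in :: "(nat \<Rightarrow> 'v) \<Rightarrow> 'v set \<Rightarrow> bool" where
  "has_tail_in r C \<longleftrightarrow> (\<exists>n. r ` {n..} \<subseteq> C)"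

definition ray_equiv :: "'v ugraph \<Rightarrow> ((nat \<Rightarrow> 'v) \<times> (nat \<Rightarrow> 'v)) set" where
  "ray_equiv G = {(r, s). r \<in> rays G \<and> s \<in> rays G \<and>
     (\<forall>X \<in> fin_subsets G. \<exists>C \<in> comps G X. has_tail_in r C \<and> has_tail_in s C)}"

definition ends :: "'v ugraph \<Rightarrow> (nat \<Rightarrow> 'v) set set" where
  "ends G = rays G // ray_equiv G"

definition end_comp :: "'v ugraph \<Rightarrow> 'v set \<Rightarrow> (nat \<Rightarrow> 'v) set \<Rightarrow> 'v set" where
  "end_comp G X \<omega> = (THE C. C \<in> comps G X \<and> (\<forall>r \<in> \<omega>. has_tail_in r C))"

section \<open>The 1-complex of a graph\<close>

text \<open>
  Points of the 1-complex are given by barycentric coordinates on the vertices: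
  \<open>edge_pt u v t\<close> is the point at distance \<open>t\<close> from \<open>u\<close> on the copy of \<open>[0,1]\<close> that is the
  edge \<open>uv\<close>.  Thus \<open>edge_pt u v t = edge_pt v u (1 - t)\<close> and \<open>edge_pt u v 0 = vertex_pt u\<close>.
\<close>

definition vertex_pt :: "'v \<Rightarrow> 'v \<Rightarrow> real" where
  "vertex_pt v = (\<lambda>w. of_bool (w = v))"

definition edge_pt :: "'v \<Rightarrow> 'v \<Rightarrow> real \<Rightarrow> 'v \<Rightarrow> real" where
  "edge_pt u v t = (\<lambda>w. (1 - t) * of_bool (w = u) + t * of_bool (w = v))"

definition inner_edge_pts :: "'v ugraph \<Rightarrow> ('v \<Rightarrow> real) set" where
  "inner_edge_pts G = {edge_pt u v t | u v t. {u, v} \<in> edges G \<and> 0 < t \<and> t < 1}"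

definition complex_pts :: "'v ugraph \<Rightarrow> ('v \<Rightarrow> real) set" where
  "complex_pts G = vertex_pt ` verts G \<union> inner_edge_pts G"

text \<open>
  The half-open intervals making up a neighbourhood of a vertex may have arbitrary positive
  lengths, with no common lower bound.
\<close>

definition one_complex :: "'v ugraph \<Rightarrow> ('v \<Rightarrow> real) topology" where
  "one_complex G = topology_generated_by
     ({edge_pt u v ` {a<..<b} | u v a b. {u, v} \<in> edges G \<and> 0 \<le> a \<and> a < b \<and> b \<le> 1}
      \<union> {insert (vertex_pt v) (\<Union>w \<in> {w. {v, w} \<in> edges G}. edge_pt v w ` {0..<\<epsilon> w}) | v \<epsilon>.
           v \<in> verts G \<and> (\<forall>w. 0 < \<epsilon> w \<and> \<epsilon> w \<le> 1)})"

definition inner_between :: "'v ugraph \<Rightarrow> 'v set \<Rightarrow> 'v set \<Rightarrow> ('v \<Rightarrow> real) set" where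
  "inner_between G X S =
     {edge_pt x u t | x u t. x \<in> X \<and> u \<in> S \<and> {x, u} \<in> edges G \<and> 0 < t \<and> t < 1}"

section \<open>Compactifications\<close>

definition compactification :: "'a topology \<Rightarrow> 'k topology \<Rightarrow> ('a \<Rightarrow> 'k) \<Rightarrow> bool" where
  "compactification T K h \<longleftrightarrow>
     compact_space K \<and> embedding_map T K h \<and> K closure_of (h ` topspace T) = topspace K"

text \<open>
  \<open>le_witness S K h K' h' f\<close>: the map \<open>f\<close> witnesses \<open>(K, h) \<le> (K', h')\<close>, for compactifications
  of a space with point set \<open>S\<close>.
\<close>

definition le_witness ::
  "'a set \<Rightarrow> 'k topology \<Rightarrow> ('a \<Rightarrow> 'k) \<Rightarrow> 'l topology \<Rightarrow> ('a \<Rightarrow> 'l) \<Rightarrow> ('l \<Rightarrow> 'k) \<Rightarrow> bool" where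
  "le_witness S K h K' h' f \<longleftrightarrow> continuous_map K' K f \<and> (\<forall>x \<in> S. f (h' x) = h x)"

section \<open>\<open>\<C>\<close>-systems\<close>

record ('v, 'k) csys =
  csp :: "'v set \<Rightarrow> 'k topology"
  cemb :: "'v set \<Rightarrow> 'v set \<Rightarrow> 'k"
  cbond :: "'v set \<Rightarrow> 'v set \<Rightarrow> 'k \<Rightarrow> 'k"

definition C_system :: "'v ugraph \<Rightarrow> ('v, 'k) csys \<Rightarrow> bool" where
  "C_system G A \<longleftrightarrow>
     (\<forall>X \<in> fin_subsets G.
        Hausdorff_space (csp A X) \<and>
        compactification (discrete_topology (comps G X)) (csp A X) (cemb A X)) \<and>
     (\<forall>X \<in> fin_subsets G. \<forall>X' \<in> fin_subsets G. X \<subseteq> X' \<longrightarrow>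
        continuous_map (csp A X') (csp A X) (cbond A X' X) \<and>
        (\<forall>C \<in> comps G X'. cbond A X' X (cemb A X' C) = cemb A X (comp_map G X' X C))) \<and>
     (\<forall>X \<in> fin_subsets G. \<forall>p \<in> topspace (csp A X). cbond A X X p = p) \<and>
     (\<forall>X \<in> fin_subsets G. \<forall>X' \<in> fin_subsets G. \<forall>X'' \<in> fin_subsets G. X \<subseteq> X' \<longrightarrow> X' \<subseteq> X'' \<longrightarrow>
        (\<forall>p \<in> topspace (csp A X''). cbond A X' X (cbond A X'' X' p) = cbond A X'' X p))"

definition C_le :: "'v ugraph \<Rightarrow> ('v, 'k) csys \<Rightarrow> ('v, 'l) csys \<Rightarrow> bool" where
  "C_le G A D \<longleftrightarrow> (\<exists>f.
     (\<forall>X \<in> fin_subsets G.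
        le_witness (comps G X) (csp A X) (cemb A X) (csp D X) (cemb D X) (f X)) \<and>
     (\<forall>X \<in> fin_subsets G. \<forall>X' \<in> fin_subsets G. X \<subseteq> X' \<longrightarrow>
        (\<forall>p \<in> topspace (csp D X'). f X (cbond D X' X p) = cbond A X' X (f X' p))))"

definition C_equivalent :: "'v ugraph \<Rightarrow> ('v, 'k) csys \<Rightarrow> ('v, 'l) csys \<Rightarrow> bool" where
  "C_equivalent G A D \<longleftrightarrow> C_le G A D \<and> C_le G D A"

section \<open>The induced space\<close>

definition inv_limit :: "'v ugraph \<Rightarrow> ('v, 'k) csys \<Rightarrow> ('v set \<Rightarrow> 'k) set" where
  "inv_limit G A = {s \<in> (\<Pi>\<^sub>E X \<in> fin_subsets G. topspace (csp A X)).
     \<forall>X \<in> fin_subsets G. \<forall>X' \<in> fin_subsets G. X \<subseteq> X' \<longrightarrow> cbond A X' X (s X') = s X}"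

text \<open>\<open>Inl\<close> marks the points of the 1-complex and \<open>Inr\<close> those of the inverse limit.\<close>

definition induced_space ::
  "'v ugraph \<Rightarrow> ('v, 'k) csys \<Rightarrow> (('v \<Rightarrow> real) + ('v set \<Rightarrow> 'k)) topology" where
  "induced_space G A = topology_generated_by
     ({Inl ` U | U. openin (one_complex G) U}
      \<union> {Inl ` (complex_pts (induced_subgraph G (\<Union>\<C>)) \<union> inner_between G X (\<Union>\<C>))
           \<union> Inr ` {s \<in> inv_limit G A. s X \<in> O'} | X O' \<C>.
           X \<in> fin_subsets G \<and> openin (csp A X) O' \<and> \<C> = {C \<in> comps G X. cemb A X C \<in> O'}})"

text \<open>The space \<open>G \<union> \<Omega>\<close>.\<close>

definition end_space :: "'v ugraph \<Rightarrow> (('v \<Rightarrow> real) + (nat \<Rightarrow> 'v) set) topology" where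
  "end_space G = topology_generated_by
     ({Inl ` U | U. openin (one_complex G) U}
      \<union> {Inl ` (complex_pts (induced_subgraph G C) \<union> inner_between G X C)
           \<union> Inr ` {\<omega>' \<in> ends G. end_comp G X \<omega>' = C} | X C \<omega>.
           X \<in> fin_subsets G \<and> \<omega> \<in> ends G \<and> C = end_comp G X \<omega>})"

definition end_thread :: "'v ugraph \<Rightarrow> ('v, 'k) csys \<Rightarrow> (nat \<Rightarrow> 'v) set \<Rightarrow> 'v set \<Rightarrow> 'k" where
  "end_thread G A \<omega> = (\<lambda>X \<in> fin_subsets G. cemb A X (end_comp G X \<omega>))"

definition end_embed ::
  "'v ugraph \<Rightarrow> ('v, 'k) csys \<Rightarrow> ('v \<Rightarrow> real) + (nat \<Rightarrow> 'v) set
     \<Rightarrow> ('v \<Rightarrow> real) + ('v set \<Rightarrow> 'k)" where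
  "end_embed G A = map_sum (\<lambda>p. p) (end_thread G A)"

definition Omega_compactification ::
  "'v ugraph \<Rightarrow> 'p topology \<Rightarrow> (('v \<Rightarrow> real) + (nat \<Rightarrow> 'v) set \<Rightarrow> 'p) \<Rightarrow> bool" where
  "Omega_compactification G K h \<longleftrightarrow>
     compactification (end_space G) K h \<and>
     Hausdorff_space (subtopology K (topspace K - h ` Inl ` inner_edge_pts G))"

definition induced_le :: "'v ugraph \<Rightarrow> ('v, 'k) csys \<Rightarrow> ('v, 'l) csys \<Rightarrow> bool" where
  "induced_le G A D \<longleftrightarrow> (\<exists>f. le_witness (Inl ` complex_pts G \<union> Inr ` ends G)
     (induced_space G A) (end_embed G A) (induced_space G D) (end_embed G D) f)"

text \<open>Topological equivalence: a homeomorphism fixing every point of \<open>G\<close> and every end.\<close>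

definition induced_equivalent :: "'v ugraph \<Rightarrow> ('v, 'k) csys \<Rightarrow> ('v, 'l) csys \<Rightarrow> bool" where
  "induced_equivalent G A D \<longleftrightarrow>
     (\<exists>f. homeomorphic_map (induced_space G D) (induced_space G A) f \<and>
          (\<forall>x \<in> Inl ` complex_pts G \<union> Inr ` ends G. f (end_embed G D x) = end_embed G A x))"

section \<open>The two extreme systems\<close>

definition ultrafilters_on :: "'a set \<Rightarrow> 'a set set set" where
  "ultrafilters_on S = {U. U \<subseteq> Pow S \<and> S \<in> U \<and> {} \<notin> U \<and>
     (\<forall>A \<in> U. \<forall>B \<in> U. A \<inter> B \<in> U) \<and>
     (\<forall>A \<in> U. \<forall>B. A \<subseteq> B \<and> B \<subseteq> S \<longrightarrow> B \<in> U) \<and>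
     (\<forall>A. A \<subseteq> S \<longrightarrow> A \<in> U \<or> S - A \<in> U)}"

definition principal_uf :: "'a set \<Rightarrow> 'a \<Rightarrow> 'a set set" where
  "principal_uf S x = {A. A \<subseteq> S \<and> x \<in> A}"

definition filter_topology :: "'a set \<Rightarrow> 'a set set set \<Rightarrow> 'a set set topology" where
  "filter_topology S P = topology_generated_by {{F \<in> P. A \<in> F} | A. A \<subseteq> S}"

definition C_U :: "'v ugraph \<Rightarrow> ('v, 'v set set set) csys" where
  "C_U G = \<lparr>
     csp = (\<lambda>X. filter_topology (comps G X) (ultrafilters_on (comps G X))),
     cemb = (\<lambda>X. principal_uf (comps G X)),
     cbond = (\<lambda>X' X U'. {\<C>. \<C> \<subseteq> comps G X \<and> (\<exists>\<C>' \<in> U'. comp_map G X' X ` \<C>' \<subseteq> \<C>)})\<rparr>"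

definition comps_nbhd :: "'v ugraph \<Rightarrow> 'v set \<Rightarrow> 'v set \<Rightarrow> 'v set set" where
  "comps_nbhd G X Y = {C \<in> comps G X. nbhd G C = Y}"

definition crit :: "'v ugraph \<Rightarrow> 'v set \<Rightarrow> 'v set set" where
  "crit G X = {Y. Y \<subseteq> X \<and> infinite (comps_nbhd G X Y)}"

definition crit_filter :: "'v ugraph \<Rightarrow> 'v set \<Rightarrow> 'v set \<Rightarrow> 'v set set set" where
  "crit_filter G X Y = {\<C>. \<C> \<subseteq> comps G X \<and>
     (\<exists>\<D>. \<D> \<subseteq> comps_nbhd G X Y \<and> finite (comps_nbhd G X Y - \<D>) \<and> \<D> \<subseteq> \<C>)}"

definition F_points :: "'v ugraph \<Rightarrow> 'v set \<Rightarrow> 'v set set set set" where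
  "F_points G X = principal_uf (comps G X) ` comps G X \<union> crit_filter G X ` crit G X"

definition F_bond :: "'v ugraph \<Rightarrow> 'v set \<Rightarrow> 'v set \<Rightarrow> 'v set set set \<Rightarrow> 'v set set set" where
  "F_bond G X' X F =
     (if F \<in> principal_uf (comps G X') ` comps G X'
      then principal_uf (comps G X)
             (comp_map G X' X (THE C'. C' \<in> comps G X' \<and> F = principal_uf (comps G X') C'))
      else let Y = (THE Y. Y \<in> crit G X' \<and> F = crit_filter G X' Y) in
        if Y \<subseteq> X then crit_filter G X Y
        else principal_uf (comps G X) (THE C. C \<in> comps G X \<and> \<Union>(comps_nbhd G X' Y) \<subseteq> C))"

definition C_F :: "'v ugraph \<Rightarrow> ('v, 'v set set set) csys" where
  "C_F G = \<lparr>
     csp = (\<lambda>X. filter_topology (comps G X) (F_points G X)),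
     cemb = (\<lambda>X. principal_uf (comps G X)),
     cbond = F_bond G\<rparr>"

end

theory Submission
  imports Defs
begin

text \<open>
  All compatibility conditions on bonding and comparison maps hold on the dense sets of components,
  hence everywhere, so only the spaces at a single finite \<open>X\<close> matter.

  The space of ultrafilters maps onto every compactification of a discrete space by taking limits.
  Conversely, let \<open>\<alpha>\<close> be a \<open>\<C>\<close>-system and let \<open>Y \<noteq> Y'\<close> be subsets of \<open>X\<close>, say \<open>y \<in> Y - Y'\<close>.
  The bonding map from \<open>X\<close> to \<open>X - {y}\<close> sends all components with neighbourhood \<open>Y\<close> to one
  isolated point and fixes those with neighbourhood \<open>Y'\<close>, so the two classes of components have
  disjoint closures in \<open>\<alpha>(\<C>\<^sub>X)\<close>. Collapsing the remainder of each of these finitely many closures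
  to a point yields the map to \<open>\<FF>\<^sub>X\<close>.

  Induced spaces are compact because a family of open sets that covers the inverse limit already
  covers \<open>\<alpha>(\<C>\<^sub>X)\<close> for some finite \<open>X\<close>, which leaves only a finite subgraph. Comparison maps
  of systems act on threads. Comparison maps of induced spaces in both directions are
  mutually inverse, since they preserve the limit points and vertices are dense in the
  Hausdorff space that remains after deleting the inner points of edges.
\<close>

section \<open>Spaces of filters\<close>

text \<open>The points of both extreme systems are filters of sets of components, with the topology
  generated by the sets of all filters containing a given A. \<open>filters_on\<close> isolates what
  the two share, so base, continuity and density are treated once. Why critical sets suffice: a
  finite X has finitely many subsets, so the classes \<open>comps_nbhd G X Y\<close> partition the
  components into finitely many pieces and closures distribute over them. In any Hausdorff
  compactification a finite class is closed, while an infinite class, being discrete, must have a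
  remainder. Hence exactly the infinite classes need a further point. The obstacle is that induced
  spaces are compact but in general not Hausdorff. In a star with infinitely many leaves, every
  neighbourhood of the centre and every neighbourhood of a limit point share inner points of edges.
  So agreement of two continuous maps on the dense set G does not by itself give equality, and a
  comparison map is not assumed to send limit points to limit points. For this reason separation is
  always stated as two open sets of the whole space that meet only in inner points of edges.\<close>

definition filters_on :: "'a set \<Rightarrow> 'a set set set" where
  "filters_on S = {F. F \<subseteq> Pow S \<and> S \<in> F \<and> {} \<notin> F \<and> (\<forall>A \<in> F. \<forall>B \<in> F. A \<inter> B \<in> F) \<and>
     (\<forall>A \<in> F. \<forall>B. A \<subseteq> B \<and> B \<subseteq> S \<longrightarrow> B \<in> F)}"

lemma ultrafilters_on_eq:
  "ultrafilters_on S = {U \<in> filters_on S. \<forall>A. A \<subseteq> S \<longrightarrow> A \<in> U \<or> S - A \<in> U}"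
  by (auto simp: ultrafilters_on_def filters_on_def)

lemma ultrafilters_onD:
  assumes "U \<in> ultrafilters_on S"
  shows "U \<in> filters_on S" "A \<subseteq> S \<Longrightarrow> A \<notin> U \<Longrightarrow> S - A \<in> U"
  using assms unfolding ultrafilters_on_eq by blast+

lemma filters_onD:
  assumes "F \<in> filters_on S"
  shows "A \<in> F \<Longrightarrow> A \<subseteq> S" "S \<in> F" "{} \<notin> F" "A \<in> F \<Longrightarrow> B \<in> F \<Longrightarrow> A \<inter> B \<in> F"
    "A \<in> F \<Longrightarrow> A \<subseteq> B \<Longrightarrow> B \<subseteq> S \<Longrightarrow> B \<in> F"
  using assms unfolding filters_on_def by blast+

lemma principal_filter: "x \<in> S \<Longrightarrow> principal_uf S x \<in> filters_on S"
  by (auto simp: principal_uf_def filters_on_def)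

lemma principal_ultrafilter: "x \<in> S \<Longrightarrow> principal_uf S x \<in> ultrafilters_on S"
  by (auto simp: principal_uf_def ultrafilters_on_def)

lemma inj_principal: "inj_on (principal_uf S) S"
proof (rule inj_onI)
  fix x y assume x: "x \<in> S" and eq: "principal_uf S x = principal_uf S y"
  have "{x} \<in> principal_uf S x" using x by (simp add: principal_uf_def)
  then show "x = y" unfolding eq by (simp add: principal_uf_def)
qed

lemma filter_eq_principal:
  assumes "F \<in> filters_on S" "{x} \<in> F"
  shows "F = principal_uf S x"
proof (intro equalityI subsetI)
  fix A assume A: "A \<in> F"
  then have "A \<inter> {x} \<noteq> {}" using filters_onD(3,4)[OF assms(1)] assms(2) by metis
  then show "A \<in> principal_uf S x"
    using filters_onD(1)[OF assms(1) A] by (auto simp: principal_uf_def)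
next
  fix A assume "A \<in> principal_uf S x"
  then show "A \<in> F" using filters_onD(5)[OF assms] by (auto simp: principal_uf_def)
qed

lemma topspace_filter_topology:
  assumes "P \<subseteq> filters_on S"
  shows "topspace (filter_topology S P) = P"
proof -
  have "P = {F \<in> P. S \<in> F}" using assms filters_onD(2) by blast
  then show ?thesis
    unfolding filter_topology_def topology_generated_by_topspace by blast
qed

lemma openin_filter_basic: "A \<subseteq> S \<Longrightarrow> openin (filter_topology S P) {F \<in> P. A \<in> F}"
  unfolding filter_topology_def by (rule topology_generated_by_Basis) blast

text \<open>The generating sets form a base and not merely a subbase: a filter contains A \<inter> B
  exactly when it contains both A and B, so intersections of generating sets have the same
  form.\<close>

lemma filter_topology_basis:
  assumes "P \<subseteq> filters_on S" "openin (filter_topology S P) W" "F \<in> W"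
  shows "\<exists>A \<in> F. {F' \<in> P. A \<in> F'} \<subseteq> W"
proof -
  have "generate_topology_on {{F \<in> P. A \<in> F} | A. A \<subseteq> S} W"
    using assms(2) unfolding filter_topology_def by (simp add: openin_topology_generated_by)
  moreover have "F \<in> P"
    using assms topspace_filter_topology openin_subset by blast
  ultimately show ?thesis using assms(3)
  proof (induction rule: generate_topology_on.induct)
    case (Int a b)
    then obtain A B where AB: "A \<in> F" "B \<in> F" "{F' \<in> P. A \<in> F'} \<subseteq> a" "{F' \<in> P. B \<in> F'} \<subseteq> b" by blast
    have *: "A \<in> F'" "B \<in> F'" if "A \<inter> B \<in> F'" "F' \<in> P" for F'
      using that AB(1,2) filters_onD(1,5) Int.prems(1) assms(1)
      by (metis Int_lower1 Int_lower2 subsetD)+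
    have "A \<inter> B \<in> F" using filters_onD(4) AB(1,2) Int.prems(1) assms(1) by (metis subsetD)
    moreover have "{F' \<in> P. A \<inter> B \<in> F'} \<subseteq> a \<inter> b"
    proof
      fix F' assume "F' \<in> {F' \<in> P. A \<inter> B \<in> F'}"
      then show "F' \<in> a \<inter> b" using *[of F'] AB(3,4) by auto
    qed
    ultimately show ?case by (rule bexI[rotated])
  qed blast+
qed

lemma openin_filter_topologyI:
  assumes "P \<subseteq> filters_on S" "W \<subseteq> P" "\<And>F. F \<in> W \<Longrightarrow> \<exists>A \<in> F. {F' \<in> P. A \<in> F'} \<subseteq> W"
  shows "openin (filter_topology S P) W"
proof (subst openin_subopen, intro ballI)
  fix F assume F: "F \<in> W"
  then obtain A where A: "A \<in> F" "{F' \<in> P. A \<in> F'} \<subseteq> W" using assms by blast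
  moreover have "A \<subseteq> S" using A F filters_onD(1) assms(1,2) by blast
  moreover have "F \<in> {F' \<in> P. A \<in> F'}" using A(1) F assms(2) by blast
  ultimately show "\<exists>T. openin (filter_topology S P) T \<and> F \<in> T \<and> T \<subseteq> W"
    using openin_filter_basic by (intro exI[of _ "{F' \<in> P. A \<in> F'}"] conjI)
qed

text \<open>The criterion looks at one member A of the image filter and asks for one member B of the
  argument that forces it. The bonding maps of both extreme systems are checked in this
  form.\<close>

lemma continuous_map_filter_topologyI:
  assumes P: "P \<subseteq> filters_on S" and P': "P' \<subseteq> filters_on S'"
    and into: "\<And>F. F \<in> P' \<Longrightarrow> f F \<in> P"
    and loc: "\<And>F A. F \<in> P' \<Longrightarrow> A \<in> f F \<Longrightarrow> \<exists>B \<in> F. \<forall>F' \<in> P'. B \<in> F' \<longrightarrow> A \<in> f F'"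
  shows "continuous_map (filter_topology S' P') (filter_topology S P) f"
  unfolding continuous_map topspace_filter_topology[OF P] topspace_filter_topology[OF P']
proof (intro conjI allI impI)
  show "f ` P' \<subseteq> P" using into by blast
  fix U assume U: "openin (filter_topology S P) U"
  show "openin (filter_topology S' P') {F \<in> P'. f F \<in> U}"
  proof (rule openin_filter_topologyI[OF P'])
    fix F assume "F \<in> {F \<in> P'. f F \<in> U}"
    then have F: "F \<in> P'" "f F \<in> U" by auto
    obtain A where A: "A \<in> f F" "{F' \<in> P. A \<in> F'} \<subseteq> U"
      using filter_topology_basis[OF P U F(2)] by blast
    obtain B where B: "B \<in> F" "\<forall>F' \<in> P'. B \<in> F' \<longrightarrow> A \<in> f F'" using loc[OF F(1) A(1)] by blast
    have "{F' \<in> P'. B \<in> F'} \<subseteq> {F \<in> P'. f F \<in> U}"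
    proof
      fix F' assume "F' \<in> {F' \<in> P'. B \<in> F'}"
      then have "F' \<in> P'" "f F' \<in> {F' \<in> P. A \<in> F'}" using B(2) into by auto
      then show "F' \<in> {F \<in> P'. f F \<in> U}" using A(2) by auto
    qed
    then show "\<exists>B \<in> F. {F' \<in> P'. B \<in> F'} \<subseteq> {F \<in> P'. f F \<in> U}" using B(1) by (rule bexI)
  qed blast
qed

section \<open>Compactifications of discrete spaces and spaces of filters\<close>

lemma embedding_map_discrete:
  assumes "inj_on h S" "h ` S \<subseteq> topspace K" "\<And>x. x \<in> S \<Longrightarrow> openin K {h x}"
  shows "embedding_map (discrete_topology S) K h"
proof -
  have "openin K T" if "T \<subseteq> h ` S" for T
    using that assms(3) by (subst openin_subopen) blast
  then have "subtopology K (h ` S) = discrete_topology (h ` S)"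
    unfolding topology_eq openin_subtopology openin_discrete_topology by (metis inf.absorb1 inf.cobounded2)
  then show ?thesis
    using assms(1) unfolding embedding_map_def topspace_discrete_topology
    by (simp add: bijective_open_imp_homeomorphic_map open_map_def image_mono)
qed

text \<open>The embedding provides an open U that meets the dense image only in h x. Points are
  closed in a Hausdorff space, so U - {h x} is open, and being disjoint from a dense set it is
  empty.\<close>

lemma open_point_discrete_compactification:
  assumes "Hausdorff_space K" "compactification (discrete_topology S) K h" "x \<in> S"
  shows "openin K {h x}"
proof -
  have emb: "homeomorphic_map (discrete_topology S) (subtopology K (h ` S)) h"
    and dense: "K closure_of (h ` S) = topspace K"
    using assms(2) by (auto simp: compactification_def embedding_map_def)
  have "openin (subtopology K (h ` S)) (h ` {x})"
    using homeomorphic_imp_open_map[OF emb] assms(3) by (auto simp: open_map_def)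
  then obtain U where U: "openin K U" "{h x} = U \<inter> h ` S" by (auto simp: openin_subtopology)
  then have hx: "h x \<in> topspace K" using openin_subset by blast
  have "closedin K {h x}" using assms(1) hx by (simp add: closedin_Hausdorff_singleton)
  then have op: "openin K (U - {h x})" using U by (simp add: openin_diff)
  have "(U - {h x}) \<inter> K closure_of (h ` S) = {}"
    using op U(2) openin_Int_closure_of_eq_empty[OF op] by blast
  then have "U = {h x}" using dense openin_subset[OF U(1)] U(2) by blast
  then show ?thesis using U by simp
qed

lemma filter_topology_compactification:
  assumes P: "P \<subseteq> filters_on S" and pr: "principal_uf S ` S \<subseteq> P"
    and "compact_space (filter_topology S P)"
  shows "compactification (discrete_topology S) (filter_topology S P) (principal_uf S)"
proof -
  have "openin (filter_topology S P) {principal_uf S x}" if x: "x \<in> S" for x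
  proof -
    have "{F \<in> P. {x} \<in> F} = {principal_uf S x}"
    proof (intro equalityI subsetI)
      fix F assume "F \<in> {F \<in> P. {x} \<in> F}"
      then have "F \<in> filters_on S" "{x} \<in> F" using P by auto
      then show "F \<in> {principal_uf S x}" using filter_eq_principal by simp
    next
      fix F assume "F \<in> {principal_uf S x}"
      then have "F \<in> P" "F = principal_uf S x" using pr x by auto
      then show "F \<in> {F \<in> P. {x} \<in> F}" using x by (simp add: principal_uf_def)
    qed
    then show ?thesis using openin_filter_basic[of "{x}" S P] x by auto
  qed
  then have "embedding_map (discrete_topology S) (filter_topology S P) (principal_uf S)"
    using embedding_map_discrete inj_principal pr topspace_filter_topology[OF P] by metis
  moreover have "F \<in> filter_topology S P closure_of (principal_uf S ` S)" if F: "F \<in> P" for F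
    unfolding in_closure_of topspace_filter_topology[OF P]
  proof (intro conjI allI impI F)
    fix T assume T: "F \<in> T \<and> openin (filter_topology S P) T"
    then obtain A where A: "A \<in> F" "{F' \<in> P. A \<in> F'} \<subseteq> T"
      using filter_topology_basis[OF P, of T F] by blast
    then obtain x where "x \<in> A" "A \<subseteq> S" using filters_onD(1,3) F P by (metis all_not_in_conv subsetD)
    then have "principal_uf S x \<in> principal_uf S ` S" "A \<in> principal_uf S x"
      by (auto simp: principal_uf_def)
    then show "\<exists>y. y \<in> principal_uf S ` S \<and> y \<in> T"
      using A(2) pr by (intro exI[of _ "principal_uf S x"]) auto
  qed
  ultimately show ?thesis
    unfolding compactification_def using assms(3) closure_of_subset_topspace topspace_filter_topology[OF P]
    by (metis subsetI subset_antisym topspace_discrete_topology)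
qed

lemma filter_topology_Hausdorff:
  assumes P: "P \<subseteq> filters_on S"
    and sep: "\<And>F F'. F \<in> P \<Longrightarrow> F' \<in> P \<Longrightarrow> F \<noteq> F' \<Longrightarrow> \<exists>A \<in> F. \<exists>B \<in> F'. A \<inter> B = {}"
  shows "Hausdorff_space (filter_topology S P)"
  unfolding Hausdorff_space_def topspace_filter_topology[OF P]
proof (intro allI impI)
  fix F F' assume F: "F \<in> P \<and> F' \<in> P \<and> F \<noteq> F'"
  then obtain A B where AB: "A \<in> F" "B \<in> F'" "A \<inter> B = {}" using sep by blast
  have "\<not> (A \<in> E \<and> B \<in> E)" if "E \<in> P" for E
    using AB(3) P that filters_onD(3,4) by (metis subsetD)
  then have "disjnt {F \<in> P. A \<in> F} {F \<in> P. B \<in> F}" unfolding disjnt_iff by simp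
  moreover have "A \<subseteq> S" "B \<subseteq> S" using AB F P filters_onD(1) by blast+
  moreover have "F \<in> {F \<in> P. A \<in> F}" "F' \<in> {F \<in> P. B \<in> F}" using F AB by auto
  ultimately show "\<exists>U V. openin (filter_topology S P) U \<and> openin (filter_topology S P) V \<and>
      F \<in> U \<and> F' \<in> V \<and> disjnt U V"
    using openin_filter_basic[of A S P] openin_filter_basic[of B S P]
    by (intro exI[of _ "{F \<in> P. A \<in> F}"] exI[of _ "{F \<in> P. B \<in> F}"] conjI)
qed

section \<open>Ultrafilters\<close>

lemma ultrafilter_Union:
  assumes U: "U \<in> ultrafilters_on S" and "finite \<A>" "\<Union>\<A> \<in> U"
  shows "\<exists>A \<in> \<A>. A \<in> U"
  using assms(2,3)
proof (induction rule: finite_induct)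
  case empty
  then show ?case using filters_onD(3) U by (auto simp: ultrafilters_on_eq)
next
  case (insert A \<A>)
  have F: "U \<in> filters_on S" using U by (simp add: ultrafilters_on_eq)
  have sub: "A \<subseteq> S" "\<Union>\<A> \<subseteq> S" using filters_onD(1)[OF F insert.prems] by auto
  show ?case
  proof (cases "A \<in> U")
    case False
    then have "S - A \<in> U" using U sub by (auto simp: ultrafilters_on_eq)
    then have "\<Union>(insert A \<A>) \<inter> (S - A) \<in> U" using filters_onD(4)[OF F insert.prems] by blast
    then have "\<Union>\<A> \<in> U" by (rule filters_onD(5)[OF F]) (use sub in auto)
    then show ?thesis using insert.IH by blast
  qed blast
qed

lemma ultrafilter_exists:
  assumes "\<B> \<subseteq> Pow S" and fip: "\<And>T. finite T \<Longrightarrow> T \<subseteq> \<B> \<Longrightarrow> S \<inter> \<Inter>T \<noteq> {}"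
  shows "\<exists>U \<in> ultrafilters_on S. \<B> \<subseteq> U"
proof -
  \<comment> \<open>Intersections are cut down to S because the intersection of the empty family is
    the whole type; the choice T = {} makes S itself nonempty.\<close>
  define \<Z> where "\<Z> = {M. \<B> \<subseteq> M \<and> M \<subseteq> Pow S \<and> (\<forall>T. finite T \<and> T \<subseteq> M \<longrightarrow> S \<inter> \<Inter>T \<noteq> {})}"
  have "\<exists>M\<in>\<Z>. \<forall>N\<in>\<Z>. M \<subseteq> N \<longrightarrow> N = M"
  proof (rule subset_Zorn_nonempty)
    have "\<B> \<in> \<Z>" using assms by (simp add: \<Z>_def)
    then show "\<Z> \<noteq> {}" by blast
    fix \<C> assume ne: "\<C> \<noteq> {}" and ch: "subset.chain \<Z> \<C>"
    then have sub: "\<C> \<subseteq> \<Z>" by (simp add: subset_chain_def)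
    have "S \<inter> \<Inter>T \<noteq> {}" if T: "finite T" "T \<subseteq> \<Union>\<C>" for T
    proof -
      obtain M where "M \<in> \<C>" "T \<subseteq> M" using finite_subset_Union_chain[OF T ne ch] by blast
      then have "M \<in> \<Z>" using sub by blast
      then show ?thesis using T(1) \<open>T \<subseteq> M\<close> by (simp add: \<Z>_def)
    qed
    moreover have "\<B> \<subseteq> M \<and> M \<subseteq> Pow S" if "M \<in> \<C>" for M
      using that sub by (auto simp: \<Z>_def)
    then have "\<B> \<subseteq> \<Union>\<C>" "\<Union>\<C> \<subseteq> Pow S" using ne by blast+
    ultimately show "\<Union>\<C> \<in> \<Z>" by (simp add: \<Z>_def)
  qed
  then obtain M where M: "M \<in> \<Z>" and max: "\<And>N. N \<in> \<Z> \<Longrightarrow> M \<subseteq> N \<Longrightarrow> N = M" by blast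
  have Msub: "M \<subseteq> Pow S" "\<B> \<subseteq> M" and Mfip: "\<And>T. finite T \<Longrightarrow> T \<subseteq> M \<Longrightarrow> S \<inter> \<Inter>T \<noteq> {}"
    using M by (simp_all add: \<Z>_def)
  have add: "A \<in> M" if A: "A \<subseteq> S" and "\<And>T. finite T \<Longrightarrow> T \<subseteq> M \<Longrightarrow> S \<inter> \<Inter>T \<inter> A \<noteq> {}" for A
  proof -
    have "S \<inter> \<Inter>T \<noteq> {}" if T: "finite T" "T \<subseteq> insert A M" for T
    proof -
      have "S \<inter> \<Inter>(T - {A}) \<inter> A \<noteq> {}" using that by (intro \<open>\<And>T. _ \<Longrightarrow> _ \<Longrightarrow> S \<inter> \<Inter>T \<inter> A \<noteq> {}\<close>) auto
      then show ?thesis by blast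
    qed
    moreover have "\<B> \<subseteq> insert A M" "insert A M \<subseteq> Pow S" using Msub A by blast+
    ultimately have "insert A M \<in> \<Z>" by (simp add: \<Z>_def)
    then show ?thesis using max by blast
  qed
  \<comment> \<open>One closure property gives three filter axioms: T = {} yields S, T = {A} yields
    upward closure, T = {A, B} yields intersections.\<close>
  have up: "B \<in> M" if T: "finite T" "T \<subseteq> M" and B: "S \<inter> \<Inter>T \<subseteq> B" "B \<subseteq> S" for T B
  proof (rule add[OF B(2)])
    fix T' assume "finite T'" "T' \<subseteq> M"
    then have "S \<inter> \<Inter>(T \<union> T') \<noteq> {}" using T by (intro Mfip) auto
    then show "S \<inter> \<Inter>T' \<inter> B \<noteq> {}" using B(1) by blast
  qed
  have dich: "A \<in> M \<or> S - A \<in> M" if A: "A \<subseteq> S" for A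
  proof (rule ccontr)
    assume neg: "\<not> (A \<in> M \<or> S - A \<in> M)"
    then obtain T where "finite T" "T \<subseteq> M" "S \<inter> \<Inter>T \<inter> A = {}" using add[OF A] by blast
    then have "S - A \<in> M" by (intro up[of T]) auto
    then show False using neg by blast
  qed
  have "S \<in> M" using up[of "{}" S] by simp
  moreover have "{} \<notin> M" using Mfip[of "{{}}"] by auto
  moreover have "A \<inter> B \<in> M" if "A \<in> M" "B \<in> M" for A B
    using that Msub(1) by (intro up[of "{A, B}"]) auto
  moreover have "B \<in> M" if "A \<in> M" "A \<subseteq> B" "B \<subseteq> S" for A B
    using that by (intro up[of "{A}"]) auto
  ultimately have "M \<in> ultrafilters_on S"
    using dich Msub(1) by (simp add: ultrafilters_on_def)
  then show ?thesis using Msub(2) by blast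
qed

lemma ultrafilters_subset_filters: "ultrafilters_on S \<subseteq> filters_on S"
  by (auto simp: ultrafilters_on_eq)

text \<open>\<open>\<A>\<close> collects the sets whose basic open set fits into one member of the
  cover. If no finite part of \<open>\<A>\<close> covered S, the complements would have the finite
  intersection property and extend to an ultrafilter, which then lies in no member of the cover. A
  finite cover of S by \<open>\<A>\<close> suffices, since an ultrafilter contains one of finitely
  many sets whose union it contains.\<close>

lemma compact_space_ultrafilters:
  "compact_space (filter_topology S (ultrafilters_on S))" (is "compact_space ?T")
  unfolding compact_space_def compactin_def
proof (intro conjI allI impI)
  note top = topspace_filter_topology[OF ultrafilters_subset_filters, of S]
  fix \<V> assume \<V>: "Ball \<V> (openin ?T) \<and> topspace ?T \<subseteq> \<Union>\<V>"
  define \<A> where "\<A> = {A. A \<subseteq> S \<and> (\<exists>V \<in> \<V>. {F \<in> ultrafilters_on S. A \<in> F} \<subseteq> V)}"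
  have "\<exists>T. finite T \<and> T \<subseteq> \<A> \<and> S \<subseteq> \<Union>T"
  proof (rule ccontr)
    assume neg: "\<not> ?thesis"
    have "\<exists>U \<in> ultrafilters_on S. (\<lambda>A. S - A) ` \<A> \<subseteq> U"
    proof (rule ultrafilter_exists)
      fix T assume "finite T" "T \<subseteq> (\<lambda>A. S - A) ` \<A>"
      then obtain T' where T': "T' \<subseteq> \<A>" "finite T'" "T = (\<lambda>A. S - A) ` T'"
        by (metis finite_subset_image)
      then have "\<not> S \<subseteq> \<Union>T'" using neg by blast
      then show "S \<inter> \<Inter>T \<noteq> {}" unfolding T' by blast
    qed blast
    then obtain U where U: "U \<in> ultrafilters_on S" "(\<lambda>A. S - A) ` \<A> \<subseteq> U" by blast
    then obtain V where V: "V \<in> \<V>" "U \<in> V" using \<V> top by blast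
    then obtain A where A: "A \<in> U" "{F \<in> ultrafilters_on S. A \<in> F} \<subseteq> V"
      using filter_topology_basis[OF ultrafilters_subset_filters, of S V U] \<V> by blast
    have F: "U \<in> filters_on S" using U ultrafilters_subset_filters by blast
    have "A \<in> \<A>" using A V filters_onD(1)[OF F] by (auto simp: \<A>_def)
    then have "S - A \<in> U" using U by blast
    then have "A \<inter> (S - A) \<in> U" using filters_onD(4)[OF F A(1)] by blast
    then show False using filters_onD(3)[OF F] by simp
  qed
  then obtain T where T: "finite T" "T \<subseteq> \<A>" "S \<subseteq> \<Union>T" by blast
  have "\<forall>A \<in> T. \<exists>V \<in> \<V>. {F \<in> ultrafilters_on S. A \<in> F} \<subseteq> V" using T(2) by (auto simp: \<A>_def)
  then obtain v where v: "\<And>A. A \<in> T \<Longrightarrow> v A \<in> \<V> \<and> {F \<in> ultrafilters_on S. A \<in> F} \<subseteq> v A" by metis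
  have "U \<in> \<Union>(v ` T)" if U: "U \<in> ultrafilters_on S" for U
  proof -
    have "\<Union>T \<in> U" using T(2,3) filters_onD(2) U ultrafilters_subset_filters[of S]
      by (metis (no_types, lifting) Sup_least \<A>_def mem_Collect_eq subset_antisym subset_iff)
    then obtain A where "A \<in> T" "A \<in> U" using ultrafilter_Union[OF U T(1)] by blast
    then have "U \<in> {F \<in> ultrafilters_on S. A \<in> F}" using U by simp
    then show ?thesis using v[OF \<open>A \<in> T\<close>] \<open>A \<in> T\<close> by blast
  qed
  then show "\<exists>\<F>. finite \<F> \<and> \<F> \<subseteq> \<V> \<and> topspace ?T \<subseteq> \<Union>\<F>"
    using T(1) v unfolding top by (intro exI[of _ "v ` T"]) auto
qed auto

lemma Hausdorff_space_ultrafilters: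
  "Hausdorff_space (filter_topology S (ultrafilters_on S))"
proof (rule filter_topology_Hausdorff[OF ultrafilters_subset_filters])
  fix U V assume U: "U \<in> ultrafilters_on S" and V: "V \<in> ultrafilters_on S" and "U \<noteq> V"
  \<comment> \<open>An ultrafilter is not properly contained in another: a set missing from the
    smaller one would have its complement in both.\<close>
  have "\<exists>A. A \<in> U \<and> A \<notin> V"
  proof (rule ccontr)
    assume "\<not> ?thesis"
    then have sub: "U \<subseteq> V" by blast
    have "A \<in> U" if A: "A \<in> V" for A
    proof (rule ccontr)
      assume "A \<notin> U"
      moreover have "A \<subseteq> S" using filters_onD(1)[OF ultrafilters_onD(1)[OF V]] A by blast
      ultimately have "S - A \<in> V" using ultrafilters_onD(2)[OF U] sub by blast
      then have "A \<inter> (S - A) \<in> V" using filters_onD(4)[OF ultrafilters_onD(1)[OF V] A] by blast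
      then show False using filters_onD(3)[OF ultrafilters_onD(1)[OF V]] by simp
    qed
    then show False using sub \<open>U \<noteq> V\<close> by blast
  qed
  then obtain A where "A \<in> U" "A \<notin> V" by blast
  moreover from this have "S - A \<in> V"
    using filters_onD(1)[OF ultrafilters_onD(1)[OF U]] ultrafilters_onD(2)[OF V] by blast
  ultimately show "\<exists>A\<in>U. \<exists>B\<in>V. A \<inter> B = {}" by blast
qed

section \<open>Limits of ultrafilters and the extension property\<close>

lemma ultrafilter_limit_exists:
  assumes K: "compact_space K" and U: "U \<in> ultrafilters_on S" and h: "h ` S \<subseteq> topspace K"
  shows "\<exists>p \<in> topspace K. \<forall>W. openin K W \<and> p \<in> W \<longrightarrow> {x \<in> S. h x \<in> W} \<in> U"
proof (rule ccontr)
  assume neg: "\<not> ?thesis"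
  \<comment> \<open>If there is no limit, these sets cover K. Finitely many of them do as well, and
    their preimages cover S, so one preimage belongs to U after all.\<close>
  define \<W> where "\<W> = {W. openin K W \<and> {x \<in> S. h x \<in> W} \<notin> U}"
  have "topspace K \<subseteq> \<Union>\<W>" using neg unfolding \<W>_def by blast
  then obtain \<F> where \<F>: "finite \<F>" "\<F> \<subseteq> \<W>" "topspace K \<subseteq> \<Union>\<F>"
    using K unfolding compact_space_alt \<W>_def by (metis (no_types, lifting) mem_Collect_eq)
  let ?A = "(\<lambda>W. {x \<in> S. h x \<in> W}) ` \<F>"
  have "\<Union>?A = S" using \<F>(3) h by blast
  then have "\<Union>?A \<in> U" using U by (simp add: ultrafilters_on_def)
  then obtain W where "W \<in> \<F>" "{x \<in> S. h x \<in> W} \<in> U"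
    using ultrafilter_Union[OF U, of ?A] \<F>(1) by auto
  then show False using \<F>(2) by (auto simp: \<W>_def)
qed

text \<open>The existence half of the universal property of the Stone-Cech compactification of a
  discrete space. Continuity rests on regularity of K: with V \<subseteq> C \<subseteq> W, V open
  and C closed, every ultrafilter containing the preimage of V has its limit in C.\<close>

lemma ultrafilter_extension:
  assumes "compact_space K" "Hausdorff_space K" and h: "h ` S \<subseteq> topspace K"
  shows "\<exists>f. continuous_map (filter_topology S (ultrafilters_on S)) K f \<and>
             (\<forall>x \<in> S. f (principal_uf S x) = h x)"
proof -
  have "\<forall>U \<in> ultrafilters_on S. \<exists>p \<in> topspace K.
      \<forall>W. openin K W \<and> p \<in> W \<longrightarrow> {x \<in> S. h x \<in> W} \<in> U"
    using ultrafilter_limit_exists[OF assms(1) _ h] by blast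
  then obtain f where f: "\<And>U. U \<in> ultrafilters_on S \<Longrightarrow> f U \<in> topspace K"
    and lim: "\<And>U W. U \<in> ultrafilters_on S \<Longrightarrow> openin K W \<Longrightarrow> f U \<in> W \<Longrightarrow> {x \<in> S. h x \<in> W} \<in> U"
    by metis
  have regular: "regular_space K" using assms by (intro compact_Hausdorff_imp_regular_space)
  have "f (principal_uf S x) = h x" if x: "x \<in> S" for x
  proof (rule ccontr)
    assume ne: "f (principal_uf S x) \<noteq> h x"
    let ?W = "topspace K - {h x}"
    have "closedin K {h x}"
      using assms(2) h x by (intro closedin_Hausdorff_singleton) auto
    then have "openin K ?W" by (intro openin_diff) auto
    then have "{y \<in> S. h y \<in> ?W} \<in> principal_uf S x"
      using ne f principal_ultrafilter[OF x] by (intro lim) auto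
    then show False by (simp add: principal_uf_def)
  qed
  moreover have "continuous_map (filter_topology S (ultrafilters_on S)) K f"
    unfolding continuous_map topspace_filter_topology[OF ultrafilters_subset_filters]
  proof (intro conjI allI impI)
    show "f ` ultrafilters_on S \<subseteq> topspace K" using f by blast
    fix W assume W: "openin K W"
    show "openin (filter_topology S (ultrafilters_on S)) {U \<in> ultrafilters_on S. f U \<in> W}"
    proof (rule openin_filter_topologyI[OF ultrafilters_subset_filters])
      fix U assume "U \<in> {U \<in> ultrafilters_on S. f U \<in> W}"
      then have U: "U \<in> ultrafilters_on S" "f U \<in> W" by auto
      obtain V C where V: "openin K V" "closedin K C" "f U \<in> V" "V \<subseteq> C" "C \<subseteq> W"
        using regular W U(2) unfolding neighbourhood_base_of_closedin[symmetric] neighbourhood_base_of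
        by metis
      have "f U' \<in> C" if U': "U' \<in> ultrafilters_on S" "{x \<in> S. h x \<in> V} \<in> U'" for U'
      proof (rule ccontr)
        assume "f U' \<notin> C"
        then have "{x \<in> S. h x \<in> topspace K - C} \<in> U'"
          using V(2) f U' by (intro lim) auto
        then have "{x \<in> S. h x \<in> V} \<inter> {x \<in> S. h x \<in> topspace K - C} \<in> U'"
          using filters_onD(4)[OF ultrafilters_onD(1)] U' by blast
        moreover have "{x \<in> S. h x \<in> V} \<inter> {x \<in> S. h x \<in> topspace K - C} = {}" using V(4) by blast
        ultimately show False using filters_onD(3)[OF ultrafilters_onD(1)[OF U'(1)]] by simp
      qed
      then have "{U' \<in> ultrafilters_on S. {x \<in> S. h x \<in> V} \<in> U'} \<subseteq> {U \<in> ultrafilters_on S. f U \<in> W}"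
        using V(5) by auto
      then show "\<exists>A\<in>U. {U' \<in> ultrafilters_on S. A \<in> U'} \<subseteq> {U \<in> ultrafilters_on S. f U \<in> W}"
        using lim[OF U(1) V(1,3)] by (rule bexI)
    qed blast
  qed
  ultimately show ?thesis by blast
qed

locale simple_ugraph =
  fixes G :: "'v ugraph"
  assumes simple: "simple_graph G"
begin

section \<open>Components\<close>

lemma edgeD:
  assumes "{u, v} \<in> edges G"
  shows "u \<in> verts G" "v \<in> verts G" "u \<noteq> v"
  using simple assms unfolding simple_graph_def by (metis doubleton_eq_iff)+

lemma adj_delete_iff:
  "(u, v) \<in> adj_rel (delete_verts G X) \<longleftrightarrow> {u, v} \<in> edges G \<and> u \<notin> X \<and> v \<notin> X"
  using edgeD[of u v]
  by (auto simp: adj_rel_def delete_verts_def induced_subgraph_def)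

lemma sym_adj_delete: "sym ((adj_rel (delete_verts G X))\<^sup>*)"
  by (intro sym_rtrancl symI) (simp add: adj_delete_iff insert_commute)

lemma comps_eq: "comps G X = {{w. (v, w) \<in> (adj_rel (delete_verts G X))\<^sup>*} | v. v \<in> verts G - X}"
  unfolding comps_def graph_components_def by (auto simp: delete_verts_def induced_subgraph_def)

lemma comps_cong_reach:
  assumes "C \<in> comps G X" "v \<in> C"
  shows "C = {w. (v, w) \<in> (adj_rel (delete_verts G X))\<^sup>*}"
proof -
  let ?R = "(adj_rel (delete_verts G X))\<^sup>*"
  obtain u where u: "C = {w. (u, w) \<in> ?R}" using assms(1) by (auto simp: comps_eq)
  then have "(u, v) \<in> ?R" "(v, u) \<in> ?R"
    using assms(2) sym_adj_delete[of X] by (auto dest: symD)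
  then show ?thesis unfolding u by (auto intro: rtrancl_trans)
qed

lemma comps_eqI: "C \<in> comps G X \<Longrightarrow> D \<in> comps G X \<Longrightarrow> v \<in> C \<Longrightarrow> v \<in> D \<Longrightarrow> C = D"
  using comps_cong_reach by metis

lemma comps_nonempty: "C \<in> comps G X \<Longrightarrow> \<exists>v. v \<in> C"
  by (auto simp: comps_eq)

text \<open>Induction along paths in the form of a closed set of vertices; inclusions between
  components for different deleted sets are derived from it.\<close>

lemma comps_least:
  assumes "C \<in> comps G X" "v \<in> C" "v \<in> S"
    and "\<And>u w. u \<in> S \<Longrightarrow> {u, w} \<in> edges G \<Longrightarrow> u \<notin> X \<Longrightarrow> w \<notin> X \<Longrightarrow> w \<in> S"
  shows "C \<subseteq> S"
proof
  fix w assume "w \<in> C"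
  then have "(v, w) \<in> (adj_rel (delete_verts G X))\<^sup>*" using comps_cong_reach assms by auto
  then show "w \<in> S"
    by (induction rule: rtrancl_induct) (use assms adj_delete_iff in auto)
qed

lemma comps_subset:
  assumes "C \<in> comps G X" shows "C \<subseteq> verts G - X"
proof -
  obtain v where "v \<in> verts G - X" "v \<in> C" using assms by (auto simp: comps_eq)
  then show ?thesis using edgeD(2) by (intro comps_least[OF assms]) auto
qed

lemma ex_comp: "v \<in> verts G \<Longrightarrow> v \<notin> X \<Longrightarrow> \<exists>C \<in> comps G X. v \<in> C"
  unfolding comps_eq by blast

lemma comps_step:
  assumes "C \<in> comps G X" "u \<in> C" "{u, w} \<in> edges G" "w \<notin> X"
  shows "w \<in> C"
proof -
  have "(u, w) \<in> adj_rel (delete_verts G X)"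
    using assms comps_subset by (auto simp: adj_delete_iff)
  then show ?thesis using comps_cong_reach[OF assms(1,2)] by auto
qed

lemma comp_supercomp:
  assumes "X \<subseteq> X'" "C' \<in> comps G X'"
  shows "\<exists>C \<in> comps G X. C' \<subseteq> C"
proof -
  obtain v where v: "v \<in> C'" using comps_nonempty assms(2) by blast
  then obtain C where C: "C \<in> comps G X" "v \<in> C" using ex_comp comps_subset assms by blast
  have "C' \<subseteq> C"
    using assms C by (intro comps_least[OF assms(2) v C(2)]) (blast intro: comps_step)
  then show ?thesis using C by blast
qed

section \<open>Maps between the sets of components for nested deleted sets\<close>

lemma comp_map_eqI:
  assumes "X \<subseteq> X'" "C' \<in> comps G X'" "C \<in> comps G X" "v \<in> C'" "v \<in> C"
  shows "comp_map G X' X C' = C"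
  unfolding comp_map_def using comp_supercomp[OF assms(1,2)] assms(2-)
  by (intro the_equality) (metis comps_eqI subsetD)+

lemma comp_map_in:
  assumes "X \<subseteq> X'" "C' \<in> comps G X'"
  shows "comp_map G X' X C' \<in> comps G X" "C' \<subseteq> comp_map G X' X C'"
proof -
  obtain C where "C \<in> comps G X" "C' \<subseteq> C" using comp_supercomp assms by blast
  moreover have "comp_map G X' X C' = C"
    using comps_nonempty assms calculation comp_map_eqI by (meson subsetD)
  ultimately show "comp_map G X' X C' \<in> comps G X" "C' \<subseteq> comp_map G X' X C'" by auto
qed

lemma comp_map_id: "C \<in> comps G X \<Longrightarrow> comp_map G X X C = C"
  using comps_nonempty comp_map_eqI by blast

lemma comp_map_comp:
  assumes "X \<subseteq> X'" "X' \<subseteq> X''" "C \<in> comps G X''"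
  shows "comp_map G X' X (comp_map G X'' X' C) = comp_map G X'' X C"
proof -
  obtain v where "v \<in> C" using comps_nonempty assms(3) by blast
  then show ?thesis using assms comp_map_in[of X' X'' C] comp_map_in[of X X'' C]
    by (intro comp_map_eqI[of _ _ _ _ v]) auto
qed

lemma nbhd_comp_subset: "C \<in> comps G X \<Longrightarrow> nbhd G C \<subseteq> X"
  unfolding nbhd_def using comps_step by blast

text \<open>Every edge leaving C ends in its neighbourhood and hence in X, so C does not grow when
  the vertices of X' - X are put back.\<close>

lemma comp_in_smaller:
  assumes "X \<subseteq> X'" "C \<in> comps G X'" "nbhd G C \<subseteq> X"
  shows "C \<in> comps G X"
proof -
  obtain v where v: "v \<in> C" using comps_nonempty assms(2) by blast
  note D = comp_map_in[OF assms(1,2)]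
  have "comp_map G X' X C \<subseteq> C"
  proof (rule comps_least[OF D(1) subsetD[OF D(2) v] v])
    fix u w assume "u \<in> C" "{u, w} \<in> edges G" "w \<notin> X"
    then show "w \<in> C" using assms(3) edgeD[of u w] unfolding nbhd_def by blast
  qed
  then show ?thesis using D by simp
qed

text \<open>The vertex y lies outside X, because it belongs to D, and is adjacent to C, so it joins
  C to D. All components of G - X' adjacent to y are thus merged; this is the device that separates
  different neighbourhoods.\<close>

lemma comp_map_of_nbhd:
  assumes "X \<subseteq> X'" "C \<in> comps G X'" "D \<in> comps G X" "y \<in> nbhd G C" "y \<in> D"
  shows "comp_map G X' X C = D"
proof -
  obtain u where u: "u \<in> C" "{u, y} \<in> edges G" using assms(4) by (auto simp: nbhd_def)
  have "u \<notin> X" using assms comps_subset u by blast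
  then have "u \<in> D" using comps_step[OF assms(3,5)] u by (simp add: insert_commute)
  then show ?thesis using comp_map_eqI assms u by blast
qed

lemma fin_subsets_Un: "X \<in> fin_subsets G \<Longrightarrow> Y \<in> fin_subsets G \<Longrightarrow> X \<union> Y \<in> fin_subsets G"
  by (auto simp: fin_subsets_def)

lemma fin_subsets_subset: "X \<in> fin_subsets G \<Longrightarrow> Y \<subseteq> X \<Longrightarrow> Y \<in> fin_subsets G"
  by (auto simp: fin_subsets_def intro: finite_subset)

lemma empty_fin_subset: "{} \<in> fin_subsets G"
  by (simp add: fin_subsets_def)

section \<open>Ends\<close>

text \<open>A ray is injective and meets a finite set only finitely often; from then on consecutive
  vertices stay in one component.\<close>

lemma ray_tail_ex:
  assumes "r \<in> rays G" "X \<in> fin_subsets G"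
  shows "\<exists>C \<in> comps G X. has_tail_in r C"
proof -
  have r: "inj r" "range r \<subseteq> verts G" "\<And>n. {r n, r (Suc n)} \<in> edges G"
    using assms(1) by (auto simp: rays_def)
  have "finite (r -` X)" using assms(2) r(1) by (simp add: fin_subsets_def finite_vimageI)
  then obtain N where N: "\<And>n. n \<ge> N \<Longrightarrow> r n \<notin> X"
    by (metis finite_nat_set_iff_bounded vimageI2 linorder_not_le)
  obtain C where C: "C \<in> comps G X" "r N \<in> C" using ex_comp r(2) N[of N] by blast
  have "r n \<in> C" if "n \<ge> N" for n
    using that
  proof (induction rule: dec_induct)
    case (step n)
    then show ?case using comps_step[OF C(1) step.IH r(3)] N[of "Suc n"] by simp
  qed (use C in auto)
  then show ?thesis using C by (auto simp: has_tail_in_def)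
qed

lemma ray_tail_unique:
  assumes "C \<in> comps G X" "D \<in> comps G X" "has_tail_in r C" "has_tail_in r D"
  shows "C = D"
proof -
  obtain m n where "r ` {m..} \<subseteq> C" "r ` {n..} \<subseteq> D" using assms by (auto simp: has_tail_in_def)
  then have "r (max m n) \<in> C" "r (max m n) \<in> D" by auto
  then show ?thesis using comps_eqI assms by blast
qed

lemma equiv_ray_equiv: "equiv (rays G) (ray_equiv G)"
proof (rule equivI)
  show "ray_equiv G \<subseteq> rays G \<times> rays G" by (auto simp: ray_equiv_def)
  show "refl_on (rays G) (ray_equiv G)"
    using ray_tail_ex by (auto simp: refl_on_def ray_equiv_def)
  show "sym (ray_equiv G)" by (auto simp: sym_def ray_equiv_def)
  show "trans (ray_equiv G)"
  proof (rule transI)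
    fix r s t assume "(r, s) \<in> ray_equiv G" "(s, t) \<in> ray_equiv G"
    then show "(r, t) \<in> ray_equiv G"
      unfolding ray_equiv_def using ray_tail_unique by simp metis
  qed
qed

lemma end_comp_eqI:
  assumes "\<omega> \<in> ends G" "X \<in> fin_subsets G" "r \<in> \<omega>" "C \<in> comps G X" "has_tail_in r C"
  shows "end_comp G X \<omega> = C"
  unfolding end_comp_def
proof (rule the_equality)
  show "C \<in> comps G X \<and> (\<forall>r\<in>\<omega>. has_tail_in r C)"
  proof (intro conjI ballI assms)
    fix s assume "s \<in> \<omega>"
    then have "(r, s) \<in> ray_equiv G"
      using assms(1,3) equiv_ray_equiv unfolding ends_def by (meson quotient_eq_iff)
    then obtain D where "D \<in> comps G X" "has_tail_in r D" "has_tail_in s D"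
      using assms(2) by (auto simp: ray_equiv_def)
    then show "has_tail_in s C" using ray_tail_unique assms by metis
  qed
qed (use assms ray_tail_unique in blast)

lemma end_ray:
  assumes "\<omega> \<in> ends G" obtains r where "r \<in> \<omega>" "r \<in> rays G"
  using assms equiv_ray_equiv unfolding ends_def
  by (metis equiv_Eps_in equiv_Eps_preserves)

lemma end_comp_in:
  assumes "\<omega> \<in> ends G" "X \<in> fin_subsets G"
  shows "end_comp G X \<omega> \<in> comps G X" and "r \<in> \<omega> \<Longrightarrow> has_tail_in r (end_comp G X \<omega>)"
proof -
  show "end_comp G X \<omega> \<in> comps G X"
    using end_ray[OF assms(1)] ray_tail_ex[OF _ assms(2)] end_comp_eqI[OF assms] by metis
  assume r: "r \<in> \<omega>"
  then have "r \<in> rays G" using assms(1) equiv_ray_equiv unfolding ends_def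
    by (metis in_quotient_imp_subset subsetD)
  then show "has_tail_in r (end_comp G X \<omega>)"
    using r ray_tail_ex[OF _ assms(2)] end_comp_eqI[OF assms] by metis
qed

lemma end_comp_mono:
  assumes "\<omega> \<in> ends G" "X' \<in> fin_subsets G" "X \<subseteq> X'"
  shows "comp_map G X' X (end_comp G X' \<omega>) = end_comp G X \<omega>"
proof -
  have X: "X \<in> fin_subsets G" using assms fin_subsets_subset by blast
  obtain r where r: "r \<in> \<omega>" using end_ray[OF assms(1)] by blast
  note C = end_comp_in(1)[OF assms(1,2)] end_comp_in(2)[OF assms(1,2) r]
  have "has_tail_in r (comp_map G X' X (end_comp G X' \<omega>))"
    using C comp_map_in(2)[OF assms(3) C(1)] by (force simp: has_tail_in_def)
  then show ?thesis
    using end_comp_eqI[OF assms(1) X r] comp_map_in(1)[OF assms(3) C(1)] by simp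
qed

text \<open>Equivalence of rays is defined through tails in common components, so an end is
  recovered from the family of its components.\<close>

lemma ends_eqI:
  assumes "\<omega> \<in> ends G" "\<omega>' \<in> ends G"
    and eq: "\<And>X. X \<in> fin_subsets G \<Longrightarrow> end_comp G X \<omega> = end_comp G X \<omega>'"
  shows "\<omega> = \<omega>'"
proof -
  obtain r r' where r: "r \<in> \<omega>" "r \<in> rays G" "r' \<in> \<omega>'" "r' \<in> rays G"
    using end_ray assms by metis
  have "(r, r') \<in> ray_equiv G"
    unfolding ray_equiv_def using r eq end_comp_in[OF assms(1)] end_comp_in[OF assms(2)]
    by (clarsimp) metis
  then show ?thesis
    using assms(1,2) r equiv_ray_equiv unfolding ends_def by (meson quotient_eqI)
qed

section \<open>The 1-complex\<close>

lemma vertex_pt_eq_iff [simp]: "vertex_pt u = vertex_pt v \<longleftrightarrow> u = v"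
  by (auto simp: vertex_pt_def fun_eq_iff of_bool_def split: if_splits)

lemma edge_pt_0: "edge_pt u v 0 = vertex_pt u"
  by (simp add: edge_pt_def vertex_pt_def)

lemma edge_pt_1: "edge_pt u v 1 = vertex_pt v"
  by (simp add: edge_pt_def vertex_pt_def)

lemma edge_pt_swap: "edge_pt u v t = edge_pt v u (1 - t)"
  by (simp add: edge_pt_def fun_eq_iff)

lemma edge_pt_in_complex:
  assumes "{u, v} \<in> edges G" "0 \<le> t" "t \<le> 1"
  shows "edge_pt u v t \<in> complex_pts G"
proof -
  consider "t = 0" | "t = 1" | "0 < t" "t < 1" using assms by linarith
  then show ?thesis
    using edgeD[OF assms(1)] assms(1) unfolding complex_pts_def
    by cases (auto simp: edge_pt_0 edge_pt_1 inner_edge_pts_def)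
qed

lemma edge_pt_nonzero_iff:
  assumes "u \<noteq> v" "0 < t" "t < 1"
  shows "edge_pt u v t w \<noteq> 0 \<longleftrightarrow> w = u \<or> w = v"
  using assms by (auto simp: edge_pt_def)

text \<open>The support of the barycentric coordinates tells the two kinds of points apart: one
  vertex for a vertex point, both ends of the edge for an inner point. Later arguments speak of
  supports instead of parametrisations.\<close>

lemma complex_pts_cases [consumes 1, case_names vertex edge]:
  assumes "p \<in> complex_pts G"
  obtains v where "v \<in> verts G" "p = vertex_pt v" "\<And>w. p w \<noteq> 0 \<longleftrightarrow> w = v"
  | u v t where "{u, v} \<in> edges G" "u \<in> verts G" "v \<in> verts G" "u \<noteq> v" "0 < t" "t < 1"
      "p = edge_pt u v t" "\<And>w. p w \<noteq> 0 \<longleftrightarrow> w = u \<or> w = v"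
proof -
  consider v where "v \<in> verts G" "p = vertex_pt v"
    | u v t where "{u, v} \<in> edges G" "0 < t" "t < 1" "p = edge_pt u v t"
    using assms unfolding complex_pts_def inner_edge_pts_def by blast
  then show ?thesis
  proof cases
    case 1
    then show ?thesis using that(1) by (simp add: vertex_pt_def)
  next
    case (2 u v t)
    note uv = edgeD[OF 2(1)]
    then have "p w \<noteq> 0 \<longleftrightarrow> w = u \<or> w = v" for w
      unfolding 2(4) using edge_pt_nonzero_iff[OF uv(3) 2(2,3)] by simp
    then show ?thesis by (intro that(2)[OF 2(1) uv 2(2-4)])
  qed
qed

lemma complex_nonzero_vert: "p \<in> complex_pts G \<Longrightarrow> p w \<noteq> 0 \<Longrightarrow> w \<in> verts G"
  by (erule complex_pts_cases) auto

lemma complex_support: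
  assumes "p \<in> complex_pts G" obtains w where "w \<in> verts G" "p w \<noteq> 0"
  using assms by (cases rule: complex_pts_cases) auto

lemma vertex_notin_inner: "vertex_pt v \<notin> inner_edge_pts G"
proof
  assume "vertex_pt v \<in> inner_edge_pts G"
  then obtain x y t where *: "{x, y} \<in> edges G" "0 < t" "t < 1" "vertex_pt v = edge_pt x y t"
    by (auto simp: inner_edge_pts_def)
  have "edge_pt x y t x \<noteq> 0" "edge_pt x y t y \<noteq> 0"
    using edge_pt_nonzero_iff[of x y t] edgeD[OF *(1)] *(2,3) by auto
  then show False using edgeD(3)[OF *(1)] unfolding *(4)[symmetric]
    by (auto simp: vertex_pt_def split: if_splits)
qed

text \<open>
  For a union \<open>S\<close> of components of \<open>G - X\<close> this is the trace on the 1-complex of a basic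
  neighbourhood of the induced space; it does not mention \<open>X\<close>.
\<close>

definition touch :: "'v set \<Rightarrow> ('v \<Rightarrow> real) set" where
  "touch S = {p \<in> complex_pts G. \<exists>w \<in> S. p w \<noteq> 0}"

lemma touch_vertex_iff: "vertex_pt v \<in> touch S \<longleftrightarrow> v \<in> verts G \<and> v \<in> S"
proof -
  have "vertex_pt v \<in> complex_pts G \<longleftrightarrow> v \<in> verts G"
    using vertex_notin_inner by (auto simp: complex_pts_def)
  then show ?thesis by (auto simp: touch_def vertex_pt_def)
qed

lemma touch_mono: "S \<subseteq> T \<Longrightarrow> touch S \<subseteq> touch T"
  by (auto simp: touch_def)

section \<open>Generators of the topology and open stars\<close>

definition complex_basis :: "('v \<Rightarrow> real) set set" where
  "complex_basis =
     {edge_pt u v ` {a<..<b} | u v a b. {u, v} \<in> edges G \<and> 0 \<le> a \<and> a < b \<and> b \<le> 1}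
      \<union> {insert (vertex_pt v) (\<Union>w \<in> {w. {v, w} \<in> edges G}. edge_pt v w ` {0..<\<epsilon> w}) | v \<epsilon>.
           v \<in> verts G \<and> (\<forall>w. 0 < \<epsilon> w \<and> \<epsilon> w \<le> 1)}"

lemma one_complex_eq: "one_complex G = topology_generated_by complex_basis"
  by (simp only: one_complex_def complex_basis_def)

lemma complex_basis_cases [consumes 1, case_names interval star]:
  assumes "U \<in> complex_basis"
  obtains u v a b where "U = edge_pt u v ` {a<..<b}" "{u, v} \<in> edges G" "0 \<le> a" "a < b" "b \<le> 1"
  | v \<epsilon> where "U = insert (vertex_pt v) (\<Union>w \<in> {w. {v, w} \<in> edges G}. edge_pt v w ` {0..<\<epsilon> w})"
      "v \<in> verts G" "\<And>w. 0 < \<epsilon> w" "\<And>w. \<epsilon> w \<le> 1"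
proof -
  from assms show thesis
    unfolding complex_basis_def
  proof (elim UnE CollectE exE conjE)
    fix v \<epsilon>
    assume "U = insert (vertex_pt v) (\<Union>w \<in> {w. {v, w} \<in> edges G}. edge_pt v w ` {0..<\<epsilon> w})"
      and "v \<in> verts G" and "\<forall>w. 0 < \<epsilon> w \<and> \<epsilon> w \<le> 1"
    then show thesis by (intro that(2)[of v \<epsilon>]) simp_all
  qed (rule that(1))
qed

lemma interval_in_basis:
  "{u, v} \<in> edges G \<Longrightarrow> edge_pt u v ` {0<..<1} \<in> complex_basis"
  unfolding complex_basis_def
  by (intro UnI1 CollectI exI[of _ u] exI[of _ v] exI[of _ 0] exI[of _ 1]) simp

lemma star_in_basis:
  "v \<in> verts G \<Longrightarrow>
    insert (vertex_pt v) (\<Union>w \<in> {w. {v, w} \<in> edges G}. edge_pt v w ` {0..<1}) \<in> complex_basis"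
  unfolding complex_basis_def
  by (intro UnI2 CollectI exI[of _ v] exI[of _ "\<lambda>w. 1"]) simp

lemma topspace_one_complex: "topspace (one_complex G) = complex_pts G"
proof -
  have "p \<in> complex_pts G" if p: "p \<in> U" and U: "U \<in> complex_basis" for p U
    using U
  proof (cases rule: complex_basis_cases)
    case (interval u v a b)
    then obtain t where "p = edge_pt u v t" "a < t" "t < b" using p by auto
    then show ?thesis using edge_pt_in_complex[of u v t] interval by simp
  next
    case (star v \<epsilon>)
    then consider "p = vertex_pt v"
      | w t where "{v, w} \<in> edges G" "p = edge_pt v w t" "0 \<le> t" "t < \<epsilon> w" using p by auto
    then show ?thesis
    proof cases
      case (2 w t)
      then show ?thesis using edge_pt_in_complex[of v w t] star(4)[of w] by simp
    qed (use star in \<open>simp add: complex_pts_def\<close>)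
  qed
  moreover have "\<exists>U \<in> complex_basis. p \<in> U" if "p \<in> complex_pts G" for p
    using that
  proof (cases rule: complex_pts_cases)
    case (vertex v)
    then show ?thesis using star_in_basis[of v] by blast
  next
    case (edge u v t)
    then have "p \<in> edge_pt u v ` {0<..<1}" by simp
    then show ?thesis using interval_in_basis edge by blast
  qed
  ultimately show ?thesis
    unfolding one_complex_eq topology_generated_by_topspace by blast
qed

text \<open>For a single vertex this set is its open star with all lengths equal to 1, one of the
  generators; in general it is a union of such stars.\<close>

lemma openin_touch: "openin (one_complex G) (touch S)"
proof -
  have "openin (one_complex G) (touch {v})" if v: "v \<in> verts G" for v
  proof -
    have "touch {v} = insert (vertex_pt v) (\<Union>w \<in> {w. {v, w} \<in> edges G}. edge_pt v w ` {0..<1})"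
      (is "_ = ?R")
    proof (intro equalityI subsetI)
      fix p assume "p \<in> touch {v}"
      then have p: "p \<in> complex_pts G" "p v \<noteq> 0" by (auto simp: touch_def)
      from p(1) show "p \<in> ?R"
      proof (cases rule: complex_pts_cases)
        case (edge x y t)
        consider "x = v" | "y = v" using p(2) edge(8)[of v] by blast
        then show ?thesis
        proof cases
          case 2
          then have "p = edge_pt v x (1 - t)" "{v, x} \<in> edges G"
            using edge edge_pt_swap[of x y t] by (auto simp: insert_commute)
          then show ?thesis using edge by auto
        qed (use edge in auto)
      qed (use p in auto)
    next
      fix p assume p: "p \<in> ?R"
      then have "p v \<noteq> 0" using edgeD(3) by (auto simp: vertex_pt_def edge_pt_def)
      moreover have "vertex_pt v \<in> complex_pts G" using v by (simp add: complex_pts_def)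
      then have "p \<in> complex_pts G"
        using p edge_pt_in_complex by auto
      ultimately show "p \<in> touch {v}" by (auto simp: touch_def)
    qed
    moreover have "openin (one_complex G) ?R"
      unfolding one_complex_eq using star_in_basis[OF v] by (rule topology_generated_by_Basis)
    ultimately show ?thesis by simp
  qed
  moreover have "touch S = (\<Union>v \<in> S \<inter> verts G. touch {v})"
    using complex_nonzero_vert by (auto simp: touch_def)
  ultimately show ?thesis by (auto intro!: openin_Union)
qed

text \<open>An edge with one end w in a component of G - X has its other end either in X, and then
  its inner points lie in \<open>inner_between\<close>, or in the same component, and then the edge
  lies in the induced subgraph.\<close>

lemma basic_nbhd_eq_touch:
  assumes "\<C> \<subseteq> comps G X"
  shows "complex_pts (induced_subgraph G (\<Union>\<C>)) \<union> inner_between G X (\<Union>\<C>) = touch (\<Union>\<C>)"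
    (is "?L = _")
proof (intro equalityI subsetI)
  have sub: "\<Union>\<C> \<subseteq> verts G - X" using assms comps_subset by blast
  {
    fix p assume p: "p \<in> ?L"
    have "(\<exists>v \<in> \<Union>\<C>. p = vertex_pt v) \<or>
      (\<exists>u t. \<exists>v \<in> \<Union>\<C>. {u, v} \<in> edges G \<and> 0 < t \<and> t < 1 \<and> p = edge_pt u v t)"
      using p unfolding complex_pts_def induced_subgraph_def inner_edge_pts_def inner_between_def
      by auto blast+
    then consider v where "v \<in> \<Union>\<C>" "p = vertex_pt v"
      | u v t where "v \<in> \<Union>\<C>" "{u, v} \<in> edges G" "0 < t" "t < 1" "p = edge_pt u v t"
      by blast
    then show "p \<in> touch (\<Union>\<C>)"
    proof cases
      case 1
      then show ?thesis using sub touch_vertex_iff by blast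
    next
      case (2 u v t)
      then have "p v \<noteq> 0" using edge_pt_nonzero_iff edgeD(3) by metis
      then show ?thesis using 2 edge_pt_in_complex[of u v t] by (auto simp: touch_def)
    qed
  next
    fix p assume "p \<in> touch (\<Union>\<C>)"
    then obtain w where p: "p \<in> complex_pts G" and w: "w \<in> \<Union>\<C>" "p w \<noteq> 0"
      by (auto simp: touch_def)
    from p show "p \<in> ?L"
    proof (cases rule: complex_pts_cases)
      case (vertex v)
      then show ?thesis using w by (auto simp: complex_pts_def induced_subgraph_def)
    next
      case (edge x y t)
      obtain u s where u: "p = edge_pt u w s" "{u, w} \<in> edges G" "u \<in> verts G" "0 < s" "s < 1"
      proof -
        have "w = x \<or> w = y" using w edge by blast
        then show ?thesis
          using edge that[of x t] that[of y "1 - t"] edge_pt_swap[of x y t]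
          by (auto simp: insert_commute)
      qed
      show ?thesis
      proof (cases "u \<in> X")
        case True
        then show ?thesis using u w by (auto simp: inner_between_def)
      next
        case False
        then have "u \<in> \<Union>\<C>"
          using w comps_step[of _ X w u] u assms by (auto simp: insert_commute)
        then show ?thesis
          using u w by (auto simp: complex_pts_def induced_subgraph_def inner_edge_pts_def)
      qed
    qed
  }
qed

text \<open>The topology has only generators, so their preimages are computed explicitly. The
  generator may use the edge xy in either direction, hence the two alternatives in each preimage; in
  this way closed edges become compact.\<close>

lemma continuous_map_edge_pt:
  assumes e: "{x, y} \<in> edges G"
  shows "continuous_map (top_of_set {0..1}) (one_complex G) (edge_pt x y)"
  unfolding one_complex_eq continuous_on_generated_topo_iff
proof (intro conjI allI impI)
  note xy = edgeD(3)[OF e]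
  show "edge_pt x y ` topspace (top_of_set {0..1}) \<subseteq> \<Union> complex_basis"
    using topspace_one_complex edge_pt_in_complex[OF e]
    unfolding one_complex_eq topology_generated_by_topspace by auto
  \<comment> \<open>The coordinates at u and v are 1 - t and t, both nonzero, so they determine the
    direction of the edge and the parameter s.\<close>
  have coord: "edge_pt x y s = edge_pt u v t \<longleftrightarrow> (x = u \<and> y = v \<and> s = t) \<or> (x = v \<and> y = u \<and> s = 1 - t)"
    if "0 < t" "t < 1" "u \<noteq> v" for u v s t
  proof
    assume eq: "edge_pt x y s = edge_pt u v t"
    then have "edge_pt x y s u = 1 - t" "edge_pt x y s v = t"
      using that by (auto simp: edge_pt_def)
    then show "(x = u \<and> y = v \<and> s = t) \<or> (x = v \<and> y = u \<and> s = 1 - t)"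
      using that xy by (auto simp: edge_pt_def of_bool_def split: if_splits)
  qed (auto intro: edge_pt_swap[symmetric])
  have vert: "edge_pt x y s = vertex_pt v \<longleftrightarrow> (x = v \<and> s = 0) \<or> (y = v \<and> s = 1)" for s v
  proof
    assume "edge_pt x y s = vertex_pt v"
    then have "edge_pt x y s v = 1" "edge_pt x y s x = of_bool (x = v)"
        "edge_pt x y s y = of_bool (y = v)" by (auto simp: vertex_pt_def)
    then show "(x = v \<and> s = 0) \<or> (y = v \<and> s = 1)"
      using xy by (auto simp: edge_pt_def of_bool_def split: if_splits)
  qed (auto simp: edge_pt_0 edge_pt_1)
  have openI: "openin (top_of_set {0..1}) (T \<inter> {0..1})" if "open T" for T :: "real set"
    using openin_open_Int[OF that, of "{0..1}"] by (metis Int_commute)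
  fix U assume "U \<in> complex_basis"
  then show "openin (top_of_set {0..1}) (edge_pt x y -` U \<inter> topspace (top_of_set {0..1}))"
  proof (cases rule: complex_basis_cases)
    case 1: (interval u v a b)
    have uv: "u \<noteq> v" using edgeD 1 by blast
    have iff: "edge_pt x y s \<in> U \<longleftrightarrow> (x = u \<and> y = v \<and> s \<in> {a<..<b}) \<or> (x = v \<and> y = u \<and> s \<in> {1-b<..<1-a})" for s
    proof -
      have "edge_pt x y s \<in> U \<longleftrightarrow> (\<exists>t \<in> {a<..<b}. edge_pt x y s = edge_pt u v t)"
        using 1 by auto
      also have "\<dots> \<longleftrightarrow> (\<exists>t \<in> {a<..<b}. (x = u \<and> y = v \<and> s = t) \<or> (x = v \<and> y = u \<and> s = 1 - t))"
        using coord uv 1 by (intro bex_cong) auto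
      also have "\<dots> \<longleftrightarrow> (x = u \<and> y = v \<and> s \<in> {a<..<b}) \<or> (x = v \<and> y = u \<and> s \<in> {1-b<..<1-a})"
      proof -
        have "s = 1 - t \<longleftrightarrow> t = 1 - s" for t by auto
        then show ?thesis by (simp only: bex_disj_distrib) auto
      qed
      finally show ?thesis .
    qed
    have "open (edge_pt x y -` U)"
      unfolding vimage_def iff greaterThanLessThan_iff
      by (intro open_Collect_disj open_Collect_conj open_Collect_const open_Collect_less
            continuous_intros)
    then show ?thesis using openI by simp
  next
    case 2: (star v \<epsilon>)
    have iff: "edge_pt x y s \<in> U \<longleftrightarrow> (x = v \<and> s < \<epsilon> y) \<or> (y = v \<and> 1 - s < \<epsilon> x)"
      if s: "s \<in> {0..1}" for s
    proof -
      have "edge_pt x y s \<in> U \<longleftrightarrow> edge_pt x y s = vertex_pt v \<or>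
          (\<exists>w t. {v, w} \<in> edges G \<and> 0 < t \<and> t < \<epsilon> w \<and> edge_pt x y s = edge_pt v w t)" (is "_ \<longleftrightarrow> _ \<or> ?Q")
      proof
        assume "edge_pt x y s \<in> U"
        then consider "edge_pt x y s = vertex_pt v"
          | w t where "{v, w} \<in> edges G" "0 \<le> t" "t < \<epsilon> w" "edge_pt x y s = edge_pt v w t"
          unfolding 2(1) by fastforce
        then show "edge_pt x y s = vertex_pt v \<or> ?Q"
        proof cases
          case (2 w t)
          then consider "t = 0" | "0 < t" by linarith
          then show ?thesis
            by cases (use 2 edge_pt_0[of v w] in \<open>simp; fail | blast\<close>)+
        qed blast
      next
        assume "edge_pt x y s = vertex_pt v \<or> ?Q"
        then show "edge_pt x y s \<in> U" unfolding 2(1) by fastforce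
      qed
      \<comment> \<open>The bound \<epsilon> w \<le> 1 enters here: it gives t < 1, so together with
        0 < t the comparison \<open>coord\<close> applies. The parameter t = 0 was split off as the
        vertex itself.\<close>
      also have "?Q \<longleftrightarrow> (\<exists>w t. {v, w} \<in> edges G \<and> 0 < t \<and> t < \<epsilon> w \<and>
          ((x = v \<and> y = w \<and> s = t) \<or> (x = w \<and> y = v \<and> s = 1 - t)))"
        by (intro ex_cong1 conj_cong refl coord) (use 2(4) edgeD(3) less_le_trans in blast)+
      also have "\<dots> \<longleftrightarrow> (x = v \<and> 0 < s \<and> s < \<epsilon> y) \<or> (y = v \<and> 0 < 1 - s \<and> 1 - s < \<epsilon> x)"
      proof -
        have "{y, x} \<in> edges G" using e by (simp add: insert_commute)
        moreover have "s = 1 - t \<longleftrightarrow> t = 1 - s" for t by auto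
        ultimately show ?thesis using e
          by (simp only: ex_disj_distrib conj_disj_distribL) auto
      qed
      finally show ?thesis using vert[of s v] s 2(3)[of x] 2(3)[of y] xy by auto
    qed
    have "edge_pt x y -` U \<inter> {0..1} =
        {s \<in> {0..1}. (x = v \<and> s < \<epsilon> y) \<or> (y = v \<and> 1 - s < \<epsilon> x)}"
      unfolding vimage_def using iff by blast
    also have "\<dots> = {s. (x = v \<and> s < \<epsilon> y) \<or> (y = v \<and> 1 - s < \<epsilon> x)} \<inter> {0..1}" by blast
    finally have "edge_pt x y -` U \<inter> {0..1} = \<dots>" .
    moreover have "open {s. (x = v \<and> s < \<epsilon> y) \<or> (y = v \<and> 1 - s < \<epsilon> x)}"
      by (intro open_Collect_disj open_Collect_conj open_Collect_const open_Collect_less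
            continuous_intros)
    ultimately show ?thesis using openI by simp
  qed
qed

text \<open>A point whose support avoids the vertices outside X lies in the subgraph induced on X,
  which has finitely many vertices and closed edges. This is what the neighbourhoods around the
  limit points leave uncovered.\<close>

lemma compactin_finite_subcomplex:
  assumes "X \<in> fin_subsets G"
  shows "compactin (one_complex G) (complex_pts G - touch (verts G - X))"
proof -
  let ?E = "{(u, v). u \<in> X \<and> v \<in> X \<and> {u, v} \<in> edges G}"
  have X: "finite X" "X \<subseteq> verts G" using assms by (auto simp: fin_subsets_def)
  have "complex_pts G - touch (verts G - X) =
      vertex_pt ` X \<union> (\<Union>(u, v) \<in> ?E. edge_pt u v ` {0..1})" (is "?L = ?R")
  proof (intro equalityI subsetI)
    fix p assume "p \<in> ?L"
    then have p: "p \<in> complex_pts G" "\<And>w. w \<in> verts G \<Longrightarrow> p w \<noteq> 0 \<Longrightarrow> w \<in> X"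
      by (auto simp: touch_def)
    from p(1) show "p \<in> ?R"
    proof (cases rule: complex_pts_cases)
      case (edge u v t)
      then have "(u, v) \<in> ?E" "p \<in> edge_pt u v ` {0..1}" using p by auto
      then show ?thesis by blast
    qed (use p in auto)
  next
    fix p assume "p \<in> ?R"
    then consider v where "v \<in> X" "p = vertex_pt v"
      | u v t where "u \<in> X" "v \<in> X" "{u, v} \<in> edges G" "p = edge_pt u v t" "0 \<le> t" "t \<le> 1"
      by auto
    then show "p \<in> ?L"
    proof cases
      case 1
      then show ?thesis using touch_vertex_iff[of v] X by (auto simp: complex_pts_def)
    next
      case (2 u v t)
      then have "p w = 0" if "w \<notin> X" for w using that by (auto simp: edge_pt_def)
      then show ?thesis using edge_pt_in_complex 2 by (auto simp: touch_def)
    qed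
  qed
  moreover have "compactin (one_complex G) (\<Union>(u, v) \<in> ?E. edge_pt u v ` {0..1})"
  proof (rule compactin_Union)
    show "finite ((\<lambda>(u, v). edge_pt u v ` {0..1::real}) ` ?E)"
      using X finite_subset[of ?E "X \<times> X"] by auto
    fix K assume "K \<in> (\<lambda>(u, v). edge_pt u v ` {0..1::real}) ` ?E"
    then obtain u v where "{u, v} \<in> edges G" "K = edge_pt u v ` {0..1}" by auto
    then show "compactin (one_complex G) K"
      using continuous_map_edge_pt
      by (auto intro!: image_compactin[where X = "top_of_set {0..1}"] simp: compactin_subtopology)
  qed
  moreover have "compactin (one_complex G) (vertex_pt ` X)"
    using X topspace_one_complex by (intro finite_imp_compactin) (auto simp: complex_pts_def)
  ultimately show ?thesis by (simp only: compactin_Un)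
qed

section \<open>\<open>\<C>\<close>-systems\<close>

lemma C_system_space:
  assumes "C_system G A" "X \<in> fin_subsets G"
  shows "Hausdorff_space (csp A X)"
    and "compactification (discrete_topology (comps G X)) (csp A X) (cemb A X)"
    and "compact_space (csp A X)"
    and "C \<in> comps G X \<Longrightarrow> cemb A X C \<in> topspace (csp A X)"
    and "csp A X closure_of (cemb A X ` comps G X) = topspace (csp A X)"
    and "inj_on (cemb A X) (comps G X)"
    and "C \<in> comps G X \<Longrightarrow> openin (csp A X) {cemb A X C}"
proof -
  show H: "Hausdorff_space (csp A X)"
    and c: "compactification (discrete_topology (comps G X)) (csp A X) (cemb A X)"
    using assms by (simp_all add: C_system_def)
  then show "compact_space (csp A X)"
    and "csp A X closure_of (cemb A X ` comps G X) = topspace (csp A X)"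
    by (simp_all add: compactification_def)
  show "C \<in> comps G X \<Longrightarrow> openin (csp A X) {cemb A X C}"
    using open_point_discrete_compactification[OF H c] .
  then show "C \<in> comps G X \<Longrightarrow> cemb A X C \<in> topspace (csp A X)"
    using openin_subset by blast
  have "homeomorphic_map (discrete_topology (comps G X))
      (subtopology (csp A X) (cemb A X ` comps G X)) (cemb A X)"
    using c by (simp add: compactification_def embedding_map_def)
  then show "inj_on (cemb A X) (comps G X)"
    using homeomorphic_imp_injective_map by fastforce
qed

lemma C_system_bond:
  assumes "C_system G A" "X' \<in> fin_subsets G" "X \<subseteq> X'"
  shows "continuous_map (csp A X') (csp A X) (cbond A X' X)"
    and "C \<in> comps G X' \<Longrightarrow> cbond A X' X (cemb A X' C) = cemb A X (comp_map G X' X C)"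
    and "p \<in> topspace (csp A X') \<Longrightarrow> cbond A X' X p \<in> topspace (csp A X)"
    and "p \<in> topspace (csp A X) \<Longrightarrow> cbond A X X p = p"
    and "X'' \<subseteq> X \<Longrightarrow> p \<in> topspace (csp A X') \<Longrightarrow>
      cbond A X X'' (cbond A X' X p) = cbond A X' X'' p"
proof -
  have X: "X \<in> fin_subsets G" using assms fin_subsets_subset by blast
  show cont: "continuous_map (csp A X') (csp A X) (cbond A X' X)"
    and "C \<in> comps G X' \<Longrightarrow> cbond A X' X (cemb A X' C) = cemb A X (comp_map G X' X C)"
    and "p \<in> topspace (csp A X) \<Longrightarrow> cbond A X X p = p"
    using assms X unfolding C_system_def by simp_all
  show "p \<in> topspace (csp A X') \<Longrightarrow> cbond A X' X p \<in> topspace (csp A X)"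
    using cont continuous_map_image_subset_topspace by blast
  assume "X'' \<subseteq> X" "p \<in> topspace (csp A X')"
  then show "cbond A X X'' (cbond A X' X p) = cbond A X' X'' p"
    using assms X fin_subsets_subset[OF X] unfolding C_system_def by simp
qed

text \<open>
  Functoriality of the bonding maps and compatibility of comparison maps hold on the dense set
  of components, and hence everywhere.
\<close>

lemma C_systemI:
  assumes H: "\<And>X. X \<in> fin_subsets G \<Longrightarrow> Hausdorff_space (csp A X)"
    and c: "\<And>X. X \<in> fin_subsets G \<Longrightarrow>
      compactification (discrete_topology (comps G X)) (csp A X) (cemb A X)"
    and b: "\<And>X X'. X' \<in> fin_subsets G \<Longrightarrow> X \<subseteq> X' \<Longrightarrow>
      continuous_map (csp A X') (csp A X) (cbond A X' X)"
    and e: "\<And>X X' C. X' \<in> fin_subsets G \<Longrightarrow> X \<subseteq> X' \<Longrightarrow> C \<in> comps G X' \<Longrightarrow>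
      cbond A X' X (cemb A X' C) = cemb A X (comp_map G X' X C)"
  shows "C_system G A"
proof -
  have dense: "p \<in> csp A X closure_of (cemb A X ` comps G X)"
    if "X \<in> fin_subsets G" "p \<in> topspace (csp A X)" for X p
    using c that by (simp add: compactification_def)
  have "cbond A X X p = p" if X: "X \<in> fin_subsets G" and p: "p \<in> topspace (csp A X)" for X p
    by (rule forall_in_closure_of_eq[OF dense[OF X p] H[OF X] b continuous_map_id[unfolded id_def]])
      (use X e comp_map_id in auto)
  moreover have "cbond A X' X (cbond A X'' X' p) = cbond A X'' X p"
    if X: "X \<in> fin_subsets G" "X' \<in> fin_subsets G" "X'' \<in> fin_subsets G" "X \<subseteq> X'" "X' \<subseteq> X''"
      and p: "p \<in> topspace (csp A X'')" for X X' X'' p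
  proof (rule forall_in_closure_of_eq[OF dense[OF X(3) p] H[OF X(1)]])
    show "continuous_map (csp A X'') (csp A X) (\<lambda>p. cbond A X' X (cbond A X'' X' p))"
      using continuous_map_compose[OF b[OF X(3,5)] b[OF X(2,4)]] by (simp add: o_def)
    show "continuous_map (csp A X'') (csp A X) (cbond A X'' X)" using b X by (meson subset_trans)
    fix x assume "x \<in> cemb A X'' ` comps G X''"
    then obtain C where C: "C \<in> comps G X''" "x = cemb A X'' C" by blast
    have "X \<subseteq> X''" using X by blast
    then show "cbond A X' X (cbond A X'' X' x) = cbond A X'' X x"
      using C X e comp_map_in(1)[OF X(5) C(1)] comp_map_comp[OF X(4,5) C(1)] by simp
  qed
  ultimately show ?thesis
    unfolding C_system_def using H c b e by (intro conjI ballI impI) simp_all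
qed

lemma C_leI:
  assumes A: "C_system G A" and D: "C_system G D"
    and "\<And>X. X \<in> fin_subsets G \<Longrightarrow>
      \<exists>f. le_witness (comps G X) (csp A X) (cemb A X) (csp D X) (cemb D X) f"
  shows "C_le G A D"
proof -
  obtain f where f: "\<And>X. X \<in> fin_subsets G \<Longrightarrow>
      le_witness (comps G X) (csp A X) (cemb A X) (csp D X) (cemb D X) (f X)"
    using assms(3) by metis
  have "f X (cbond D X' X p) = cbond A X' X (f X' p)"
    if X: "X \<in> fin_subsets G" "X' \<in> fin_subsets G" "X \<subseteq> X'" and p: "p \<in> topspace (csp D X')"
    for X X' p
  proof (rule forall_in_closure_of_eq[where f = "\<lambda>p. f X (cbond D X' X p)"
        and g = "\<lambda>p. cbond A X' X (f X' p)"])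
    note fX = f[OF X(1), unfolded le_witness_def] and fX' = f[OF X(2), unfolded le_witness_def]
    show "p \<in> csp D X' closure_of (cemb D X' ` comps G X')"
      using C_system_space(5)[OF D X(2)] p by simp
    show "Hausdorff_space (csp A X)" using C_system_space(1)[OF A X(1)] .
    show "continuous_map (csp D X') (csp A X) (\<lambda>p. f X (cbond D X' X p))"
      using continuous_map_compose[OF C_system_bond(1)[OF D X(2,3)]] fX by (auto simp: o_def)
    show "continuous_map (csp D X') (csp A X) (\<lambda>p. cbond A X' X (f X' p))"
      using continuous_map_compose[OF _ C_system_bond(1)[OF A X(2,3)]] fX' by (auto simp: o_def)
    fix x assume "x \<in> cemb D X' ` comps G X'"
    then obtain C where C: "C \<in> comps G X'" "x = cemb D X' C" by blast
    then show "f X (cbond D X' X x) = cbond A X' X (f X' x)"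
      using C_system_bond(2)[OF D X(2,3) C(1)] C_system_bond(2)[OF A X(2,3) C(1)]
        fX fX' comp_map_in(1)[OF X(3) C(1)] by simp
  qed
  then show ?thesis unfolding C_le_def using f by blast
qed

section \<open>The system of ultrafilters\<close>

text \<open>For a filter the condition on images is equivalent to a test by preimages, so the bond
  is the image ultrafilter under \<open>comp_map\<close>. Preimages commute with intersections and
  complements, which transports the ultrafilter axioms.\<close>

lemma C_U_bond:
  assumes "X \<subseteq> X'" "U \<in> ultrafilters_on (comps G X')"
  shows "cbond (C_U G) X' X U =
    {A. A \<subseteq> comps G X \<and> {C \<in> comps G X'. comp_map G X' X C \<in> A} \<in> U}"
proof -
  note F = filters_onD[OF ultrafilters_onD(1)[OF assms(2)]]
  have "(\<exists>B\<in>U. comp_map G X' X ` B \<subseteq> A) \<longleftrightarrow> {C \<in> comps G X'. comp_map G X' X C \<in> A} \<in> U" for A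
  proof
    assume "\<exists>B\<in>U. comp_map G X' X ` B \<subseteq> A"
    then obtain B where B: "B \<in> U" "comp_map G X' X ` B \<subseteq> A" by blast
    show "{C \<in> comps G X'. comp_map G X' X C \<in> A} \<in> U"
      by (rule F(5)[OF B(1)]) (use B F(1)[OF B(1)] in auto)
  next
    assume "{C \<in> comps G X'. comp_map G X' X C \<in> A} \<in> U"
    then show "\<exists>B\<in>U. comp_map G X' X ` B \<subseteq> A" by (rule bexI[rotated]) auto
  qed
  then show ?thesis unfolding C_U_def by simp
qed

lemma C_U_bond_ultrafilter:
  assumes "X \<subseteq> X'" "U \<in> ultrafilters_on (comps G X')"
  shows "cbond (C_U G) X' X U \<in> ultrafilters_on (comps G X)"
proof -
  note F = filters_onD[OF ultrafilters_onD(1)[OF assms(2)]]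
  let ?p = "\<lambda>A. {C \<in> comps G X'. comp_map G X' X C \<in> A}"
  let ?V = "{A. A \<subseteq> comps G X \<and> ?p A \<in> U}"
  have int: "?p (A \<inter> B) = ?p A \<inter> ?p B" for A B by blast
  have top: "?p (comps G X) = comps G X'" using comp_map_in(1)[OF assms(1)] by blast
  have compl: "?p (comps G X - A) = comps G X' - ?p A" for A
    using comp_map_in(1)[OF assms(1)] by blast
  have "comps G X \<in> ?V" using top F(2) by simp
  moreover have "{} \<notin> ?V" using F(3) by simp
  moreover have "A \<inter> B \<in> ?V" if "A \<in> ?V" "B \<in> ?V" for A B
    using that F(4)[of "?p A" "?p B"] int[of A B] by auto
  moreover have "B \<in> ?V" if A: "A \<in> ?V" and B: "A \<subseteq> B" "B \<subseteq> comps G X" for A B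
  proof -
    have "?p A \<in> U" using A by simp
    then have "?p B \<in> U" by (rule F(5)) (use B in auto)
    then show ?thesis using B by simp
  qed
  moreover have "A \<in> ?V \<or> comps G X - A \<in> ?V" if "A \<subseteq> comps G X" for A
    using that ultrafilters_onD(2)[OF assms(2), of "?p A"] compl[of A] by auto
  ultimately have "?V \<in> ultrafilters_on (comps G X)"
    unfolding ultrafilters_on_def by (intro CollectI conjI ballI allI impI) auto
  then show ?thesis unfolding C_U_bond[OF assms] .
qed

lemma C_U_system: "C_system G (C_U G)"
proof (rule C_systemI)
  fix X
  show "Hausdorff_space (csp (C_U G) X)"
    by (simp add: C_U_def Hausdorff_space_ultrafilters)
  show "compactification (discrete_topology (comps G X)) (csp (C_U G) X) (cemb (C_U G) X)"
    unfolding C_U_def csys.simps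
    by (rule filter_topology_compactification[OF ultrafilters_subset_filters _ compact_space_ultrafilters])
      (auto intro: principal_ultrafilter)
next
  fix X X' :: "'v set" assume X: "X \<subseteq> X'"
  have "continuous_map (filter_topology (comps G X') (ultrafilters_on (comps G X')))
      (filter_topology (comps G X) (ultrafilters_on (comps G X))) (cbond (C_U G) X' X)"
  proof (rule continuous_map_filter_topologyI[OF ultrafilters_subset_filters ultrafilters_subset_filters])
    fix U assume U: "U \<in> ultrafilters_on (comps G X')"
    then show "cbond (C_U G) X' X U \<in> ultrafilters_on (comps G X)"
      using C_U_bond_ultrafilter[OF X] by blast
    fix A assume A: "A \<in> cbond (C_U G) X' X U"
    let ?B = "{C \<in> comps G X'. comp_map G X' X C \<in> A}"
    have "\<forall>V\<in>ultrafilters_on (comps G X'). ?B \<in> V \<longrightarrow> A \<in> cbond (C_U G) X' X V"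
      using A C_U_bond[OF X] C_U_bond[OF X U] by simp
    moreover have "?B \<in> U" using A C_U_bond[OF X U] by simp
    ultimately show "\<exists>B\<in>U. \<forall>V\<in>ultrafilters_on (comps G X'). B \<in> V \<longrightarrow> A \<in> cbond (C_U G) X' X V"
      by (rule bexI)
  qed
  then show "continuous_map (csp (C_U G) X') (csp (C_U G) X) (cbond (C_U G) X' X)"
    by (simp add: C_U_def)
  fix C assume C: "C \<in> comps G X'"
  then have "cbond (C_U G) X' X (principal_uf (comps G X') C) =
      principal_uf (comps G X) (comp_map G X' X C)"
    using C_U_bond[OF X principal_ultrafilter[OF C]] by (auto simp: principal_uf_def)
  then show "cbond (C_U G) X' X (cemb (C_U G) X' C) = cemb (C_U G) X (comp_map G X' X C)"
    by (simp add: C_U_def)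
qed

lemma C_le_C_U:
  assumes "C_system G A"
  shows "C_le G A (C_U G)"
proof (rule C_leI[OF assms C_U_system])
  fix X assume X: "X \<in> fin_subsets G"
  note K = C_system_space[OF assms X]
  have "\<exists>f. continuous_map (filter_topology (comps G X) (ultrafilters_on (comps G X))) (csp A X) f \<and>
      (\<forall>C \<in> comps G X. f (principal_uf (comps G X) C) = cemb A X C)"
    using K by (intro ultrafilter_extension) auto
  then show "\<exists>f. le_witness (comps G X) (csp A X) (cemb A X) (csp (C_U G) X) (cemb (C_U G) X) f"
    by (simp add: le_witness_def C_U_def)
qed

section \<open>The system of critical filters\<close>

lemma comps_nbhd_mono: "X \<subseteq> X' \<Longrightarrow> Y \<subseteq> X \<Longrightarrow> comps_nbhd G X' Y \<subseteq> comps_nbhd G X Y"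
  unfolding comps_nbhd_def using comp_in_smaller by blast

lemma crit_filter_iff:
  "A \<in> crit_filter G X Y \<longleftrightarrow> A \<subseteq> comps G X \<and> finite (comps_nbhd G X Y - A)"
proof
  assume "A \<in> crit_filter G X Y"
  then obtain D where D: "A \<subseteq> comps G X" "finite (comps_nbhd G X Y - D)" "D \<subseteq> A"
    by (auto simp: crit_filter_def)
  then have "finite (comps_nbhd G X Y - A)" by (meson Diff_mono finite_subset subset_refl)
  then show "A \<subseteq> comps G X \<and> finite (comps_nbhd G X Y - A)" using D by simp
next
  assume A: "A \<subseteq> comps G X \<and> finite (comps_nbhd G X Y - A)"
  have "comps_nbhd G X Y - comps_nbhd G X Y \<inter> A = comps_nbhd G X Y - A" by blast
  then show "A \<in> crit_filter G X Y"
    unfolding crit_filter_def using A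
    by (intro CollectI conjI exI[of _ "comps_nbhd G X Y \<inter> A"]) auto
qed

lemma crit_infinite: "Y \<in> crit G X \<Longrightarrow> infinite (comps_nbhd G X Y)"
  by (simp add: crit_def)

lemma comps_nbhd_disjoint: "Y \<noteq> Y' \<Longrightarrow> comps_nbhd G X Y \<inter> comps_nbhd G X Y' = {}"
  by (auto simp: comps_nbhd_def)

lemma comps_nbhd_subset: "comps_nbhd G X Y \<subseteq> comps G X"
  by (auto simp: comps_nbhd_def)

text \<open>A member of a critical filter misses only finitely many elements of an infinite class,
  so it cannot fit into another class, which is disjoint from the first.\<close>

lemma crit_filter_unique:
  assumes "Y \<in> crit G X" "A \<in> crit_filter G X Y" "A \<subseteq> comps_nbhd G X Y'"
  shows "Y = Y'"
proof (rule ccontr)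
  assume "Y \<noteq> Y'"
  then have "comps_nbhd G X Y - A = comps_nbhd G X Y" using comps_nbhd_disjoint assms(3) by blast
  then show False using assms crit_infinite by (simp add: crit_filter_iff)
qed

lemma crit_filter_self: "comps_nbhd G X Y \<in> crit_filter G X Y"
  by (simp add: crit_filter_iff comps_nbhd_subset)

lemma crit_filter_inj:
  assumes "Y \<in> crit G X" "crit_filter G X Y = crit_filter G X Y'"
  shows "Y = Y'"
  using crit_filter_unique[OF assms(1), of "comps_nbhd G X Y'" Y'] crit_filter_self assms(2) by simp

lemma crit_filter_not_singleton:
  assumes "Y \<in> crit G X" shows "{C} \<notin> crit_filter G X Y"
  using crit_infinite[OF assms] by (simp add: crit_filter_iff)

lemma crit_filter_not_principal:
  assumes "Y \<in> crit G X" "C \<in> comps G X"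
  shows "crit_filter G X Y \<noteq> principal_uf (comps G X) C"
proof
  assume eq: "crit_filter G X Y = principal_uf (comps G X) C"
  have "{C} \<in> principal_uf (comps G X) C" using assms by (simp add: principal_uf_def)
  then show False using crit_filter_not_singleton[OF assms(1)] unfolding eq[symmetric] by blast
qed

lemma crit_filter_filter:
  assumes "Y \<in> crit G X" shows "crit_filter G X Y \<in> filters_on (comps G X)"
proof -
  have "A \<inter> B \<in> crit_filter G X Y" if "A \<in> crit_filter G X Y" "B \<in> crit_filter G X Y" for A B
    using that unfolding crit_filter_iff by (auto simp: Diff_Int)
  moreover have "B \<in> crit_filter G X Y" if "A \<in> crit_filter G X Y" "A \<subseteq> B" "B \<subseteq> comps G X" for A B
    using that unfolding crit_filter_iff by (meson Diff_mono finite_subset subset_refl)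
  moreover have "comps G X \<in> crit_filter G X Y"
    unfolding crit_filter_iff using comps_nbhd_subset[of X Y] by (simp add: Diff_eq_empty_iff[THEN iffD2])
  moreover have "{} \<notin> crit_filter G X Y" using crit_infinite[OF assms] by (simp add: crit_filter_iff)
  moreover have "crit_filter G X Y \<subseteq> Pow (comps G X)" by (auto simp: crit_filter_iff)
  ultimately show ?thesis
    unfolding filters_on_def by (intro CollectI conjI ballI allI impI) auto
qed

section \<open>The space of principal and critical filters\<close>

lemma F_points_cases [consumes 1, case_names comp crit]:
  assumes "F \<in> F_points G X"
  obtains C where "C \<in> comps G X" "F = principal_uf (comps G X) C"
  | Y where "Y \<in> crit G X" "F = crit_filter G X Y"
  using assms unfolding F_points_def by blast

lemma F_points_filters: "F_points G X \<subseteq> filters_on (comps G X)"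
proof
  fix F assume "F \<in> F_points G X"
  then show "F \<in> filters_on (comps G X)"
    by (cases rule: F_points_cases) (simp_all add: principal_filter crit_filter_filter)
qed

lemma crit_filter_remove: "comps G X - {C} \<in> crit_filter G X Y"
proof -
  have "comps_nbhd G X Y - (comps G X - {C}) \<subseteq> {C}" using comps_nbhd_subset by blast
  then show ?thesis unfolding crit_filter_iff using finite_subset by blast
qed

lemma Hausdorff_space_F_points: "Hausdorff_space (filter_topology (comps G X) (F_points G X))"
proof (rule filter_topology_Hausdorff[OF F_points_filters])
  have sing: "{C} \<in> principal_uf (comps G X) C" if "C \<in> comps G X" for C
    using that by (simp add: principal_uf_def)
  fix F F' assume F: "F \<in> F_points G X" and F': "F' \<in> F_points G X" and ne: "F \<noteq> F'"
  from F show "\<exists>A\<in>F. \<exists>B\<in>F'. A \<inter> B = {}"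
  proof (cases rule: F_points_cases)
    case C: (comp C)
    from F' show ?thesis
    proof (cases rule: F_points_cases)
      case (comp D)
      then have "C \<noteq> D" using ne C by blast
      then show ?thesis
        using sing[OF C(1)] sing[OF comp(1)] unfolding C(2) comp(2)
        by (intro bexI[of _ "{C}"] bexI[of _ "{D}"]) auto
    next
      case (crit Y)
      then show ?thesis
        using sing[OF C(1)] crit_filter_remove[of X C Y] unfolding C(2) crit(2)
        by (intro bexI[of _ "{C}"] bexI[of _ "comps G X - {C}"]) auto
    qed
  next
    case Y: (crit Y)
    from F' show ?thesis
    proof (cases rule: F_points_cases)
      case (comp C)
      then show ?thesis
        using sing[OF comp(1)] crit_filter_remove[of X C Y] unfolding Y(2) comp(2)
        by (intro bexI[of _ "{C}"] bexI[of _ "comps G X - {C}"]) auto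
    next
      case (crit Y')
      then have "Y \<noteq> Y'" using ne Y by blast
      then show ?thesis
        using crit_filter_self[of X Y] crit_filter_self[of X Y'] comps_nbhd_disjoint unfolding Y(2) crit(2)
        by (intro bexI[of _ "comps_nbhd G X Y"] bexI[of _ "comps_nbhd G X Y'"]) auto
    qed
  qed
qed

text \<open>Around each of the finitely many critical filters the cover contains a basic set given
  by \<open>a Y\<close>, which takes all but finitely many components with neighbourhood Y.
  Neighbourhoods of components are subsets of the finite X, so the set R of components not taken is
  finite: it consists of the exceptions in critical classes and of elements of the other, finite
  classes.\<close>

lemma compact_space_F_points:
  assumes "finite X"
  shows "compact_space (filter_topology (comps G X) (F_points G X))" (is "compact_space ?T")
  unfolding compact_space_def compactin_def
proof (intro conjI allI impI)
  note top = topspace_filter_topology[OF F_points_filters, of X]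
  fix \<V> assume "Ball \<V> (openin ?T) \<and> topspace ?T \<subseteq> \<Union>\<V>"
  then have op: "\<And>V. V \<in> \<V> \<Longrightarrow> openin ?T V" and cov: "F_points G X \<subseteq> \<Union>\<V>" using top by auto
  have "\<forall>F \<in> F_points G X. \<exists>V. V \<in> \<V> \<and> F \<in> V" using cov by blast
  then obtain v where v: "\<And>F. F \<in> F_points G X \<Longrightarrow> v F \<in> \<V> \<and> F \<in> v F" by metis
  have "\<forall>Y \<in> crit G X. \<exists>A. A \<in> crit_filter G X Y \<and>
      {F \<in> F_points G X. A \<in> F} \<subseteq> v (crit_filter G X Y)"
  proof
    fix Y assume "Y \<in> crit G X"
    then have "crit_filter G X Y \<in> F_points G X" by (simp add: F_points_def)
    from filter_topology_basis[OF F_points_filters op[of "v (crit_filter G X Y)"]] v[OF this]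
    show "\<exists>A. A \<in> crit_filter G X Y \<and> {F \<in> F_points G X. A \<in> F} \<subseteq> v (crit_filter G X Y)"
      by blast
  qed
  then obtain a where a: "\<And>Y. Y \<in> crit G X \<Longrightarrow> a Y \<in> crit_filter G X Y"
    "\<And>Y. Y \<in> crit G X \<Longrightarrow> {F \<in> F_points G X. a Y \<in> F} \<subseteq> v (crit_filter G X Y)" by metis
  define R where "R = {C \<in> comps G X. \<forall>Y \<in> crit G X. C \<notin> a Y}"
  have fin_crit: "finite (crit G X)"
    using assms finite_subset[of "crit G X" "Pow X"] by (auto simp: crit_def)
  have "R \<subseteq> (\<Union>Y\<in>Pow X. if Y \<in> crit G X then comps_nbhd G X Y - a Y else comps_nbhd G X Y)"
  proof
    fix C assume C: "C \<in> R"
    then have "C \<in> comps G X" by (simp add: R_def)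
    then have "nbhd G C \<in> Pow X" "C \<in> comps_nbhd G X (nbhd G C)"
      using nbhd_comp_subset by (auto simp: comps_nbhd_def)
    then show "C \<in> (\<Union>Y\<in>Pow X. if Y \<in> crit G X then comps_nbhd G X Y - a Y else comps_nbhd G X Y)"
      using C by (intro UN_I[of "nbhd G C"]) (auto simp: R_def)
  qed
  moreover have "finite (\<Union>Y\<in>Pow X. if Y \<in> crit G X then comps_nbhd G X Y - a Y else comps_nbhd G X Y)"
    using assms a(1) by (auto simp: crit_filter_iff) (auto simp: crit_def)
  ultimately have fin_R: "finite R" using finite_subset by blast
  let ?\<F> = "v ` (crit_filter G X ` crit G X \<union> principal_uf (comps G X) ` R)"
  have sub: "crit_filter G X ` crit G X \<union> principal_uf (comps G X) ` R \<subseteq> F_points G X"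
    unfolding F_points_def R_def by blast
  have all: "F \<in> \<Union>?\<F>" if F: "F \<in> F_points G X" for F
    using F
  proof (cases rule: F_points_cases)
    case (crit Y)
    then show ?thesis using v[OF F] by blast
  next
    case (comp C)
    show ?thesis
    proof (cases "C \<in> R")
      case True
      then show ?thesis using v[OF F] comp by blast
    next
      case False
      then obtain Y where Y: "Y \<in> crit G X" "C \<in> a Y" using comp(1) by (auto simp: R_def)
      then have "a Y \<in> F" using a(1) comp(2) by (auto simp: principal_uf_def crit_filter_iff)
      then have "F \<in> v (crit_filter G X Y)" using a(2)[OF Y(1)] F by auto
      then show ?thesis using Y(1) by blast
    qed
  qed
  have "finite ?\<F>" using fin_crit fin_R by blast
  moreover have "?\<F> \<subseteq> \<V>" using v sub by blast
  moreover have "topspace ?T \<subseteq> \<Union>?\<F>" unfolding top using all by (rule subsetI)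
  ultimately show "\<exists>\<F>. finite \<F> \<and> \<F> \<subseteq> \<V> \<and> topspace ?T \<subseteq> \<Union>\<F>"
    by (intro exI[of _ ?\<F>] conjI)
qed auto

section \<open>Bonding maps between spaces of critical filters\<close>

lemma F_bond_principal:
  assumes "C \<in> comps G X'"
  shows "F_bond G X' X (principal_uf (comps G X') C) = principal_uf (comps G X) (comp_map G X' X C)"
proof -
  have "(THE C'. C' \<in> comps G X' \<and> principal_uf (comps G X') C = principal_uf (comps G X') C') = C"
    using assms inj_principal[of "comps G X'"] by (intro the_equality) (auto dest: inj_onD)
  then show ?thesis using assms unfolding F_bond_def by simp
qed

lemma F_bond_crit:
  assumes "Y \<in> crit G X'"
  shows "F_bond G X' X (crit_filter G X' Y) =
     (if Y \<subseteq> X then crit_filter G X Y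
      else principal_uf (comps G X) (THE C. C \<in> comps G X \<and> \<Union>(comps_nbhd G X' Y) \<subseteq> C))"
proof -
  have "(THE Y'. Y' \<in> crit G X' \<and> crit_filter G X' Y = crit_filter G X' Y') = Y"
    using assms crit_filter_inj[OF assms] by (intro the_equality) auto
  moreover have "crit_filter G X' Y \<notin> principal_uf (comps G X') ` comps G X'"
    using crit_filter_not_principal[OF assms] by blast
  ultimately show ?thesis unfolding F_bond_def by simp
qed

lemma F_bond_crit_outside:
  assumes "X \<subseteq> X'" "Y \<in> crit G X'" "y \<in> Y" "D \<in> comps G X" "y \<in> D"
  shows "F_bond G X' X (crit_filter G X' Y) = principal_uf (comps G X) D"
proof -
  have map: "comp_map G X' X C = D" if "C \<in> comps_nbhd G X' Y" for C
    using that assms by (intro comp_map_of_nbhd[of X X' C D y]) (auto simp: comps_nbhd_def)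
  have sub: "C \<subseteq> D" if "C \<in> comps_nbhd G X' Y" for C
    using that map comp_map_in(2)[OF assms(1)] by (auto simp: comps_nbhd_def)
  \<comment> \<open>A critical class is nonempty, which makes D the only component that contains its
    union.\<close>
  obtain C where C: "C \<in> comps_nbhd G X' Y"
    using crit_infinite[OF assms(2)] by (metis all_not_in_conv finite.emptyI)
  then obtain v where v: "v \<in> C" using comps_nonempty by (auto simp: comps_nbhd_def)
  have "(THE C. C \<in> comps G X \<and> \<Union>(comps_nbhd G X' Y) \<subseteq> C) = D"
  proof (rule the_equality)
    show "D \<in> comps G X \<and> \<Union>(comps_nbhd G X' Y) \<subseteq> D" using sub assms by blast
    fix E assume "E \<in> comps G X \<and> \<Union>(comps_nbhd G X' Y) \<subseteq> E"
    then show "E = D" using C v sub[OF C] assms(4) comps_eqI[of E X D v] by blast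
  qed
  moreover have "\<not> Y \<subseteq> X" using assms comps_subset by blast
  ultimately show ?thesis using F_bond_crit[OF assms(2)] by simp
qed

text \<open>Principal filters are isolated, so only the critical filter of some Y needs an argument.
  If Y \<subseteq> X, components with neighbourhood Y are unchanged in G - X. Otherwise a vertex y
  of Y outside X joins all of them to the component D of y, and the bond is constant near the
  filter.\<close>

lemma continuous_map_F_bond:
  assumes X': "X' \<in> fin_subsets G" and X: "X \<subseteq> X'"
  shows "continuous_map (filter_topology (comps G X') (F_points G X'))
    (filter_topology (comps G X) (F_points G X)) (F_bond G X' X)"
proof (rule continuous_map_filter_topologyI[OF F_points_filters F_points_filters])
  have fin: "finite X'" "X' \<subseteq> verts G" using X' by (auto simp: fin_subsets_def)
  fix F assume F: "F \<in> F_points G X'"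
  \<comment> \<open>If B consists of components with neighbourhood Y, a point containing B is the
    principal filter of an element of B or the critical filter of Y; nothing else is nearby.\<close>
  have same: "F' = crit_filter G X' Y"
    if "F' \<in> F_points G X'" "B \<in> F'" "B \<subseteq> comps_nbhd G X' Y"
      "\<And>C. C \<in> B \<Longrightarrow> F' \<noteq> principal_uf (comps G X') C" for F' B Y
    using that(1)
  proof (cases rule: F_points_cases)
    case (comp C)
    then show ?thesis using that(2,4) by (auto simp: principal_uf_def)
  next
    case (crit Y')
    then show ?thesis using crit_filter_unique that(2,3) by blast
  qed
  have "F_bond G X' X F \<in> F_points G X \<and>
    (\<forall>A \<in> F_bond G X' X F. \<exists>B\<in>F. \<forall>F'\<in>F_points G X'. B \<in> F' \<longrightarrow> A \<in> F_bond G X' X F')"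
    using F
  proof (cases rule: F_points_cases)
    case (comp C)
    have "{C} \<in> F" using comp by (simp add: principal_uf_def)
    moreover have "F' = F" if "F' \<in> F_points G X'" "{C} \<in> F'" for F'
      using filter_eq_principal[OF _ that(2)] F_points_filters that(1) comp by blast
    moreover have "F_bond G X' X F \<in> F_points G X"
      using F_bond_principal[OF comp(1)] comp comp_map_in(1)[OF X comp(1)]
      by (simp add: F_points_def)
    ultimately show ?thesis by metis
  next
    case (crit Y)
    show ?thesis
    proof (cases "Y \<subseteq> X")
      case True
      then have eq: "F_bond G X' X F = crit_filter G X Y" using F_bond_crit crit by simp
      have "infinite (comps_nbhd G X Y)"
        using crit_infinite[OF crit(1)] comps_nbhd_mono[OF X True] finite_subset by blast
      then have "Y \<in> crit G X" using True by (simp add: crit_def)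
      then have "F_bond G X' X F \<in> F_points G X" using eq by (simp add: F_points_def)
      moreover have "\<exists>B\<in>F. \<forall>F'\<in>F_points G X'. B \<in> F' \<longrightarrow> A \<in> F_bond G X' X F'"
        if A: "A \<in> F_bond G X' X F" for A
      proof -
        have A': "A \<subseteq> comps G X" "finite (comps_nbhd G X Y - A)"
          using A unfolding eq crit_filter_iff by auto
        \<comment> \<open>A consists of components of G - X. Its part in the class for X' consists
          of components of G - X' as well, and still misses only finitely many elements of that
          class.\<close>
        let ?B = "A \<inter> comps_nbhd G X' Y"
        have "comps_nbhd G X' Y - ?B \<subseteq> comps_nbhd G X Y - A"
          using comps_nbhd_mono[OF X True] by blast
        then have "?B \<in> F" unfolding crit(2) crit_filter_iff
          using A' comps_nbhd_subset finite_subset by blast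
        moreover have "A \<in> F_bond G X' X F'" if F': "F' \<in> F_points G X'" "?B \<in> F'" for F'
        proof (cases "\<exists>C \<in> ?B. F' = principal_uf (comps G X') C")
          case True
          then obtain C where C: "C \<in> ?B" "F' = principal_uf (comps G X') C" by blast
          then have C': "C \<in> comps G X'" "C \<in> comps G X" using A' comps_nbhd_subset by blast+
          obtain u where "u \<in> C" using comps_nonempty[OF C'(1)] by blast
          then have "comp_map G X' X C = C" using comp_map_eqI[OF X C'] by blast
          then show ?thesis using F_bond_principal[OF C'(1)] C A' by (simp add: principal_uf_def)
        next
          case False
          then have "F' = F" using same[OF F', of Y] crit(2) by blast
          then show ?thesis using A by simp
        qed
        ultimately show ?thesis by (intro bexI[of _ ?B]) auto
      qed
      ultimately show ?thesis by blast
    next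
      case False
      then obtain y where y: "y \<in> Y" "y \<notin> X" by blast
      then have "y \<in> verts G" using crit(1) fin by (auto simp: crit_def)
      then obtain D where D: "D \<in> comps G X" "y \<in> D" using ex_comp y by blast
      have eq: "F_bond G X' X F = principal_uf (comps G X) D"
        using F_bond_crit_outside[OF X crit(1) y(1) D] crit(2) by simp
      have "A \<in> F_bond G X' X F'"
        if A: "A \<in> F_bond G X' X F" and F': "F' \<in> F_points G X'" "comps_nbhd G X' Y \<in> F'" for A F'
      proof (cases "\<exists>C \<in> comps_nbhd G X' Y. F' = principal_uf (comps G X') C")
        case True
        then obtain C where C: "C \<in> comps_nbhd G X' Y" "F' = principal_uf (comps G X') C" by blast
        then have C': "C \<in> comps G X'" "nbhd G C = Y" by (auto simp: comps_nbhd_def)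
        have "comp_map G X' X C = D" using comp_map_of_nbhd[OF X C'(1) D(1) _ D(2)] C' y by simp
        then show ?thesis using A eq C F_bond_principal[OF C'(1)] by simp
      next
        case False
        then have "F' = F" using same[OF F', of Y] crit(2) by blast
        then show ?thesis using A by simp
      qed
      moreover have "comps_nbhd G X' Y \<in> F" using crit_filter_self crit(2) by simp
      moreover have "F_bond G X' X F \<in> F_points G X" using eq D by (simp add: F_points_def)
      ultimately show ?thesis by blast
    qed
  qed
  then show "F_bond G X' X F \<in> F_points G X"
    and "\<And>A. A \<in> F_bond G X' X F \<Longrightarrow>
      \<exists>B\<in>F. \<forall>F'\<in>F_points G X'. B \<in> F' \<longrightarrow> A \<in> F_bond G X' X F'" by blast+
qed

lemma C_F_system: "C_system G (C_F G)"
proof (rule C_systemI)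
  fix X assume X: "X \<in> fin_subsets G"
  show "Hausdorff_space (csp (C_F G) X)"
    by (simp add: C_F_def Hausdorff_space_F_points)
  have "compact_space (filter_topology (comps G X) (F_points G X))"
    using compact_space_F_points X by (simp add: fin_subsets_def)
  then show "compactification (discrete_topology (comps G X)) (csp (C_F G) X) (cemb (C_F G) X)"
    unfolding C_F_def csys.simps
    by (intro filter_topology_compactification[OF F_points_filters]) (auto simp: F_points_def)
next
  fix X X' assume "X' \<in> fin_subsets G" "X \<subseteq> X'"
  then show "continuous_map (csp (C_F G) X') (csp (C_F G) X) (cbond (C_F G) X' X)"
    using continuous_map_F_bond by (simp add: C_F_def)
next
  fix X X' C assume "C \<in> comps G X'"
  then show "cbond (C_F G) X' X (cemb (C_F G) X' C) = cemb (C_F G) X (comp_map G X' X C)"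
    using F_bond_principal by (simp add: C_F_def)
qed

text \<open>
  Distinct neighbourhoods are separated by deleting a vertex \<open>y\<close> of one of them from \<open>X\<close>: the
  components adjacent to \<open>y\<close> merge into a single isolated point, the others persist.
\<close>

lemma nbhd_class_closures_disjoint:
  assumes A: "C_system G A" and X: "X \<in> fin_subsets G" and y: "y \<in> Y" "y \<notin> Y'" "Y \<subseteq> X"
    and p: "p \<in> csp A X closure_of (cemb A X ` comps_nbhd G X Y)"
      "p \<in> csp A X closure_of (cemb A X ` comps_nbhd G X Y')"
  shows False
proof -
  let ?Z = "X - {y}"
  let ?b = "cbond A X ?Z"
  have Z: "?Z \<in> fin_subsets G" "?Z \<subseteq> X" using X fin_subsets_subset by blast+
  have yX: "y \<in> X" "y \<in> verts G" using y X by (auto simp: fin_subsets_def)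
  then obtain D where D: "D \<in> comps G ?Z" "y \<in> D" using ex_comp[of y ?Z] by blast
  note cont = C_system_bond(1)[OF A X Z(2)]
  have emb: "C \<in> comps G X \<Longrightarrow> ?b (cemb A X C) = cemb A ?Z (comp_map G X ?Z C)" for C
    using C_system_bond(2)[OF A X Z(2)] .
  have "?b p = cemb A ?Z D"
  proof (rule forall_in_closure_of_eq[OF p(1) C_system_space(1)[OF A Z(1)] cont])
    show "continuous_map (csp A X) (csp A ?Z) (\<lambda>_. cemb A ?Z D)"
      using C_system_space(4)[OF A Z(1) D(1)] by simp
    fix x assume "x \<in> cemb A X ` comps_nbhd G X Y"
    then obtain C where C: "x = cemb A X C" "C \<in> comps G X" "nbhd G C = Y"
      by (auto simp: comps_nbhd_def)
    then have "comp_map G X ?Z C = D" using comp_map_of_nbhd[OF Z(2) C(2) D(1) _ D(2)] y by simp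
    then show "?b x = cemb A ?Z D" using emb C by simp
  qed
  moreover have "openin (csp A X) {q \<in> topspace (csp A X). ?b q \<in> {cemb A ?Z D}}"
    using openin_continuous_map_preimage[OF cont C_system_space(7)[OF A Z(1) D(1)]] .
  moreover have "p \<in> topspace (csp A X)" using p by (simp add: in_closure_of)
  ultimately have "\<exists>x. x \<in> cemb A X ` comps_nbhd G X Y' \<and>
      x \<in> {q \<in> topspace (csp A X). ?b q \<in> {cemb A ?Z D}}"
    by (intro p(2)[unfolded in_closure_of, THEN conjunct2, rule_format]) simp
  then obtain C where C: "C \<in> comps_nbhd G X Y'" "?b (cemb A X C) = cemb A ?Z D" by auto
  then have C': "C \<in> comps G X" "nbhd G C = Y'" by (auto simp: comps_nbhd_def)
  \<comment> \<open>Since y is not in Y', the component C keeps its whole neighbourhood after y is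
    put back and remains a component. Injectivity then identifies it with D, although D contains y
    and C does not.\<close>
  then have "nbhd G C \<subseteq> ?Z" using nbhd_comp_subset[OF C'(1)] y by blast
  then have CZ: "C \<in> comps G ?Z" using comp_in_smaller[OF Z(2) C'(1)] by blast
  obtain u where "u \<in> C" using comps_nonempty[OF CZ] by blast
  then have "comp_map G X ?Z C = C" using comp_map_eqI[OF Z(2) C'(1) CZ] by blast
  then have "cemb A ?Z C = cemb A ?Z D" using emb[OF C'(1)] C(2) by simp
  then have "C = D" using C_system_space(6)[OF A Z(1)] CZ D(1) by (auto dest: inj_onD)
  then show False using D(2) yX(1) comps_subset[OF C'(1)] by blast
qed

lemma C_F_le:
  assumes A: "C_system G A"
  shows "C_le G (C_F G) A"
proof (rule C_leI[OF C_F_system A])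
  fix X assume X: "X \<in> fin_subsets G"
  note K = C_system_space[OF A X]
  let ?K = "csp A X" and ?e = "cemb A X"
  let ?cl = "\<lambda>Y. ?K closure_of (?e ` comps_nbhd G X Y)"
  have fin: "finite (Pow X)" using X by (simp add: fin_subsets_def)
  have disj: "Y = Y'" if "p \<in> ?cl Y" "p \<in> ?cl Y'" "Y \<subseteq> X" "Y' \<subseteq> X" for p Y Y'
  proof (rule ccontr)
    assume "Y \<noteq> Y'"
    then obtain y where "y \<in> Y \<and> y \<notin> Y' \<or> y \<in> Y' \<and> y \<notin> Y" by blast
    then consider "y \<in> Y" "y \<notin> Y'" | "y \<in> Y'" "y \<notin> Y" by blast
    then show False
    proof cases
      case 1
      show False by (rule nbhd_class_closures_disjoint[OF A X 1 that(3,1,2)])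
    next
      case 2
      show False by (rule nbhd_class_closures_disjoint[OF A X 2 that(4,2,1)])
    qed
  qed
  have un: "comps G X = (\<Union>Y\<in>Pow X. comps_nbhd G X Y)"
    unfolding comps_nbhd_def using nbhd_comp_subset by blast
  have "?e ` comps G X = \<Union>((\<lambda>Y. ?e ` comps_nbhd G X Y) ` Pow X)"
    by (subst un) (rule image_UN)
  \<comment> \<open>Closure commutes with finite unions, and X has finitely many subsets.\<close>
  then have cover: "topspace ?K = (\<Union>Y\<in>Pow X. ?cl Y)"
    unfolding K(5)[symmetric] using fin by (simp only:) (subst closure_of_Union; simp)
  have emb_cl: "?e C \<in> ?cl (nbhd G C)" if "C \<in> comps G X" for C
  proof -
    have "?e C \<in> topspace ?K \<inter> ?e ` comps_nbhd G X (nbhd G C)"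
      using that K(4) by (simp add: comps_nbhd_def)
    then show ?thesis by (rule subsetD[OF closure_of_subset_Int])
  qed
  \<comment> \<open>A finite class is closed in a Hausdorff space and hence equal to its closure, so
    points of the remainder occur only over infinite classes.\<close>
  have crit: "Y \<in> crit G X" if Y: "Y \<subseteq> X" and p: "p \<in> ?cl Y" "p \<notin> ?e ` comps G X" for p Y
  proof (rule ccontr)
    assume "Y \<notin> crit G X"
    then have "finite (?e ` comps_nbhd G X Y)" using Y by (simp add: crit_def)
    moreover have "?e ` comps_nbhd G X Y \<subseteq> topspace ?K" using K(4) comps_nbhd_subset by blast
    ultimately have "closedin ?K (?e ` comps_nbhd G X Y)"
      using K(1) by (metis compactin_imp_closedin finite_imp_compactin)
    then have "p \<in> ?e ` comps_nbhd G X Y" using p closure_of_closedin by metis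
    then show False using p comps_nbhd_subset by blast
  qed
  \<comment> \<open>On the remainder the class is unique by \<open>disj\<close>, so the description
    is well defined; the isolated points of components are dealt with separately and keep their
    principal filters.\<close>
  define f where "f p = (if p \<in> ?e ` comps G X then principal_uf (comps G X) (inv_into (comps G X) ?e p)
     else crit_filter G X (THE Y. Y \<subseteq> X \<and> p \<in> ?cl Y))" for p
  have f_comp: "f (?e C) = principal_uf (comps G X) C" if "C \<in> comps G X" for C
    using that K(6) by (simp add: f_def)
  have f_crit: "f p = crit_filter G X Y" if "p \<notin> ?e ` comps G X" "Y \<subseteq> X" "p \<in> ?cl Y" for p Y
  proof -
    have "(THE Y. Y \<subseteq> X \<and> p \<in> ?cl Y) = Y"
    proof (rule the_equality)
      show "Y \<subseteq> X \<and> p \<in> ?cl Y" using that by simp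
      fix Y' assume "Y' \<subseteq> X \<and> p \<in> ?cl Y'"
      then show "Y' = Y" using disj[OF _ that(3) _ that(2)] by simp
    qed
    then show ?thesis using that(1) by (simp add: f_def)
  qed
  have f_in: "f p \<in> F_points G X" if p: "p \<in> topspace ?K" for p
  proof (cases "p \<in> ?e ` comps G X")
    case True
    then show ?thesis using f_comp by (auto simp: F_points_def)
  next
    case False
    obtain Y where "Y \<subseteq> X" "p \<in> ?cl Y" using p cover by blast
    then show ?thesis using crit False f_crit by (simp add: F_points_def)
  qed
  have "continuous_map ?K (filter_topology (comps G X) (F_points G X)) f"
    unfolding continuous_map topspace_filter_topology[OF F_points_filters]
  proof (intro conjI allI impI)
    show "f ` topspace ?K \<subseteq> F_points G X" using f_in by blast
    fix U assume U: "openin (filter_topology (comps G X) (F_points G X)) U"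
    show "openin ?K {p \<in> topspace ?K. f p \<in> U}"
    proof (subst openin_subopen, intro ballI)
      fix p assume "p \<in> {p \<in> topspace ?K. f p \<in> U}"
      then have p: "p \<in> topspace ?K" "f p \<in> U" by auto
      show "\<exists>T. openin ?K T \<and> p \<in> T \<and> T \<subseteq> {p \<in> topspace ?K. f p \<in> U}"
      proof (cases "p \<in> ?e ` comps G X")
        case True
        then have "openin ?K {p}" using K(7) by blast
        then show ?thesis using p by blast
      next
        case False
        obtain Y where Y: "Y \<subseteq> X" "p \<in> ?cl Y" using p cover by blast
        then have fp: "f p = crit_filter G X Y" using False f_crit by blast
        obtain B where B: "B \<in> f p" "{F \<in> F_points G X. B \<in> F} \<subseteq> U"
          using filter_topology_basis[OF F_points_filters U p(2)] by blast
        have B': "B \<subseteq> comps G X" "finite (comps_nbhd G X Y - B)"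
          using B(1) unfolding fp crit_filter_iff by auto
        \<comment> \<open>Without the closures of the other classes, only points over Y remain;
          without the finitely many elements of the class of Y outside B, the components that remain
          lie in B. All removed sets are closed and miss p.\<close>
        let ?R = "\<Union>(?cl ` (Pow X - {Y})) \<union> ?e ` (comps_nbhd G X Y - B)"
        have "closedin ?K (?e ` (comps_nbhd G X Y - B))"
          using B'(2) K(1,4) comps_nbhd_subset
          by (intro compactin_imp_closedin finite_imp_compactin) auto
        then have "closedin ?K ?R"
          using fin by (intro closedin_Un closedin_Union) auto
        then have "openin ?K (topspace ?K - ?R)" by blast
        moreover have "p \<in> topspace ?K - ?R"
        proof -
          have "p \<notin> ?cl Y'" if "Y' \<in> Pow X - {Y}" for Y'
            using that disj[OF _ Y(2) _ Y(1), of Y'] by auto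
          moreover have "p \<notin> ?e ` (comps_nbhd G X Y - B)" using False comps_nbhd_subset by blast
          ultimately show ?thesis using p(1) by simp
        qed
        moreover have "f q \<in> U" if q: "q \<in> topspace ?K" "q \<notin> ?R" for q
        proof (cases "q \<in> ?e ` comps G X")
          case True
          then obtain C where C: "C \<in> comps G X" "q = ?e C" by blast
          have "nbhd G C = Y"
          proof (rule ccontr)
            assume "nbhd G C \<noteq> Y"
            then have "nbhd G C \<in> Pow X - {Y}" using nbhd_comp_subset[OF C(1)] by blast
            then have "q \<in> ?R" using emb_cl[OF C(1)] C(2) by simp blast
            then show False using q(2) by contradiction
          qed
          then have "C \<in> B" using q(2) C by (auto simp: comps_nbhd_def)
          then have "B \<in> f q" using C f_comp B'(1) by (simp add: principal_uf_def)
          then show ?thesis using B(2) f_in[OF q(1)] by blast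
        next
          case Fq: False
          obtain Y' where Y': "Y' \<in> Pow X" "q \<in> ?cl Y'" using q(1) cover by auto
          have "Y' = Y"
          proof (rule ccontr)
            assume "Y' \<noteq> Y"
            then have "q \<in> ?R" using Y' by simp blast
            then show False using q(2) by contradiction
          qed
          then have "q \<in> ?cl Y" using Y' by simp
          then have "f q = f p" using f_crit[OF Fq Y(1)] fp by simp
          then show ?thesis using p(2) by simp
        qed
        ultimately show ?thesis by (intro exI[of _ "topspace ?K - ?R"]) auto
      qed
    qed
  qed
  then have "le_witness (comps G X) (csp (C_F G) X) (cemb (C_F G) X) ?K ?e f"
    using f_comp by (simp add: le_witness_def C_F_def)
  then show "\<exists>f. le_witness (comps G X) (csp (C_F G) X) (cemb (C_F G) X) ?K ?e f" by blast
qed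

section \<open>The induced space\<close>

definition basic :: "('v, 'k) csys \<Rightarrow> 'v set \<Rightarrow> 'k set \<Rightarrow> (('v \<Rightarrow> real) + ('v set \<Rightarrow> 'k)) set" where
  "basic A X W = Inl ` touch (\<Union>{C \<in> comps G X. cemb A X C \<in> W}) \<union> Inr ` {s \<in> inv_limit G A. s X \<in> W}"

definition induced_basis :: "('v, 'k) csys \<Rightarrow> (('v \<Rightarrow> real) + ('v set \<Rightarrow> 'k)) set set" where
  "induced_basis A = {Inl ` U | U. openin (one_complex G) U} \<union>
     {basic A X W | X W. X \<in> fin_subsets G \<and> openin (csp A X) W}"

lemma induced_space_eq: "induced_space G A = topology_generated_by (induced_basis A)"
proof -
  have "complex_pts (induced_subgraph G (\<Union>{C \<in> comps G X. cemb A X C \<in> W})) \<union>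
      inner_between G X (\<Union>{C \<in> comps G X. cemb A X C \<in> W}) = touch (\<Union>{C \<in> comps G X. cemb A X C \<in> W})"
    for X W by (intro basic_nbhd_eq_touch) auto
  then have "{Inl ` (complex_pts (induced_subgraph G (\<Union>\<C>)) \<union> inner_between G X (\<Union>\<C>))
           \<union> Inr ` {s \<in> inv_limit G A. s X \<in> W} | X W \<C>.
           X \<in> fin_subsets G \<and> openin (csp A X) W \<and> \<C> = {C \<in> comps G X. cemb A X C \<in> W}} =
     {basic A X W | X W. X \<in> fin_subsets G \<and> openin (csp A X) W}"
    unfolding basic_def by simp
  then show ?thesis unfolding induced_space_def induced_basis_def by (simp only:)
qed

lemma induced_basis_cases [consumes 1, case_names complex basic]:
  assumes "B \<in> induced_basis A"
  obtains U where "openin (one_complex G) U" "B = Inl ` U"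
  | X W where "X \<in> fin_subsets G" "openin (csp A X) W" "B = basic A X W"
  using assms unfolding induced_basis_def by (elim UnE CollectE exE conjE) simp_all

lemma Inr_in_basic [simp]: "Inr s \<in> basic A X W \<longleftrightarrow> s \<in> inv_limit G A \<and> s X \<in> W"
  by (auto simp: basic_def)

lemma Inl_in_basic:
  "Inl p \<in> basic A X W \<longleftrightarrow>
    p \<in> complex_pts G \<and> (\<exists>C \<in> comps G X. cemb A X C \<in> W \<and> (\<exists>w \<in> C. p w \<noteq> 0))"
  by (auto simp: basic_def touch_def)

lemma vertex_in_basic:
  "Inl (vertex_pt v) \<in> basic A X W \<longleftrightarrow> (\<exists>C \<in> comps G X. cemb A X C \<in> W \<and> v \<in> C)"
proof -
  have "Inl (vertex_pt v) \<in> basic A X W \<longleftrightarrow> vertex_pt v \<in> touch (\<Union>{C \<in> comps G X. cemb A X C \<in> W})"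
    by (auto simp: basic_def)
  then show ?thesis using comps_subset unfolding touch_vertex_iff by blast
qed

lemma basic_mono: "W \<subseteq> W' \<Longrightarrow> basic A X W \<subseteq> basic A X W'"
  unfolding basic_def by (intro Un_mono image_mono touch_mono) auto

lemma openin_induced_Inl: "openin (one_complex G) U \<Longrightarrow> openin (induced_space G A) (Inl ` U)"
  unfolding induced_space_eq by (rule topology_generated_by_Basis) (auto simp: induced_basis_def)

lemma openin_induced_basic:
  "X \<in> fin_subsets G \<Longrightarrow> openin (csp A X) W \<Longrightarrow> openin (induced_space G A) (basic A X W)"
  unfolding induced_space_eq by (rule topology_generated_by_Basis) (auto simp: induced_basis_def)

lemma inv_limitD:
  assumes "s \<in> inv_limit G A"
  shows "X \<in> fin_subsets G \<Longrightarrow> s X \<in> topspace (csp A X)"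
    and "X' \<in> fin_subsets G \<Longrightarrow> X \<subseteq> X' \<Longrightarrow> cbond A X' X (s X') = s X"
    and "s \<in> extensional (fin_subsets G)"
proof -
  have *: "s \<in> (\<Pi>\<^sub>E X \<in> fin_subsets G. topspace (csp A X))"
    "\<forall>X \<in> fin_subsets G. \<forall>X' \<in> fin_subsets G. X \<subseteq> X' \<longrightarrow> cbond A X' X (s X') = s X"
    using assms by (auto simp: inv_limit_def)
  show "X \<in> fin_subsets G \<Longrightarrow> s X \<in> topspace (csp A X)" using *(1) by (rule PiE_mem)
  show "X' \<in> fin_subsets G \<Longrightarrow> X \<subseteq> X' \<Longrightarrow> cbond A X' X (s X') = s X"
    using *(2) fin_subsets_subset by blast
  show "s \<in> extensional (fin_subsets G)" using *(1) by (simp add: PiE_def)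
qed

lemma topspace_induced:
  "topspace (induced_space G A) = Inl ` complex_pts G \<union> Inr ` inv_limit G A"
proof (intro equalityI subsetI)
  fix z assume "z \<in> topspace (induced_space G A)"
  then obtain B where B: "B \<in> induced_basis A" "z \<in> B"
    unfolding induced_space_eq topology_generated_by_topspace by (elim UnionE)
  from B(1) show "z \<in> Inl ` complex_pts G \<union> Inr ` inv_limit G A"
  proof (cases rule: induced_basis_cases)
    case (complex U)
    then have "U \<subseteq> complex_pts G" using openin_subset topspace_one_complex by metis
    then show ?thesis using B(2) complex by blast
  next
    case (basic X W)
    then show ?thesis using B(2) by (cases z) (auto simp: Inl_in_basic)
  qed
next
  fix z assume "z \<in> Inl ` complex_pts G \<union> Inr ` inv_limit G A"
  then consider "z \<in> Inl ` complex_pts G" | s where "z = Inr s" "s \<in> inv_limit G A" by blast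
  then show "z \<in> topspace (induced_space G A)"
  proof cases
    case 1
    have "openin (one_complex G) (complex_pts G)" using openin_topspace topspace_one_complex by metis
    then show ?thesis using openin_subset[OF openin_induced_Inl] 1 by blast
  next
    case (2 s)
    then have "z \<in> basic A {} (topspace (csp A {}))" using inv_limitD(1) empty_fin_subset by simp
    then show ?thesis
      using openin_subset[OF openin_induced_basic[OF empty_fin_subset openin_topspace]] by blast
  qed
qed

text \<open>Finite sets are directed, and neighbourhoods over different sets are compared by pulling
  both back to a common larger one. The second claim is only an inclusion because vertices of X' - X
  belong to no component of G - X'.\<close>

lemma basic_pullback:
  assumes A: "C_system G A" and X: "X' \<in> fin_subsets G" "X \<subseteq> X'" and W: "openin (csp A X) W"
  shows "openin (csp A X') {q \<in> topspace (csp A X'). cbond A X' X q \<in> W}"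
    and "basic A X' {q \<in> topspace (csp A X'). cbond A X' X q \<in> W} \<subseteq> basic A X W"
proof -
  show "openin (csp A X') {q \<in> topspace (csp A X'). cbond A X' X q \<in> W}"
    using openin_continuous_map_preimage[OF C_system_bond(1)[OF A X] W] .
  show "basic A X' {q \<in> topspace (csp A X'). cbond A X' X q \<in> W} \<subseteq> basic A X W"
  proof
    fix z assume z: "z \<in> basic A X' {q \<in> topspace (csp A X'). cbond A X' X q \<in> W}"
    show "z \<in> basic A X W"
    proof (cases z)
      case (Inl p)
      then obtain C w where C: "p \<in> complex_pts G" "C \<in> comps G X'" "cbond A X' X (cemb A X' C) \<in> W"
        "w \<in> C" "p w \<noteq> 0" using z by (auto simp: Inl_in_basic)
      then have "cemb A X (comp_map G X' X C) \<in> W" using C_system_bond(2)[OF A X C(2)] by simp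
      moreover note comp_map_in[OF X(2) C(2)]
      ultimately show ?thesis using C unfolding Inl Inl_in_basic by blast
    next
      case (Inr s)
      then show ?thesis using z inv_limitD(2)[of s A X' X] X by simp
    qed
  qed
qed

text \<open>Open subsets of the 1-complex contain no limit point, and two basic sets around s are
  refined by one over the union of their finite sets. Hence at limit points the basic sets form a
  local base.\<close>

lemma induced_nbhd_limit:
  assumes A: "C_system G A" and W: "openin (induced_space G A) W" "Inr s \<in> W"
  shows "\<exists>X O'. X \<in> fin_subsets G \<and> openin (csp A X) O' \<and> s X \<in> O' \<and> basic A X O' \<subseteq> W"
proof -
  have "generate_topology_on (induced_basis A) W"
    using W(1) unfolding induced_space_eq by (rule openin_topology_generated_by)
  moreover have "s \<in> inv_limit G A"
    using openin_subset[OF W(1)] W(2) unfolding topspace_induced by blast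
  ultimately show ?thesis using W(2)
  proof (induction rule: generate_topology_on.induct)
    case (Int a b)
    then obtain X O' Y P where XO: "X \<in> fin_subsets G" "openin (csp A X) O'" "s X \<in> O'" "basic A X O' \<subseteq> a"
      and YP: "Y \<in> fin_subsets G" "openin (csp A Y) P" "s Y \<in> P" "basic A Y P \<subseteq> b" by blast
    let ?Z = "X \<union> Y"
    have Z: "?Z \<in> fin_subsets G" "X \<subseteq> ?Z" "Y \<subseteq> ?Z" using XO YP fin_subsets_Un by auto
    let ?O = "{q \<in> topspace (csp A ?Z). cbond A ?Z X q \<in> O'}"
    let ?P = "{q \<in> topspace (csp A ?Z). cbond A ?Z Y q \<in> P}"
    note O = basic_pullback[OF A Z(1,2) XO(2)] and P = basic_pullback[OF A Z(1,3) YP(2)]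
    have "openin (csp A ?Z) (?O \<inter> ?P)" using O(1) P(1) by (rule openin_Int)
    moreover have "s ?Z \<in> ?O \<inter> ?P"
      using inv_limitD[OF Int.prems(1)] Z XO(3) YP(3) by simp
    moreover have "basic A ?Z (?O \<inter> ?P) \<subseteq> a"
      using subset_trans[OF basic_mono[OF Int_lower1] subset_trans[OF O(2) XO(4)]] .
    moreover have "basic A ?Z (?O \<inter> ?P) \<subseteq> b"
      using subset_trans[OF basic_mono[OF Int_lower2] subset_trans[OF P(2) YP(4)]] .
    ultimately show ?case using Z(1) by (intro exI[of _ ?Z] exI[of _ "?O \<inter> ?P"] conjI Int_greatest)
  next
    case (UN K)
    then obtain k where k: "k \<in> K" "Inr s \<in> k" by blast
    then obtain X O' where "X \<in> fin_subsets G" "openin (csp A X) O'" "s X \<in> O'" "basic A X O' \<subseteq> k"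
      using UN by blast
    then show ?case using k(1) by blast
  next
    case (Basis B)
    from Basis(1) show ?case
    proof (cases rule: induced_basis_cases)
      case (basic X O')
      then show ?thesis using Basis.prems by (intro exI[of _ X] exI[of _ O']) simp
    qed (use Basis.prems in auto)
  qed simp
qed

text \<open>A basic set around s may be taken over a finite set that includes Y. Components are
  dense in the compactification there, so some component belongs to the neighbourhood, and its
  vertices avoid Y. Taking Y empty gives density; a singleton Y produces a vertex other than a
  prescribed one.\<close>

lemma induced_nbhd_vertex:
  assumes A: "C_system G A" and W: "openin (induced_space G A) W" "Inr s \<in> W"
    and Y: "Y \<in> fin_subsets G"
  shows "\<exists>v \<in> verts G - Y. Inl (vertex_pt v) \<in> W"
proof -
  obtain X O' where X: "X \<in> fin_subsets G" "openin (csp A X) O'" "s X \<in> O'" "basic A X O' \<subseteq> W"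
    using induced_nbhd_limit[OF A W] by blast
  have s: "s \<in> inv_limit G A" using openin_subset[OF W(1)] W(2) unfolding topspace_induced by blast
  let ?Z = "X \<union> Y"
  have Z: "?Z \<in> fin_subsets G" "X \<subseteq> ?Z" using X Y fin_subsets_Un by auto
  let ?O = "{q \<in> topspace (csp A ?Z). cbond A ?Z X q \<in> O'}"
  note O = basic_pullback[OF A Z X(2)]
  have "s ?Z \<in> ?O" using inv_limitD[OF s] Z X(3) by simp
  moreover have "s ?Z \<in> csp A ?Z closure_of (cemb A ?Z ` comps G ?Z)"
    using C_system_space(5)[OF A Z(1)] inv_limitD(1)[OF s Z(1)] by simp
  ultimately obtain C where C: "C \<in> comps G ?Z" "cemb A ?Z C \<in> ?O"
    using O(1) unfolding in_closure_of by (metis (no_types, lifting) imageE)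
  obtain v where v: "v \<in> C" using comps_nonempty[OF C(1)] by blast
  then have "Inl (vertex_pt v) \<in> basic A ?Z ?O" using C unfolding vertex_in_basic by blast
  then have "Inl (vertex_pt v) \<in> W" using O(2) X(4) by blast
  moreover have "v \<in> verts G - Y" using comps_subset[OF C(1)] v by blast
  ultimately show ?thesis by blast
qed

lemma continuous_map_Inl: "continuous_map (one_complex G) (induced_space G A) Inl"
  unfolding induced_space_eq continuous_on_generated_topo_iff
proof (intro conjI allI impI)
  fix B assume "B \<in> induced_basis A"
  then show "openin (one_complex G) (Inl -` B \<inter> topspace (one_complex G))"
  proof (cases rule: induced_basis_cases)
    case (complex U)
    have "Inl -` B = U" unfolding complex(2) by auto
    then show ?thesis using complex(1) by (auto intro: openin_Int)
  next
    case (basic X W)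
    have "Inl -` B = touch (\<Union>{C \<in> comps G X. cemb A X C \<in> W})"
      unfolding basic basic_def by auto
    then show ?thesis using openin_touch by (auto intro: openin_Int)
  qed
next
  show "Inl ` topspace (one_complex G) \<subseteq> \<Union> (induced_basis A)"
    using topspace_induced[of A] unfolding induced_space_eq topology_generated_by_topspace topspace_one_complex
    by blast
qed

section \<open>Compactness\<close>

text \<open>Threads through the closed sets K X form the intersection of closed subsets of a product
  that is compact by Tychonoff's theorem. Finitely many compatibility conditions involve only
  subsets of one finite set, over which a single point and its images satisfy them all.\<close>

lemma inv_limit_nonempty:
  assumes A: "C_system G A"
    and closed: "\<And>X. X \<in> fin_subsets G \<Longrightarrow> closedin (csp A X) (K X)"
    and ne: "\<And>X. X \<in> fin_subsets G \<Longrightarrow> K X \<noteq> {}"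
    and bond: "\<And>X X' q. X' \<in> fin_subsets G \<Longrightarrow> X \<subseteq> X' \<Longrightarrow> q \<in> K X' \<Longrightarrow> cbond A X' X q \<in> K X"
  shows "\<exists>s \<in> inv_limit G A. \<forall>X \<in> fin_subsets G. s X \<in> K X"
proof -
  let ?P = "product_topology (\<lambda>X. subtopology (csp A X) (K X)) (fin_subsets G)"
  have sub: "K X \<subseteq> topspace (csp A X)" if "X \<in> fin_subsets G" for X
    using closedin_subset[OF closed[OF that]] .
  have top: "topspace ?P = (\<Pi>\<^sub>E X \<in> fin_subsets G. K X)"
    using sub by (auto simp: PiE_iff)
  have compact: "compact_space ?P"
    using closed C_system_space(3)[OF A]
    by (simp add: compact_space_product_topology closedin_compact_space compact_space_subtopology)
  have proj: "continuous_map ?P (csp A X) (\<lambda>s. s X)" if "X \<in> fin_subsets G" for X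
    using continuous_map_product_projection[OF that, of "\<lambda>X. subtopology (csp A X) (K X)"]
      continuous_map_into_fulltopology by blast
  \<comment> \<open>S X' demands compatibility only from X' downwards. Each condition is closed
    because its target is Hausdorff.\<close>
  define S where "S X' = (\<Inter>X \<in> Pow X'. {s \<in> topspace ?P. cbond A X' X (s X') = s X})" for X'
  have S_iff: "s \<in> S X' \<longleftrightarrow> s \<in> topspace ?P \<and> (\<forall>X. X \<subseteq> X' \<longrightarrow> cbond A X' X (s X') = s X)" for s X'
    unfolding S_def by auto
  have "\<Inter>(S ` fin_subsets G) \<noteq> {}"
  proof (rule compact_space_fip[THEN iffD1, OF compact, rule_format], intro conjI ballI allI impI)
    fix T assume "T \<in> S ` fin_subsets G"
    then obtain X' where X': "X' \<in> fin_subsets G" "T = S X'" by blast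
    show "closedin ?P T" unfolding X'(2) S_def
    proof (rule closedin_INT)
      fix X assume "X \<in> Pow X'"
      then have X: "X \<subseteq> X'" "X \<in> fin_subsets G" using fin_subsets_subset[OF X'(1)] by auto
      have "continuous_map ?P (csp A X) (\<lambda>s. cbond A X' X (s X'))"
        using continuous_map_compose[OF proj[OF X'(1)] C_system_bond(1)[OF A X'(1) X(1)]]
        by (simp add: o_def)
      then show "closedin ?P {s \<in> topspace ?P. cbond A X' X (s X') = s X}"
        using closedin_continuous_maps_eq[OF C_system_space(1)[OF A X(2)] _ proj[OF X(2)]] by blast
    qed blast
  next
    fix \<F> assume "finite \<F> \<and> \<F> \<subseteq> S ` fin_subsets G"
    then obtain \<X> where \<X>: "finite \<X>" "\<X> \<subseteq> fin_subsets G" "\<F> = S ` \<X>"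
      by (meson finite_subset_image)
    have Z: "\<Union>\<X> \<in> fin_subsets G" using \<X>(1,2) by (auto simp: fin_subsets_def)
    obtain q where q: "q \<in> K (\<Union>\<X>)" using ne[OF Z] by blast
    have "\<forall>X \<in> fin_subsets G. \<exists>p. p \<in> K X" using ne by blast
    then obtain d where d: "\<And>X. X \<in> fin_subsets G \<Longrightarrow> d X \<in> K X" by metis
    \<comment> \<open>Below the union the coordinates are the images of q; elsewhere any element
      \<open>d X\<close> of K X will do, as no selected condition refers to it.\<close>
    define s where "s = (\<lambda>X \<in> fin_subsets G. if X \<subseteq> \<Union>\<X> then cbond A (\<Union>\<X>) X q else d X)"
    have "s \<in> topspace ?P" unfolding top s_def using bond[OF Z _ q] d by auto
    moreover have "cbond A X' X (s X') = s X" if X': "X' \<in> \<X>" and X: "X \<subseteq> X'" for X X'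
    proof -
      have "X' \<subseteq> \<Union>\<X>" "X \<subseteq> \<Union>\<X>" using X X' by blast+
      moreover from this have "X' \<in> fin_subsets G" "X \<in> fin_subsets G"
        using fin_subsets_subset[OF Z] by blast+
      ultimately show ?thesis
        using C_system_bond(5)[OF A Z _ X] q sub[OF Z] unfolding s_def by (simp add: subset_iff)
    qed
    ultimately have "s \<in> S X'" if "X' \<in> \<X>" for X' using that unfolding S_iff by blast
    then show "\<Inter>\<F> \<noteq> {}" unfolding \<X>(3) by blast
  qed
  then obtain s where "s \<in> \<Inter>(S ` fin_subsets G)" by blast
  then have s: "s \<in> S X" if "X \<in> fin_subsets G" for X using that by blast
  then have "s \<in> topspace ?P" using empty_fin_subset S_iff by blast
  then have sK: "s \<in> (\<Pi>\<^sub>E X \<in> fin_subsets G. K X)" unfolding top .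
  then have "s \<in> (\<Pi>\<^sub>E X \<in> fin_subsets G. topspace (csp A X))" using sub PiE_mono by blast
  then have "s \<in> inv_limit G A" using s unfolding S_iff inv_limit_def by simp
  then show ?thesis using sK PiE_mem by metis
qed

lemma compact_space_induced:
  assumes A: "C_system G A"
  shows "compact_space (induced_space G A)" (is "compact_space ?T")
  unfolding compact_space_alt
proof (intro allI impI)
  fix \<U> assume "(\<forall>U\<in>\<U>. openin ?T U) \<and> topspace ?T \<subseteq> \<Union>\<U>"
  then have op: "\<And>U. U \<in> \<U> \<Longrightarrow> openin ?T U" and cov: "topspace ?T \<subseteq> \<Union>\<U>" by auto
  \<comment> \<open>Traces on the compactification over X' of those basic sets, over subsets of X',
    that lie inside one member of the cover.\<close>
  define \<B> where "\<B> X' = {{q \<in> topspace (csp A X'). cbond A X' X q \<in> W} | X W.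
     X \<subseteq> X' \<and> openin (csp A X) W \<and> (\<exists>U \<in> \<U>. basic A X W \<subseteq> U)}" for X'
  have \<B>_open: "openin (csp A X') B" if X': "X' \<in> fin_subsets G" and B: "B \<in> \<B> X'" for X' B
  proof -
    obtain X W where "B = {q \<in> topspace (csp A X'). cbond A X' X q \<in> W}" "X \<subseteq> X'" "openin (csp A X) W"
      using B unfolding \<B>_def by (elim CollectE exE conjE)
    then show ?thesis using basic_pullback(1)[OF A X'] by simp
  qed
  have "\<exists>X' \<in> fin_subsets G. topspace (csp A X') \<subseteq> \<Union>(\<B> X')"
  proof (rule ccontr)
    assume neg: "\<not> ?thesis"
    \<comment> \<open>The uncovered parts are closed, nonempty and respected by the bonds, so a
      thread runs through all of them. The cover member containing this limit point includes a basic
      set, whose trace contradicts this.\<close>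
    have "\<exists>s \<in> inv_limit G A. \<forall>X \<in> fin_subsets G. s X \<in> topspace (csp A X) - \<Union>(\<B> X)"
    proof (rule inv_limit_nonempty[OF A])
      fix X' assume X': "X' \<in> fin_subsets G"
      have "openin (csp A X') (\<Union>(\<B> X'))" using \<B>_open[OF X'] by (rule openin_Union)
      then show "closedin (csp A X') (topspace (csp A X') - \<Union>(\<B> X'))"
        by (rule closedin_diff[OF closedin_topspace])
      show "topspace (csp A X') - \<Union>(\<B> X') \<noteq> {}" using neg X' by blast
    next
      fix X X' q assume X': "X' \<in> fin_subsets G" and X: "X \<subseteq> X'"
        and q: "q \<in> topspace (csp A X') - \<Union>(\<B> X')"
      have "cbond A X' X q \<notin> \<Union>(\<B> X)"
      proof
        assume "cbond A X' X q \<in> \<Union>(\<B> X)"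
        then obtain B where B: "B \<in> \<B> X" "cbond A X' X q \<in> B" by (elim UnionE)
        then obtain Y W where Y: "B = {q \<in> topspace (csp A X). cbond A X Y q \<in> W}" "Y \<subseteq> X"
          "openin (csp A Y) W" "\<exists>U \<in> \<U>. basic A Y W \<subseteq> U"
          unfolding \<B>_def by (elim CollectE exE conjE)
        have "cbond A X' Y q \<in> W"
          using B(2) C_system_bond(5)[OF A X' X Y(2)] q unfolding Y(1) by simp
        then have "q \<in> {q \<in> topspace (csp A X'). cbond A X' Y q \<in> W}" using q by simp
        moreover have "{q \<in> topspace (csp A X'). cbond A X' Y q \<in> W} \<in> \<B> X'"
          unfolding \<B>_def using Y X by (intro CollectI exI[of _ Y] exI[of _ W]) simp
        ultimately show False using q by blast
      qed
      then show "cbond A X' X q \<in> topspace (csp A X) - \<Union>(\<B> X)"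
        using C_system_bond(3)[OF A X' X] q by simp
    qed
    then obtain s where s: "s \<in> inv_limit G A" "\<And>X. X \<in> fin_subsets G \<Longrightarrow> s X \<notin> \<Union>(\<B> X)" by blast
    have "Inr s \<in> topspace ?T" using s(1) unfolding topspace_induced by simp
    then have "Inr s \<in> \<Union>\<U>" using cov by (rule subsetD[rotated])
    then obtain U where U: "U \<in> \<U>" "Inr s \<in> U" by (elim UnionE)
    obtain X W where X: "X \<in> fin_subsets G" "openin (csp A X) W" "s X \<in> W" "basic A X W \<subseteq> U"
      using induced_nbhd_limit[OF A op[OF U(1)] U(2)] by blast
    have "{q \<in> topspace (csp A X). cbond A X X q \<in> W} \<in> \<B> X"
      unfolding \<B>_def using X U by (intro CollectI exI[of _ X] exI[of _ W]) blast
    moreover have "s X \<in> {q \<in> topspace (csp A X). cbond A X X q \<in> W}"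
      using X(3) inv_limitD(1)[OF s(1) X(1)] C_system_bond(4)[OF A X(1) subset_refl] by simp
    ultimately show False using s(2)[OF X(1)] by blast
  qed
  then obtain X' where X': "X' \<in> fin_subsets G" "topspace (csp A X') \<subseteq> \<Union>(\<B> X')" by blast
  have "\<exists>\<T>. finite \<T> \<and> \<T> \<subseteq> \<B> X' \<and> topspace (csp A X') \<subseteq> \<Union>\<T>"
    using \<B>_open[OF X'(1)] X'(2)
    by (intro C_system_space(3)[OF A X'(1), unfolded compact_space_alt, rule_format]) simp
  then obtain \<T> where \<T>: "finite \<T>" "\<T> \<subseteq> \<B> X'" "topspace (csp A X') \<subseteq> \<Union>\<T>" by (elim exE conjE)
  have "\<forall>T \<in> \<T>. \<exists>U. U \<in> \<U> \<and> (\<exists>X W. X \<subseteq> X' \<and> basic A X W \<subseteq> U \<and> T = {q \<in> topspace (csp A X'). cbond A X' X q \<in> W})"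
  proof
    fix T assume "T \<in> \<T>"
    then have "T \<in> \<B> X'" using \<T>(2) by blast
    then obtain X W where "T = {q \<in> topspace (csp A X'). cbond A X' X q \<in> W}" "X \<subseteq> X'"
      "\<exists>U \<in> \<U>. basic A X W \<subseteq> U" unfolding \<B>_def by (elim CollectE exE conjE)
    then show "\<exists>U. U \<in> \<U> \<and> (\<exists>X W. X \<subseteq> X' \<and> basic A X W \<subseteq> U \<and> T = {q \<in> topspace (csp A X'). cbond A X' X q \<in> W})"
      by blast
  qed
  from bchoice[OF this] obtain u where *: "\<forall>T \<in> \<T>. u T \<in> \<U> \<and>
      (\<exists>X W. X \<subseteq> X' \<and> basic A X W \<subseteq> u T \<and> T = {q \<in> topspace (csp A X'). cbond A X' X q \<in> W})" ..
  have u: "u T \<in> \<U>"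
    "\<exists>X W. X \<subseteq> X' \<and> basic A X W \<subseteq> u T \<and> T = {q \<in> topspace (csp A X'). cbond A X' X q \<in> W}"
    if "T \<in> \<T>" for T
    using bspec[OF * that] by (rule conjunct1, rule conjunct2)
  let ?R = "complex_pts G - touch (verts G - X')"
  have "compactin ?T (Inl ` ?R)"
    using image_compactin[OF compactin_finite_subcomplex[OF X'(1)] continuous_map_Inl] .
  moreover have "Inl ` ?R \<subseteq> \<Union>\<U>" using cov unfolding topspace_induced by blast
  ultimately have "\<exists>\<F>. finite \<F> \<and> \<F> \<subseteq> \<U> \<and> Inl ` ?R \<subseteq> \<Union>\<F>"
    using op unfolding compactin_def by (elim conjE allE[of _ \<U>] impE) simp_all
  then obtain \<F> where \<F>: "finite \<F>" "\<F> \<subseteq> \<U>" "Inl ` ?R \<subseteq> \<Union>\<F>" by (elim exE conjE)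
  have "z \<in> \<Union>(\<F> \<union> u ` \<T>)" if z: "z \<in> topspace ?T" for z
  proof (cases z)
    case (Inl p)
    then have p: "p \<in> complex_pts G" using z unfolding topspace_induced by blast
    show ?thesis
    proof (cases "p \<in> ?R")
      case True
      then show ?thesis using \<F>(3) Inl by blast
    next
      case False
      \<comment> \<open>A point outside the finite subcomplex has a vertex w outside X' in its
        support; the component of w lies in a selected trace T, and the corresponding basic set
        contains the point.\<close>
      then obtain w where w: "w \<in> verts G" "w \<notin> X'" "p w \<noteq> 0" using p by (auto simp: touch_def)
      then obtain C where C: "C \<in> comps G X'" "w \<in> C" using ex_comp by blast
      then have "cemb A X' C \<in> \<Union>\<T>" using \<T>(3) C_system_space(4)[OF A X'(1)] by blast
      then obtain T where T: "T \<in> \<T>" "cemb A X' C \<in> T" by blast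
      then obtain X W where X: "X \<subseteq> X'" "basic A X W \<subseteq> u T"
        "T = {q \<in> topspace (csp A X'). cbond A X' X q \<in> W}" using u(2) by blast
      have "cemb A X (comp_map G X' X C) \<in> W"
        using T(2) C_system_bond(2)[OF A X'(1) X(1) C(1)] unfolding X(3) by simp
      then have "Inl p \<in> basic A X W"
        unfolding Inl_in_basic using p w C(2) comp_map_in[OF X(1) C(1)] by blast
      then show ?thesis using X(2) T(1) Inl by blast
    qed
  next
    case (Inr s)
    then have s: "s \<in> inv_limit G A" using z unfolding topspace_induced by blast
    then have "s X' \<in> \<Union>\<T>" using \<T>(3) inv_limitD(1) X'(1) by blast
    then obtain T where T: "T \<in> \<T>" "s X' \<in> T" by blast
    then obtain X W where X: "X \<subseteq> X'" "basic A X W \<subseteq> u T"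
      "T = {q \<in> topspace (csp A X'). cbond A X' X q \<in> W}" using u(2) by blast
    then have "s X \<in> W" using T(2) inv_limitD(2)[OF s X'(1) X(1)] by simp
    then have "Inr s \<in> basic A X W" using s by simp
    then show ?thesis using X(2) T(1) Inr by blast
  qed
  then have "topspace ?T \<subseteq> \<Union>(\<F> \<union> u ` \<T>)" by (rule subsetI)
  moreover have "finite (\<F> \<union> u ` \<T>)" using \<F>(1) \<T>(1) by simp
  moreover have "\<F> \<union> u ` \<T> \<subseteq> \<U>" using \<F>(2) u(1) by auto
  ultimately show "\<exists>\<F>. finite \<F> \<and> \<F> \<subseteq> \<U> \<and> topspace ?T \<subseteq> \<Union>\<F>"
    by (intro exI[of _ "\<F> \<union> u ` \<T>"] conjI)
qed

section \<open>Separation\<close>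

lemma non_inner_cases [consumes 2, case_names vertex limit]:
  assumes "z \<in> topspace (induced_space G A)" "z \<notin> Inl ` inner_edge_pts G"
  obtains v where "v \<in> verts G" "z = Inl (vertex_pt v)"
  | s where "s \<in> inv_limit G A" "z = Inr s"
  using assms unfolding topspace_induced complex_pts_def by auto

text \<open>The open star of v contains no other vertex, and v lies in no component of G - {v}. So
  the two neighbourhoods can share only inner points of edges at v.\<close>

lemma vertex_limit_separated:
  assumes v: "v \<in> verts G" and s: "s \<in> inv_limit G A"
  shows "\<exists>U V. openin (induced_space G A) U \<and> openin (induced_space G A) V \<and>
      Inl (vertex_pt v) \<in> U \<and> Inr s \<in> V \<and> U \<inter> V \<subseteq> Inl ` inner_edge_pts G"
proof -
  let ?U = "Inl ` touch {v}" and ?V = "basic A {v} (topspace (csp A {v}))"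
  have X: "{v} \<in> fin_subsets G" using v by (simp add: fin_subsets_def)
  have "z \<in> Inl ` inner_edge_pts G" if z: "z \<in> ?U" "z \<in> ?V" for z
  proof (rule ccontr)
    assume n: "z \<notin> Inl ` inner_edge_pts G"
    obtain p where p: "z = Inl p" "p \<in> touch {v}" using z(1) by blast
    then have "p \<in> complex_pts G" by (simp add: touch_def)
    then obtain u where u: "p = vertex_pt u" using n p(1) by (auto simp: complex_pts_def)
    then have "u = v" using p(2) touch_vertex_iff by simp
    moreover obtain C where "C \<in> comps G {v}" "u \<in> C"
      using z(2) unfolding p(1) u vertex_in_basic by blast
    ultimately show False using comps_subset by blast
  qed
  then have "?U \<inter> ?V \<subseteq> Inl ` inner_edge_pts G" by (intro subsetI) simp
  moreover have "Inl (vertex_pt v) \<in> ?U" using v touch_vertex_iff by simp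
  moreover have "Inr s \<in> ?V" using s inv_limitD(1)[OF s X] by simp
  ultimately show ?thesis
    using openin_induced_Inl[OF openin_touch] openin_induced_basic[OF X openin_topspace]
    by (intro exI[of _ ?U] exI[of _ ?V] conjI)
qed

text \<open>Distinct threads differ over some X, and disjoint open sets there suffice: a common
  vertex would lie in a single component whose image belongs to both sets, and a common limit point
  would have its coordinate over X in both.\<close>

lemma limit_limit_separated:
  assumes A: "C_system G A" and s: "s \<in> inv_limit G A" "t \<in> inv_limit G A" "s \<noteq> t"
  shows "\<exists>U V. openin (induced_space G A) U \<and> openin (induced_space G A) V \<and>
      Inr s \<in> U \<and> Inr t \<in> V \<and> U \<inter> V \<subseteq> Inl ` inner_edge_pts G"
proof -
  obtain X where X: "X \<in> fin_subsets G" "s X \<noteq> t X"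
    using s extensionalityI[OF inv_limitD(3)[OF s(1)] inv_limitD(3)[OF s(2)]] by blast
  obtain P Q where PQ: "openin (csp A X) P" "openin (csp A X) Q" "s X \<in> P" "t X \<in> Q" "disjnt P Q"
    using C_system_space(1)[OF A X(1)] X(2) inv_limitD(1)[OF s(1) X(1)] inv_limitD(1)[OF s(2) X(1)]
    unfolding Hausdorff_space_def by blast
  let ?U = "basic A X P" and ?V = "basic A X Q"
  have "z \<in> Inl ` inner_edge_pts G" if z: "z \<in> ?U" "z \<in> ?V" for z
  proof (rule ccontr)
    assume n: "z \<notin> Inl ` inner_edge_pts G"
    show False
    proof (cases z)
      case (Inl p)
      then have "p \<in> complex_pts G" using z(1) by (simp add: Inl_in_basic)
      then obtain u where u: "p = vertex_pt u" using n Inl by (auto simp: complex_pts_def)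
      obtain C where C: "C \<in> comps G X" "cemb A X C \<in> P" "u \<in> C"
        using z(1) unfolding Inl u vertex_in_basic by blast
      obtain D where D: "D \<in> comps G X" "cemb A X D \<in> Q" "u \<in> D"
        using z(2) unfolding Inl u vertex_in_basic by blast
      have "C = D" using comps_eqI[OF C(1) D(1) C(3) D(3)] .
      then show False using C(2) D(2) PQ(5) by (auto simp: disjnt_iff)
    next
      case (Inr r)
      then show False using z PQ(5) by (auto simp: disjnt_iff)
    qed
  qed
  then have "?U \<inter> ?V \<subseteq> Inl ` inner_edge_pts G" by (intro subsetI) simp
  moreover have "Inr s \<in> ?U" "Inr t \<in> ?V" using s PQ by simp_all
  ultimately show ?thesis
    using openin_induced_basic[OF X(1)] PQ(1,2) by (intro exI[of _ ?U] exI[of _ ?V] conjI)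
qed

lemma Hausdorff_space_induced:
  assumes A: "C_system G A"
  shows "Hausdorff_space (subtopology (induced_space G A)
    (topspace (induced_space G A) - Inl ` inner_edge_pts G))"
    (is "Hausdorff_space (subtopology ?T ?N)")
  unfolding Hausdorff_space_def
proof (intro allI impI)
  fix x y assume "x \<in> topspace (subtopology ?T ?N) \<and> y \<in> topspace (subtopology ?T ?N) \<and> x \<noteq> y"
  then have x: "x \<in> topspace ?T" "x \<notin> Inl ` inner_edge_pts G"
    and y: "y \<in> topspace ?T" "y \<notin> Inl ` inner_edge_pts G" and ne: "x \<noteq> y" by auto
  have "\<exists>U V. openin ?T U \<and> openin ?T V \<and> x \<in> U \<and> y \<in> V \<and> U \<inter> V \<subseteq> Inl ` inner_edge_pts G"
    using x
  proof (cases rule: non_inner_cases)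
    case xv: (vertex v)
    from y show ?thesis
    proof (cases rule: non_inner_cases)
      case (vertex w)
      then have "v \<noteq> w" using ne xv by blast
      have "p \<in> inner_edge_pts G" if "p \<in> touch {v}" "p \<in> touch {w}" for p
      proof (rule ccontr)
        assume "p \<notin> inner_edge_pts G"
        moreover have "p \<in> complex_pts G" using that(1) by (simp add: touch_def)
        ultimately obtain u where "p = vertex_pt u" by (auto simp: complex_pts_def)
        then show False using that \<open>v \<noteq> w\<close> touch_vertex_iff by simp
      qed
      then have "Inl ` touch {v} \<inter> Inl ` touch {w} \<subseteq> Inl ` inner_edge_pts G" by blast
      moreover have "x \<in> Inl ` touch {v}" "y \<in> Inl ` touch {w}"
        using xv vertex touch_vertex_iff by simp_all
      ultimately show ?thesis
        using openin_induced_Inl[OF openin_touch]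
        by (intro exI[of _ "Inl ` touch {v}"] exI[of _ "Inl ` touch {w}"] conjI)
    next
      case (limit s)
      show ?thesis using vertex_limit_separated[OF xv(1) limit(1)] unfolding xv(2) limit(2) .
    qed
  next
    case xs: (limit s)
    from y show ?thesis
    proof (cases rule: non_inner_cases)
      case (vertex w)
      obtain U V where UV: "openin ?T U" "openin ?T V" "Inl (vertex_pt w) \<in> U" "Inr s \<in> V"
        "U \<inter> V \<subseteq> Inl ` inner_edge_pts G"
        using vertex_limit_separated[OF vertex(1) xs(1)] by (elim exE conjE)
      then show ?thesis unfolding xs(2) vertex(2)
        by (intro exI[of _ V] exI[of _ U] conjI) (simp_all add: Int_commute)
    next
      case (limit t)
      then have "s \<noteq> t" using ne xs by blast
      from limit_limit_separated[OF A xs(1) limit(1) this] show ?thesis unfolding xs(2) limit(2) .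
    qed
  qed
  then obtain U V where UV: "openin ?T U" "openin ?T V" "x \<in> U" "y \<in> V"
    "U \<inter> V \<subseteq> Inl ` inner_edge_pts G" by (elim exE conjE)
  have "openin (subtopology ?T ?N) (U \<inter> ?N)" "openin (subtopology ?T ?N) (V \<inter> ?N)"
    using UV openin_subtopology by blast+
  moreover have "disjnt (U \<inter> ?N) (V \<inter> ?N)" using UV(5) by (auto simp: disjnt_iff)
  moreover have "x \<in> U \<inter> ?N" "y \<in> V \<inter> ?N" using UV x y by auto
  ultimately show "\<exists>U V. openin (subtopology ?T ?N) U \<and> openin (subtopology ?T ?N) V \<and>
      x \<in> U \<and> y \<in> V \<and> disjnt U V"
    by (intro exI[of _ "U \<inter> ?N"] exI[of _ "V \<inter> ?N"] conjI)
qed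

section \<open>Embedding the ends\<close>

definition end_nbhd :: "'v set \<Rightarrow> 'v set \<Rightarrow> (('v \<Rightarrow> real) + (nat \<Rightarrow> 'v) set) set" where
  "end_nbhd X C = Inl ` touch C \<union> Inr ` {\<omega> \<in> ends G. end_comp G X \<omega> = C}"

definition end_basis :: "(('v \<Rightarrow> real) + (nat \<Rightarrow> 'v) set) set set" where
  "end_basis = {Inl ` U | U. openin (one_complex G) U} \<union>
     {end_nbhd X (end_comp G X \<omega>) | X \<omega>. X \<in> fin_subsets G \<and> \<omega> \<in> ends G}"

lemma end_space_eq: "end_space G = topology_generated_by end_basis"
proof -
  have eq: "Inl ` (complex_pts (induced_subgraph G C) \<union> inner_between G X C)
      \<union> Inr ` {\<omega>' \<in> ends G. end_comp G X \<omega>' = C} = end_nbhd X C"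
    if "X \<in> fin_subsets G" "\<omega> \<in> ends G" "C = end_comp G X \<omega>" for X C \<omega>
    using basic_nbhd_eq_touch[of "{C}" X] end_comp_in(1) that by (simp add: end_nbhd_def)
  have "{Inl ` (complex_pts (induced_subgraph G C) \<union> inner_between G X C)
           \<union> Inr ` {\<omega>' \<in> ends G. end_comp G X \<omega>' = C} | X C \<omega>.
           X \<in> fin_subsets G \<and> \<omega> \<in> ends G \<and> C = end_comp G X \<omega>} =
    {end_nbhd X (end_comp G X \<omega>) | X \<omega>. X \<in> fin_subsets G \<and> \<omega> \<in> ends G}" (is "?L = ?R")
  proof (intro equalityI subsetI)
    fix B assume "B \<in> ?L"
    then obtain X C \<omega> where B: "B = Inl ` (complex_pts (induced_subgraph G C) \<union> inner_between G X C)
           \<union> Inr ` {\<omega>' \<in> ends G. end_comp G X \<omega>' = C}"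
      and X: "X \<in> fin_subsets G" "\<omega> \<in> ends G" "C = end_comp G X \<omega>" by (elim CollectE exE conjE)
    then show "B \<in> ?R" unfolding B eq[OF X] by (intro CollectI exI[of _ X] exI[of _ \<omega>]) simp
  next
    fix B assume "B \<in> ?R"
    then obtain X \<omega> where B: "B = end_nbhd X (end_comp G X \<omega>)"
      and X: "X \<in> fin_subsets G" "\<omega> \<in> ends G" by (elim CollectE exE conjE)
    show "B \<in> ?L" unfolding B eq[OF X refl, symmetric]
      using X by (intro CollectI exI[of _ X] exI[of _ "end_comp G X \<omega>"] exI[of _ \<omega>]) simp
  qed
  then show ?thesis unfolding end_space_def end_basis_def by (simp only:)
qed

lemma end_basis_cases [consumes 1, case_names complex tail]:
  assumes "B \<in> end_basis"
  obtains U where "openin (one_complex G) U" "B = Inl ` U"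
  | X \<omega> where "X \<in> fin_subsets G" "\<omega> \<in> ends G" "B = end_nbhd X (end_comp G X \<omega>)"
  using assms unfolding end_basis_def by (elim UnE CollectE exE conjE) simp_all

lemma openin_end_Inl: "openin (one_complex G) U \<Longrightarrow> openin (end_space G) (Inl ` U)"
  unfolding end_space_eq by (rule topology_generated_by_Basis) (auto simp: end_basis_def)

lemma openin_end_nbhd:
  "X \<in> fin_subsets G \<Longrightarrow> \<omega> \<in> ends G \<Longrightarrow> openin (end_space G) (end_nbhd X (end_comp G X \<omega>))"
  unfolding end_space_eq by (rule topology_generated_by_Basis) (auto simp: end_basis_def)

lemma topspace_end_space: "topspace (end_space G) = Inl ` complex_pts G \<union> Inr ` ends G"
proof (intro equalityI subsetI)
  fix z assume "z \<in> topspace (end_space G)"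
  then obtain B where B: "B \<in> end_basis" "z \<in> B"
    unfolding end_space_eq topology_generated_by_topspace by (elim UnionE)
  from B(1) show "z \<in> Inl ` complex_pts G \<union> Inr ` ends G"
  proof (cases rule: end_basis_cases)
    case (complex U)
    then have "U \<subseteq> complex_pts G" using openin_subset topspace_one_complex by metis
    then show ?thesis using B(2) complex by blast
  next
    case (tail X \<omega>)
    then show ?thesis using B(2) unfolding end_nbhd_def touch_def by auto
  qed
next
  fix z assume "z \<in> Inl ` complex_pts G \<union> Inr ` ends G"
  then consider "z \<in> Inl ` complex_pts G" | \<omega> where "z = Inr \<omega>" "\<omega> \<in> ends G" by blast
  then show "z \<in> topspace (end_space G)"
  proof cases
    case 1
    have "openin (one_complex G) (complex_pts G)" using openin_topspace topspace_one_complex by metis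
    then show ?thesis using openin_subset[OF openin_end_Inl] 1 by blast
  next
    case (2 \<omega>)
    then have "z \<in> end_nbhd {} (end_comp G {} \<omega>)" by (simp add: end_nbhd_def)
    then show ?thesis
      using openin_subset[OF openin_end_nbhd[OF empty_fin_subset 2(2)]] by blast
  qed
qed

lemma end_embed_simps [simp]:
  "end_embed G A (Inl p) = Inl p" "end_embed G A (Inr \<omega>) = Inr (end_thread G A \<omega>)"
  by (simp_all add: end_embed_def)

lemma end_thread_apply: "X \<in> fin_subsets G \<Longrightarrow> end_thread G A \<omega> X = cemb A X (end_comp G X \<omega>)"
  by (simp add: end_thread_def)

lemma end_thread_in:
  assumes A: "C_system G A" and \<omega>: "\<omega> \<in> ends G"
  shows "end_thread G A \<omega> \<in> inv_limit G A"
proof -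
  have "cbond A X' X (end_thread G A \<omega> X') = end_thread G A \<omega> X"
    if X: "X \<in> fin_subsets G" "X' \<in> fin_subsets G" "X \<subseteq> X'" for X X'
    using C_system_bond(2)[OF A X(2,3) end_comp_in(1)[OF \<omega> X(2)]] end_comp_mono[OF \<omega> X(2,3)] X
    by (simp add: end_thread_apply)
  moreover have "end_thread G A \<omega> \<in> (\<Pi>\<^sub>E X \<in> fin_subsets G. topspace (csp A X))"
    unfolding end_thread_def using C_system_space(4)[OF A] end_comp_in(1)[OF \<omega>] by auto
  ultimately show ?thesis unfolding inv_limit_def by simp
qed

lemma end_embed_into:
  "C_system G A \<Longrightarrow> z \<in> topspace (end_space G) \<Longrightarrow> end_embed G A z \<in> topspace (induced_space G A)"
  using end_thread_in[of A] unfolding topspace_end_space topspace_induced by (cases z) auto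

lemma inj_end_embed:
  assumes A: "C_system G A"
  shows "inj_on (end_embed G A) (topspace (end_space G))"
proof (rule inj_onI)
  have thread: "\<omega> = \<omega>'" if \<omega>: "\<omega> \<in> ends G" "\<omega>' \<in> ends G" and eq: "end_thread G A \<omega> = end_thread G A \<omega>'"
    for \<omega> \<omega>'
  proof (rule ends_eqI[OF \<omega>])
    fix X assume X: "X \<in> fin_subsets G"
    then have "cemb A X (end_comp G X \<omega>) = cemb A X (end_comp G X \<omega>')"
      using fun_cong[OF eq, of X] by (simp add: end_thread_apply)
    then show "end_comp G X \<omega> = end_comp G X \<omega>'"
      using inj_onD[OF C_system_space(6)[OF A X]] end_comp_in(1)[OF _ X] \<omega> by blast
  qed
  fix x y assume "x \<in> topspace (end_space G)" "y \<in> topspace (end_space G)"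
    "end_embed G A x = end_embed G A y"
  then show "x = y"
    using thread unfolding topspace_end_space by (cases x; cases y) (simp_all add: image_iff)
qed

lemma continuous_map_end_embed:
  assumes A: "C_system G A"
  shows "continuous_map (end_space G) (induced_space G A) (end_embed G A)"
  unfolding induced_space_eq continuous_on_generated_topo_iff
proof (intro conjI allI impI)
  show "end_embed G A ` topspace (end_space G) \<subseteq> \<Union>(induced_basis A)"
    using end_embed_into[OF A] unfolding induced_space_eq topology_generated_by_topspace by blast
  fix B assume "B \<in> induced_basis A"
  then show "openin (end_space G) (end_embed G A -` B \<inter> topspace (end_space G))"
  proof (cases rule: induced_basis_cases)
    case (complex U)
    have "z \<in> end_embed G A -` B \<longleftrightarrow> z \<in> Inl ` U" for z
      unfolding complex(2) by (cases z) auto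
    then have "end_embed G A -` B = Inl ` U" by blast
    then show ?thesis using openin_end_Inl[OF complex(1)] by (auto intro: openin_Int)
  next
    case (basic X W)
    let ?E = "{\<omega> \<in> ends G. cemb A X (end_comp G X \<omega>) \<in> W}"
    let ?t = "touch (\<Union>{C \<in> comps G X. cemb A X C \<in> W})"
    have in_iff: "z \<in> end_embed G A -` B \<inter> topspace (end_space G) \<longleftrightarrow> z \<in> Inl ` ?t \<union> Inr ` ?E" for z
    proof (cases z)
      case (Inl p)
      have "p \<in> ?t \<Longrightarrow> p \<in> complex_pts G" by (simp add: touch_def)
      then show ?thesis unfolding Inl basic(3) topspace_end_space basic_def by auto
    next
      case (Inr \<omega>)
      then show ?thesis unfolding Inr basic(3) topspace_end_space
        using end_thread_in[OF A] basic(1) by (auto simp: end_thread_apply)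
    qed
    have sub: "end_nbhd X (end_comp G X \<omega>) \<subseteq> Inl ` ?t \<union> Inr ` ?E" if \<omega>: "\<omega> \<in> ?E" for \<omega>
    proof -
      have "touch (end_comp G X \<omega>) \<subseteq> ?t"
        using end_comp_in(1)[OF _ basic(1)] \<omega> by (intro touch_mono) blast
      moreover have "{\<omega>' \<in> ends G. end_comp G X \<omega>' = end_comp G X \<omega>} \<subseteq> ?E" using \<omega> by auto
      ultimately show ?thesis unfolding end_nbhd_def by blast
    qed
    \<comment> \<open>An end neighbourhood covers only one component, so those of all ends involved
      are united. The open set \<open>?t\<close> accounts for the 1-complex, including components in
      which no end lives.\<close>
    have "Inl ` ?t \<union> Inr ` ?E = Inl ` ?t \<union> (\<Union>\<omega>\<in>?E. end_nbhd X (end_comp G X \<omega>))"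
    proof (intro equalityI Un_least)
      have "Inr \<omega> \<in> end_nbhd X (end_comp G X \<omega>)" if "\<omega> \<in> ?E" for \<omega>
        using that by (simp add: end_nbhd_def)
      then show "Inr ` ?E \<subseteq> Inl ` ?t \<union> (\<Union>\<omega>\<in>?E. end_nbhd X (end_comp G X \<omega>))" by blast
      show "(\<Union>\<omega>\<in>?E. end_nbhd X (end_comp G X \<omega>)) \<subseteq> Inl ` ?t \<union> Inr ` ?E"
        using sub by (rule UN_least)
    qed simp_all
    moreover have "openin (end_space G) (Inl ` ?t \<union> (\<Union>\<omega>\<in>?E. end_nbhd X (end_comp G X \<omega>)))"
      using openin_end_nbhd[OF basic(1)] openin_end_Inl[OF openin_touch]
      by (intro openin_Un openin_Union) auto
    moreover have "end_embed G A -` B \<inter> topspace (end_space G) = Inl ` ?t \<union> Inr ` ?E"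
      using in_iff by (rule set_eqI)
    ultimately show ?thesis by simp
  qed
qed

text \<open>The image of a component is isolated, so its singleton is an admissible open set. The
  basic set over this singleton meets the image of the end space exactly in the image of the end
  neighbourhood.\<close>

lemma end_embed_open_basis:
  assumes A: "C_system G A" and B: "B \<in> end_basis"
  shows "openin (subtopology (induced_space G A) (end_embed G A ` topspace (end_space G)))
    (end_embed G A ` B)" (is "openin (subtopology ?T ?R) _")
  using B
proof (cases rule: end_basis_cases)
  case (complex U)
  have "U \<subseteq> complex_pts G" using openin_subset[OF complex(1)] topspace_one_complex by simp
  then have "end_embed G A ` B = Inl ` U \<inter> ?R"
    unfolding complex(2) topspace_end_space by (auto simp: image_image image_Un)
  then show ?thesis using openin_induced_Inl[OF complex(1)] unfolding openin_subtopology by blast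
next
  case (tail X \<omega>)
  let ?C = "end_comp G X \<omega>"
  have C: "?C \<in> comps G X" using end_comp_in(1)[OF tail(2,1)] .
  note inj = C_system_space(6)[OF A tail(1)]
  have "{D \<in> comps G X. cemb A X D \<in> {cemb A X ?C}} = {?C}" using inj C by (auto dest: inj_onD)
  then have basic: "basic A X {cemb A X ?C} = Inl ` touch ?C \<union> Inr ` {s \<in> inv_limit G A. s X = cemb A X ?C}"
    unfolding basic_def by simp
  have "y \<in> end_embed G A ` B \<longleftrightarrow> y \<in> basic A X {cemb A X ?C} \<inter> ?R" for y
  proof
    assume "y \<in> end_embed G A ` B"
    then obtain z where z: "z \<in> B" "y = end_embed G A z" by blast
    then show "y \<in> basic A X {cemb A X ?C} \<inter> ?R"
      unfolding basic tail(3) end_nbhd_def topspace_end_space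
      using end_thread_in[OF A] tail(1) by (auto simp: touch_def end_thread_apply)
  next
    assume y: "y \<in> basic A X {cemb A X ?C} \<inter> ?R"
    then obtain z where z: "z \<in> topspace (end_space G)" "y = end_embed G A z" by blast
    have "z \<in> B"
    proof (cases z)
      case (Inl p)
      then show ?thesis using y z(2) unfolding basic tail(3) end_nbhd_def by auto
    next
      case (Inr \<omega>')
      then have \<omega>': "\<omega>' \<in> ends G" using z(1) unfolding topspace_end_space by blast
      have "cemb A X (end_comp G X \<omega>') = cemb A X ?C"
        using y z(2) Inr tail(1) unfolding basic by (auto simp: end_thread_apply)
      then have "end_comp G X \<omega>' = ?C" using inj_onD[OF inj] C end_comp_in(1)[OF \<omega>' tail(1)] by blast
      then show ?thesis using Inr \<omega>' unfolding tail(3) end_nbhd_def by simp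
    qed
    then show "y \<in> end_embed G A ` B" using z(2) by blast
  qed
  then have "end_embed G A ` B = basic A X {cemb A X ?C} \<inter> ?R" by (rule set_eqI)
  then show ?thesis
    using openin_induced_basic[OF tail(1) C_system_space(7)[OF A tail(1) C]]
    unfolding openin_subtopology by blast
qed

lemma embedding_map_end_embed:
  assumes A: "C_system G A"
  shows "embedding_map (end_space G) (induced_space G A) (end_embed G A)"
proof -
  let ?S = "topspace (end_space G)" and ?h = "end_embed G A"
  let ?R = "subtopology (induced_space G A) (?h ` ?S)"
  let ?g = "inv_into ?S ?h"
  note inj = inj_end_embed[OF A]
  have topR: "topspace ?R = ?h ` ?S" using end_embed_into[OF A] by auto
  have "continuous_map (end_space G) ?R ?h"
    using continuous_map_end_embed[OF A] by (intro continuous_map_into_subtopology) auto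
  moreover have "continuous_map ?R (topology_generated_by end_basis) ?g"
    unfolding continuous_on_generated_topo_iff
  proof (intro conjI allI impI)
    have S: "\<Union>end_basis = ?S" unfolding end_space_eq topology_generated_by_topspace ..
    show "?g ` topspace ?R \<subseteq> \<Union>end_basis"
      unfolding topR S by (auto intro: inv_into_into)
    fix B assume B: "B \<in> end_basis"
    then have "B \<subseteq> ?S" using S by blast
    then have "y \<in> ?g -` B \<inter> topspace ?R \<longleftrightarrow> y \<in> ?h ` B" for y
      unfolding topR using inj by (auto simp: subset_iff)
    then have "?g -` B \<inter> topspace ?R = ?h ` B" by (rule set_eqI)
    then show "openin ?R (?g -` B \<inter> topspace ?R)" using end_embed_open_basis[OF A B] by simp
  qed
  then have "continuous_map ?R (end_space G) ?g" by (simp only: end_space_eq[symmetric])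
  moreover have "\<forall>x \<in> ?S. ?g (?h x) = x" using inj by simp
  moreover have "\<forall>y \<in> topspace ?R. ?h (?g y) = y" unfolding topR by (simp add: f_inv_into_f)
  ultimately have "homeomorphic_maps (end_space G) ?R ?h ?g" unfolding homeomorphic_maps_def by simp
  then show ?thesis unfolding embedding_map_def homeomorphic_map_maps by blast
qed

lemma induced_Omega_compactification:
  assumes A: "C_system G A"
  shows "Omega_compactification G (induced_space G A) (end_embed G A)"
proof -
  have "z \<in> induced_space G A closure_of (end_embed G A ` topspace (end_space G))"
    if z: "z \<in> topspace (induced_space G A)" for z
    unfolding in_closure_of
  proof (intro conjI allI impI z)
    fix W assume W: "z \<in> W \<and> openin (induced_space G A) W"
    show "\<exists>y. y \<in> end_embed G A ` topspace (end_space G) \<and> y \<in> W"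
    proof (cases z)
      case (Inl p)
      then have "p \<in> complex_pts G" using z unfolding topspace_induced by blast
      then have "Inl p \<in> end_embed G A ` topspace (end_space G)"
        unfolding topspace_end_space by (intro image_eqI[of _ _ "Inl p"]) auto
      then show ?thesis using W Inl by blast
    next
      case (Inr s)
      then obtain v where v: "v \<in> verts G" "Inl (vertex_pt v) \<in> W"
        using induced_nbhd_vertex[OF A _ _ empty_fin_subset, of W s] W by blast
      then have "Inl (vertex_pt v) \<in> end_embed G A ` topspace (end_space G)"
        unfolding topspace_end_space complex_pts_def
        by (intro image_eqI[of _ _ "Inl (vertex_pt v)"]) auto
      then show ?thesis using v by blast
    qed
  qed
  then have "induced_space G A closure_of (end_embed G A ` topspace (end_space G)) =
      topspace (induced_space G A)"
    by (intro subset_antisym closure_of_subset_topspace subsetI)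
  moreover have "end_embed G A ` Inl ` inner_edge_pts G = Inl ` inner_edge_pts G"
    by (simp add: image_image)
  ultimately show ?thesis
    unfolding Omega_compactification_def compactification_def
    using compact_space_induced[OF A] embedding_map_end_embed[OF A] Hausdorff_space_induced[OF A]
    by simp
qed

section \<open>Comparing induced spaces\<close>

lemma C_le_imp_induced_le:
  assumes A: "C_system G A" and D: "C_system G D" and le: "C_le G A D"
  shows "induced_le G A D"
proof -
  obtain f where f: "\<And>X. X \<in> fin_subsets G \<Longrightarrow>
        le_witness (comps G X) (csp A X) (cemb A X) (csp D X) (cemb D X) (f X)"
    and comm: "\<And>X X' p. X \<in> fin_subsets G \<Longrightarrow> X' \<in> fin_subsets G \<Longrightarrow> X \<subseteq> X' \<Longrightarrow>
        p \<in> topspace (csp D X') \<Longrightarrow> f X (cbond D X' X p) = cbond A X' X (f X' p)"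
  proof -
    from le[unfolded C_le_def] obtain f where
      "\<forall>X \<in> fin_subsets G. le_witness (comps G X) (csp A X) (cemb A X) (csp D X) (cemb D X) (f X)"
      "\<forall>X \<in> fin_subsets G. \<forall>X' \<in> fin_subsets G. X \<subseteq> X' \<longrightarrow>
        (\<forall>p \<in> topspace (csp D X'). f X (cbond D X' X p) = cbond A X' X (f X' p))"
      by (elim exE conjE)
    then show thesis by (intro that[of f]) simp_all
  qed
  have cont: "continuous_map (csp D X) (csp A X) (f X)"
    and fe: "\<And>C. C \<in> comps G X \<Longrightarrow> f X (cemb D X C) = cemb A X C" if "X \<in> fin_subsets G" for X
    using f[OF that] by (simp_all add: le_witness_def)
  define F where "F = map_sum (\<lambda>p :: 'v \<Rightarrow> real. p) (\<lambda>s. \<lambda>X \<in> fin_subsets G. f X (s X))"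
  have F_simps: "F (Inl p) = Inl p" "F (Inr s) = Inr (\<lambda>X \<in> fin_subsets G. f X (s X))" for p s
    by (simp_all add: F_def)
  have F_lim: "(\<lambda>X \<in> fin_subsets G. f X (s X)) \<in> inv_limit G A" if s: "s \<in> inv_limit G D" for s
  proof -
    have "f X (s X) \<in> topspace (csp A X)" if X: "X \<in> fin_subsets G" for X
      using continuous_map_image_subset_topspace[OF cont[OF X]] inv_limitD(1)[OF s X] by blast
    moreover have "cbond A X' X (f X' (s X')) = f X (s X)"
      if X: "X \<in> fin_subsets G" "X' \<in> fin_subsets G" "X \<subseteq> X'" for X X'
      using comm[OF X inv_limitD(1)[OF s X(2)]] inv_limitD(2)[OF s X(2,3)] by simp
    ultimately show ?thesis unfolding inv_limit_def by simp
  qed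
  have F_into: "F z \<in> topspace (induced_space G A)" if "z \<in> topspace (induced_space G D)" for z
    using that F_lim unfolding topspace_induced by (cases z) (auto simp: F_simps)
  have "continuous_map (induced_space G D) (induced_space G A) F"
    unfolding induced_space_eq[of A] continuous_on_generated_topo_iff
  proof (intro conjI allI impI)
    show "F ` topspace (induced_space G D) \<subseteq> \<Union>(induced_basis A)"
      using F_into unfolding induced_space_eq[of A] topology_generated_by_topspace by blast
    fix B assume "B \<in> induced_basis A"
    then show "openin (induced_space G D) (F -` B \<inter> topspace (induced_space G D))"
    proof (cases rule: induced_basis_cases)
      case (complex U)
      have "z \<in> F -` B \<longleftrightarrow> z \<in> Inl ` U" for z
        unfolding complex(2) by (cases z) (auto simp: F_simps)
      then have "F -` B = Inl ` U" by blast
      then show ?thesis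
        using openin_Int[OF openin_induced_Inl[OF complex(1), of D] openin_topspace] by simp
    next
      case (basic X W)
      let ?W = "{q \<in> topspace (csp D X). f X q \<in> W}"
      have open_W: "openin (csp D X) ?W"
        using openin_continuous_map_preimage[OF cont[OF basic(1)] basic(2)] .
      \<comment> \<open>Because \<open>f X\<close> respects the embedded components, the preimage of
        a basic set is exactly the basic set over the preimage of W, on the 1-complex as well as on
        threads.\<close>
      have "z \<in> F -` B \<inter> topspace (induced_space G D) \<longleftrightarrow> z \<in> basic D X ?W" for z
      proof (cases z)
        case (Inl p)
        have "cemb A X C \<in> W \<longleftrightarrow> cemb D X C \<in> ?W" if "C \<in> comps G X" for C
          using that C_system_space(4)[OF D basic(1)] fe[OF basic(1)] by simp
        then show ?thesis
          unfolding Inl basic(3) topspace_induced by (auto simp: F_simps Inl_in_basic)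
      next
        case (Inr s)
        then show ?thesis
          unfolding basic(3) topspace_induced
          using F_lim inv_limitD(1)[of s D X] basic(1) by (auto simp: F_simps)
      qed
      then have "F -` B \<inter> topspace (induced_space G D) = basic D X ?W" by (rule set_eqI)
      then show ?thesis using openin_induced_basic[OF basic(1) open_W] by simp
    qed
  qed
  moreover have "F (end_embed G D x) = end_embed G A x" if "x \<in> Inl ` complex_pts G \<union> Inr ` ends G" for x
  proof (cases x)
    case (Inr \<omega>)
    then have \<omega>: "\<omega> \<in> ends G" using that by blast
    have "(\<lambda>X \<in> fin_subsets G. f X (end_thread G D \<omega> X)) = end_thread G A \<omega>"
    proof
      fix X
      show "(\<lambda>X \<in> fin_subsets G. f X (end_thread G D \<omega> X)) X = end_thread G A \<omega> X"
        using fe end_comp_in(1)[OF \<omega>] by (simp add: end_thread_def)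
    qed
    then show ?thesis using Inr by (simp add: F_simps)
  qed (simp add: F_simps)
  ultimately show ?thesis unfolding induced_le_def le_witness_def by blast
qed

text \<open>
  The open star of a vertex \<open>u\<close> contains no other vertex, whereas every neighbourhood of a limit
  point contains a vertex other than \<open>u\<close>.
\<close>

lemma limit_to_limit:
  assumes D: "C_system G D"
    and g: "continuous_map (induced_space G D) (induced_space G A) g"
    and fix_g: "\<And>p. p \<in> complex_pts G \<Longrightarrow> g (Inl p) = Inl p"
    and s: "s \<in> inv_limit G D"
  shows "\<exists>t \<in> inv_limit G A. g (Inr s) = Inr t"
proof -
  have sT: "Inr s \<in> topspace (induced_space G D)" using s by (simp add: topspace_induced)
  then have gs: "g (Inr s) \<in> topspace (induced_space G A)"
    using continuous_map_image_subset_topspace[OF g] by blast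
  show ?thesis
  proof (cases "g (Inr s)")
    case (Inl p)
    then have p: "p \<in> complex_pts G" using gs unfolding topspace_induced by auto
    obtain u where u: "u \<in> verts G" "p u \<noteq> 0" using complex_support[OF p] .
    \<comment> \<open>The vertex u is in the support of p, so its open star is a neighbourhood of
      p.\<close>
    let ?W = "{z \<in> topspace (induced_space G D). g z \<in> Inl ` touch {u}}"
    have "openin (induced_space G D) ?W"
      using openin_continuous_map_preimage[OF g openin_induced_Inl[OF openin_touch]] .
    moreover have "Inr s \<in> ?W" using sT p u Inl by (simp add: touch_def)
    moreover have "{u} \<in> fin_subsets G" using u by (simp add: fin_subsets_def)
    ultimately obtain v where v: "v \<in> verts G - {u}" "Inl (vertex_pt v) \<in> ?W"
      using induced_nbhd_vertex[OF D] by blast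
    then have "Inl (vertex_pt v) \<in> (Inl ` touch {u} :: (('v \<Rightarrow> real) + ('v set \<Rightarrow> 'b)) set)"
      using fix_g[of "vertex_pt v"] by (simp add: complex_pts_def)
    then have "vertex_pt v \<in> touch {u}" by blast
    then show ?thesis using v(1) touch_vertex_iff by blast
  next
    case (Inr t)
    then have "t \<in> inv_limit G A" using gs unfolding topspace_induced by auto
    then show ?thesis using Inr by blast
  qed
qed

text \<open>If a limit point were moved, open sets around it and its image would meet only in inner
  points of edges. By continuity some vertex near the limit point is mapped into the second set; it
  is fixed, so it lies in both, but a vertex is never an inner point.\<close>

lemma induced_endomorphism_id:
  assumes A: "C_system G A"
    and k: "continuous_map (induced_space G A) (induced_space G A) k"
    and fix_k: "\<And>p. p \<in> complex_pts G \<Longrightarrow> k (Inl p) = Inl p"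
    and z: "z \<in> topspace (induced_space G A)"
  shows "k z = z"
proof (cases z)
  case (Inl p)
  then show ?thesis using z fix_k unfolding topspace_induced by blast
next
  case (Inr s)
  then have s: "s \<in> inv_limit G A" using z unfolding topspace_induced by blast
  obtain t where t: "t \<in> inv_limit G A" "k (Inr s) = Inr t" using limit_to_limit[OF A k fix_k s] by blast
  have "s = t"
  proof (rule ccontr)
    assume "s \<noteq> t"
    from limit_limit_separated[OF A s t(1) this]
    obtain U V where UV: "openin (induced_space G A) U" "openin (induced_space G A) V"
      "Inr s \<in> U" "Inr t \<in> V" "U \<inter> V \<subseteq> Inl ` inner_edge_pts G"
      by (elim exE conjE)
    let ?W = "U \<inter> {z \<in> topspace (induced_space G A). k z \<in> V}"
    have "openin (induced_space G A) ?W"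
      using UV(1) openin_continuous_map_preimage[OF k UV(2)] by (rule openin_Int)
    moreover have "Inr s \<in> ?W" using UV z Inr t(2) by simp
    ultimately obtain v where v: "v \<in> verts G" "Inl (vertex_pt v) \<in> ?W"
      using induced_nbhd_vertex[OF A _ _ empty_fin_subset] by blast
    then have "Inl (vertex_pt v) \<in> U \<inter> V" using fix_k[of "vertex_pt v"] by (simp add: complex_pts_def)
    then show False using UV(5) vertex_notin_inner by blast
  qed
  then show ?thesis using t Inr by simp
qed

text \<open>Both composites fix every point of the 1-complex and are therefore identities; so a
  comparison map in one direction is already the required homeomorphism.\<close>

lemma induced_le_antisym:
  assumes A: "C_system G A" and D: "C_system G D" and le: "induced_le G A D" "induced_le G D A"
  shows "induced_equivalent G A D"
proof -
  obtain f where f: "continuous_map (induced_space G D) (induced_space G A) f"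
    and fx: "\<forall>x \<in> Inl ` complex_pts G \<union> Inr ` ends G. f (end_embed G D x) = end_embed G A x"
    using le(1) unfolding induced_le_def le_witness_def by blast
  obtain g where g: "continuous_map (induced_space G A) (induced_space G D) g"
    and gx: "\<forall>x \<in> Inl ` complex_pts G \<union> Inr ` ends G. g (end_embed G A x) = end_embed G D x"
    using le(2) unfolding induced_le_def le_witness_def by blast
  have fp: "f (Inl p) = Inl p" and gp: "g (Inl p) = Inl p" if "p \<in> complex_pts G" for p
    using bspec[OF fx, of "Inl p"] bspec[OF gx, of "Inl p"] that by simp_all
  have "g (f z) = z" if "z \<in> topspace (induced_space G D)" for z
    using induced_endomorphism_id[OF D continuous_map_compose[OF f g] _ that] fp gp by simp
  moreover have "f (g z) = z" if "z \<in> topspace (induced_space G A)" for z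
    using induced_endomorphism_id[OF A continuous_map_compose[OF g f] _ that] fp gp by simp
  ultimately have "homeomorphic_maps (induced_space G D) (induced_space G A) f g"
    using f g by (simp add: homeomorphic_maps_def)
  then show ?thesis
    using fx unfolding induced_equivalent_def homeomorphic_map_maps by blast
qed

end

text \<open>Being least or greatest is stated together with uniqueness up to equivalence. For
  systems the latter is the definition of equivalence; for induced spaces it says that comparability
  in both directions yields a homeomorphism fixing the graph and its ends.\<close>

theorem theorem5p4p10:
  fixes G :: "'v ugraph"
  assumes "simple_graph G" and "infinite (verts G)"
  shows
    "(C_system G (C_F G) \<and>
      (\<forall>A :: ('v, 'k) csys. C_system G A \<longrightarrow>
         C_le G (C_F G) A \<and> (C_le G A (C_F G) \<longrightarrow> C_equivalent G A (C_F G)))) \<and>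
     (C_system G (C_U G) \<and>
      (\<forall>A :: ('v, 'k) csys. C_system G A \<longrightarrow>
         C_le G A (C_U G) \<and> (C_le G (C_U G) A \<longrightarrow> C_equivalent G A (C_U G)))) \<and>
     (Omega_compactification G (induced_space G (C_F G)) (end_embed G (C_F G)) \<and>
      (\<forall>A :: ('v, 'k) csys. C_system G A \<longrightarrow>
         induced_le G (C_F G) A \<and>
         (induced_le G A (C_F G) \<longrightarrow> induced_equivalent G A (C_F G)))) \<and>
     (Omega_compactification G (induced_space G (C_U G)) (end_embed G (C_U G)) \<and>
      (\<forall>A :: ('v, 'k) csys. C_system G A \<longrightarrow>
         induced_le G A (C_U G) \<and>
         (induced_le G (C_U G) A \<longrightarrow> induced_equivalent G A (C_U G))))"
proof -
  interpret simple_ugraph G by standard (fact assms(1))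
  note F = C_F_system and U = C_U_system
  have "C_le G (C_F G) A" "C_le G A (C_U G)" if "C_system G A" for A :: "('v, 'k) csys"
    using C_F_le[OF that] C_le_C_U[OF that] .
  moreover from this have "induced_le G (C_F G) A" "induced_le G A (C_U G)"
    if "C_system G A" for A :: "('v, 'k) csys"
    using C_le_imp_induced_le[OF F that] C_le_imp_induced_le[OF that U] that by blast+
  moreover from this have "induced_le G A (C_F G) \<Longrightarrow> induced_equivalent G A (C_F G)"
    "induced_le G (C_U G) A \<Longrightarrow> induced_equivalent G A (C_U G)"
    if "C_system G A" for A :: "('v, 'k) csys"
    using induced_le_antisym[OF that F] induced_le_antisym[OF that U] that by blast+
  ultimately show ?thesis
    unfolding C_equivalent_def
    using F U induced_Omega_compactification[OF F] induced_Omega_compactification[OF U] by blast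
qed

end
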